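(* Suppose the standing assumptions (a)–(e) on problem (P) hold and that Algorithm 1 uses Algorithm 2 in its Step 1 to compute $z^{(k+1)}$ (with the integers $i_k,j_k$ specified in the context). Let $\tau=2L_f$, let $0<\varepsilon<\min\{\sqrt{3L_f},1\}$, let $\delta>0$, let $\Delta_{F_0}=F_0(x^{(0)})-\inf_x F_0(x)$, and let $\overline K_\varepsilon=\lceil 120 L_f\Delta_{F_0}\varepsilon^{-2}\rceil$. Let $\overline\mu_k$ be the quantity defined in the context. Then the following hold. (a) If $[\overline A;A]$ has full row rank and $\mu_k=\overline\mu_k$ for all $k\ge 0$, then Algorithm 1 finds a $(\delta,\varepsilon)$-KKT point of problem (P) with total number $$\mathcal O\left(\kappa([\overline A;A])\,\log\Big(\frac{1}{\delta\varepsilon}\Big)\frac{L_f\Delta_{F_0}}{\varepsilon^2}\right)$$ of inner iterations (i.e., APG steps). (b) If $g(y)=\max\{u^\top y: Cu\le \mathbf d,\ u\in\mathbb R^{\overline n}\}$ for some matrix $C$ and vector $\mathbf d$, and in addition $\overline b=0$, $b=0$, and $\mu_k=\overline\mu_k$ for all $k\ge0$, then the same conclusion as in (a) holds except that the total number of inner iterations becomes $$\mathcal O\left(\sqrt{\lambda_{\max}([\overline A;A][\overline A;A]^\top)\,\theta^2(\overline A,A,C)}\,\log\Big(\frac{1}{\delta\varepsilon}\Big)\frac{L_f\Delta_{F_0}}{\varepsilon^2}\right).$$ (c) If $g(y)=\max\{u^\top y: Cu\le \mathbf d,\ u\in\mathbb R^{\overline n}\}$ for some matrix $C$ and vector $\mathbf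 d$, and in addition the level set $\{(x,y): F(x,y)\le F(x^{(0)},y^{(0)})+1\}$ is compact, and $\mu_k=\frac{1}{(k+1)^2}\overline\mu_k$ for all $k\ge0$, then there exist constants $B_5,B_6$ independent of $\varepsilon$ such that $$\|\nu^{(k)}\|^2\le B_5,\qquad \mathcal D_k(z^{\rm ini})-\mathcal D_k^*\le B_6,\qquad \forall\,0\le k<\overline K_\varepsilon,$$ and the same conclusion as in (a) holds except that the total number of inner iterations becomes $$\mathcal O\left(\sqrt{\lambda_{\max}([\overline A;A][\overline A;A]^\top)\,\theta^2(\overline A,A,\overline b,b,C)\,(1+B_6/\tau+2B_5)}\,\log\Big(\frac{B_6}{\delta\varepsilon}\Big)\frac{L_f\Delta_{F_0}}{\varepsilon^2}\right).$$
   Context: **Problems.** Let $A\in\mathbb R^{n\times d}$, $b\in\mathbb R^n$, $\overline A\in\mathbb R^{\overline n\times d}$, $\overline b\in\mathbb R^{\overline n}$. Problem (P) is $\min_{x\in\mathbb R^d}F_0(x):=f_0(x)+g(\overline Ax+\overline b)$ subject to $Ax+b=0$. Its splitting reformulation (SP) is $\min_{x\in\mathbb R^d,y\in\mathbb R^{\overline n}}F(x,y):=f_0(x)+g(y)$ subject to $Ax+b=0$, $y=\overline Ax+\overline b$. **Standing assumptions.** (a) $f_0:\mathbb R^d\to\mathbb R$ is differentiable and $\nabla f_0$ is $L_f$-Lipschitz continuous ($L_f>0$); (b) $\inf_xF_0(x)>-\infty$; (c) $g:\mathbb R^{\overline n}\to\mathbb R\cup\{+\infty\}$ is proper, lower semicontinuous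 and convex (possibly nonsmooth); (d) $A$ has full row rank and there is a feasible point $x$ of (P) such that $\overline Ax+\overline b$ lies in the relative interior of $\mathrm{dom}(g)$; (e) $g$ is $l_g$-Lipschitz continuous over $\mathrm{dom}(g)$, with $l_g>0$. **Notation.** $[\overline A;A]$ is the matrix obtained by stacking $\overline A$ on top of $A$. $\lambda_{\max}(\cdot)$ and $\lambda^+_{\min}(\cdot)$ are the largest and the smallest positive eigenvalues, and $\kappa(M)=\sqrt{\lambda_{\max}(MM^\top)/\lambda_{\min}^+(MM^\top)}$. $\|\cdot\|$ is the Euclidean/spectral norm. $\mathbf{prox}_{\eta h}(v)=\arg\min_{v'}\{h(v')+\frac1{2\eta}\|v'-v\|^2\}$. $g^\star$ is the convex conjugate of $g$. **KKT points.** $x^*$ is an $\varepsilon$-KKT point of (P) if for some $\gamma\in\mathbb R^n$, $\max\{\mathrm{dist}(0,\nabla f_0(x^* )+A^\top\gamma+\overline A^\top\partial g(\overline Ax^*+\overline b)),\ \|Ax^*+b\|\}\le\varepsilon$. A point $\overline x$ is a $(\delta,\varepsilon)$-KKT point of (P) if $\|\overline x-x^*\|\le\delta$ for some $\varepsilon$-KKT point $x^*$ of (P). **Dual subproblem.** Given $x^{(k)}$ and $\tau>0$, for $z=(z_1^\top,z_2^\top)^\top$ with $z_1\in\mathbb R^{\overline n}$, $z_2\in\mathbb R^n$, let $$\mathcal D_k(z)=\tfrac1{2\tau}\|\overline A^\top z_1+A^\top z_2+\nabla f_0(x^{(k)})-\tau x^{(k)}\|^2+g^\star(z_1)-z_1^\top\overline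 b-z_2^\top b,$$ $\mathcal D_k^*=\min_z\mathcal D_k(z)$ and $\Omega^{(k+1)}=\mathrm{Argmin}_z\mathcal D_k(z)$. **Algorithm 1 (PG-RPD).** Inputs: a feasible point $(x^{(0)},y^{(0)})$ of (SP), $\sigma>0$, $\varepsilon>0$, $\tau>L_f$, positive tolerances $\mu_k$. For $k=0,1,\dots$: (Step 1) compute $z^{(k+1)}$ with $z_1^{(k+1)}\in\mathrm{dom}(g^\star)$ and $\mathrm{dist}(z^{(k+1)},\Omega^{(k+1)})\le\mu_k$; (Step 2) set $x^{(k+1)}=x^{(k)}-\frac1\tau(\overline A^\top z_1^{(k+1)}+A^\top z_2^{(k+1)}+\nabla f_0(x^{(k)}))$ and $y^{(k+1)}=\mathbf{prox}_{\sigma^{-1}g}(\sigma^{-1}z_1^{(k+1)}+\overline Ax^{(k+1)}+\overline b)$. **Algorithm 2 (restarted APG on $\mathcal D_k$).** Let $L_{\mathcal D}=\lambda_{\max}([\overline A;A][\overline A;A]^\top)/\tau$. Input $z^{\rm ini}$ (fixed) with $z_1^{\rm ini}\in\mathrm{dom}(g^\star)$. Set $z^{(0,k)}=\widehat z^{(0,k)}=z^{\rm ini}$, $\alpha_0=1$. For $i=0,\dots,i_k-1$: {for $j=0,\dots,j_k-1$ do one APG step: with $v^j=\overline A^\top\widehat z_1^{(j,k)}+A^\top\widehat z_2^{(j,k)}+\nabla f_0(x^{(k)})-\tau x^{(k)}$, $\widehat{\mathcal G}_1^j=\frac1\tau\overline Av^j-\overline b$, $\widehat{\mathcal G}_2^j=\frac1\tau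 Av^j-b$, set $z_1^{(j+1,k)}=\mathbf{prox}_{L_{\mathcal D}^{-1}g^\star}(\widehat z_1^{(j,k)}-\frac1{L_{\mathcal D}}\widehat{\mathcal G}_1^j)$, $z_2^{(j+1,k)}=\widehat z_2^{(j,k)}-\frac1{L_{\mathcal D}}\widehat{\mathcal G}_2^j$, $\alpha_{j+1}=\frac{1+\sqrt{1+4\alpha_j^2}}2$, $\widehat z^{(j+1,k)}=z^{(j+1,k)}+\frac{\alpha_j-1}{\alpha_{j+1}}(z^{(j+1,k)}-z^{(j,k)})$}; then restart: $z^{(0,k)}\leftarrow z^{(j_k,k)}$, $\widehat z^{(0,k)}\leftarrow z^{(0,k)}$, $\alpha_0\leftarrow1$. Output $z^{(k+1)}=z^{(0,k)}$. Each APG step is one inner iteration; it uses $\mathcal O(1)$ evaluations of $\nabla f_0$, products with $A,\overline A,A^\top,\overline A^\top$, and proximal mappings of $g$. **Choice of $i_k,j_k$.** In (a): $\kappa_{\mathcal D}=\lambda^+_{\min}([\overline A;A][\overline A;A]^\top)/\tau$, $j_k=\lceil2\sqrt2\,\kappa([\overline A;A])\rceil$, $i_k=\max\{0,\lceil\log_2\frac{2(\mathcal D_k(z^{\rm ini})-\mathcal D_k^* )}{\kappa_{\mathcal D}\mu_k^2}\rceil\}$. In (b), (c): $j_k=\lceil2\sqrt{2L_{\mathcal D}/\rho_k}\rceil$, $i_k=\max\{0,\lceil\log_2\frac{2(\mathcal D_k(z^{\rm ini})-\mathcal D_k^* )}{\rho_k\mu_k^2}\rceil\}$, where $\rho_k=[\theta^2(\overline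 A,A,\overline b,b,C)(\tau+\mathcal D_k(z^{\rm ini})-\mathcal D_k^*+2\tau\|\nu^{(k)}\|^2)]^{-1}$ if $\overline b\ne0$ or $b\neq0$, and $\rho_k=[\theta^2(\overline A,A,C)\tau]^{-1}$ if $\overline b=0$ and $b=0$. **$\nu^{(k)}$ and Hoffman constants** (when $g(y)=\max\{u^\top y:Cu\le\mathbf d\}$, so $g^\star$ is the indicator of $\{z_1: Cz_1\le\mathbf d\}$). $\nu^{(k)}\in\mathbb R^d$ is the common value of $[\overline A;A]^\top\overline z+\nabla f_0(x^{(k)})-\tau x^{(k)}$ over all $\overline z\in\Omega^{(k+1)}$. $\theta(\overline A,A,\overline b,b,C)>0$ is a Hoffman constant, i.e. a constant depending only on these data such that for all $k$ and $z$, $\mathrm{dist}(z,\Omega^{(k+1)})\le\theta(\overline A,A,\overline b,b,C)$ times the norm of the stacked vector with blocks $[\overline A;A]^\top z+\nabla f_0(x^{(k)})-\tau x^{(k)}-\nu^{(k)}$, $-z_1^\top\overline b-z_2^\top b-\mathcal D_k^*+\frac1{2\tau}\|\nu^{(k)}\|^2$, and $(Cz_1-\mathbf d)_+$. When $\overline b=0,b=0$, $\theta(\overline A,A,C)>0$ is the analogous constant with the middle block dropped. **Constants.** $l_f^k=\|\nabla f_0(x^{(k)})\|$, $B_1=\frac1\tau\|\overline A\|\|[\overline A;A]\|+\sigma^{-1}+\frac1\tau(\|\overline A\|+\|A\|)\|[\overline A;A]\|$, $B_2=1+\|(AA^\top)^{-1}A\|\|[\overline A;A]\|$, $B_3^k=\|(AA^\top)^{-1}A\|(l_f^k+\|\overline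 A\|l_g)$, $B_4^k=\frac1\tau(l_f^k+\|[\overline A;A]\|(l_g+B_3^k))$, and $$\overline\mu_k=\min\Big\{\tfrac{\varepsilon^2}{480B_1l_gL_f},\tfrac{\tau\delta}{\|[\overline A;A]\|},\tfrac{\varepsilon}{6\|[\overline A;A]\|},\tfrac{\varepsilon}{B_1\sigma},\tfrac{\varepsilon}{B_1},\tfrac{\varepsilon^2}{12L_fB_1(B_3^k+\sigma\|\overline A\|B_4^k+l_g)},\sqrt{\tfrac{\varepsilon^2}{12L_fB_1B_2(1+\frac1\tau\sigma\|\overline A\|\|[\overline A;A]\|)}}\Big\}.$$ **Convention on $\mathcal O$.** $\mathcal O(\cdot)$ describes the behaviour as $\varepsilon\to0$ (with $\delta$ bounded above, e.g. $\delta\le1$) with the problem data, $\sigma$ and initial points fixed; dependence on other problem quantities (such as $\Delta_{F_0}$, $l_f^k$, $l_g$ and other data) that enters only inside the logarithm is suppressed.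
   Formalization: In (c), if τ<1 and (b̄,b)≠0, the stated ρ_k can make j_k too small and the claim fails; it is proved for runs meeting the Step 1 tolerance for k<K̄_ε, and unconditionally with 2τ‖ν‖² in ρ_k replaced by (2/τ)‖ν‖² (and 2B_5 by 2B_5/τ²). *)

theory Defs
  imports "HOL-Analysis.Analysis"
begin

definition edom :: "('a \<Rightarrow> ereal) \<Rightarrow> 'a set" where
  "edom h = {y. h y \<noteq> \<infinity>}"

definition proper_fun :: "('a \<Rightarrow> ereal) \<Rightarrow> bool" where
  "proper_fun h \<longleftrightarrow> (\<forall>y. h y \<noteq> -\<infinity>) \<and> edom h \<noteq> {}"

definition lsc_fun :: "('a::topological_space \<Rightarrow> ereal) \<Rightarrow> bool" where
  "lsc_fun h \<longleftrightarrow> (\<forall>y. h y \<le> Liminf (at y) h)"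

text \<open>Convexity of the epigraph; the pointwise inequality would involve \<open>0 * \<infinity>\<close>.\<close>

definition convex_fun :: "('a::real_vector \<Rightarrow> ereal) \<Rightarrow> bool" where
  "convex_fun h \<longleftrightarrow> convex {p :: 'a \<times> real. h (fst p) \<le> ereal (snd p)}"

definition conjugate :: "('a::real_inner \<Rightarrow> ereal) \<Rightarrow> 'a \<Rightarrow> ereal" where
  "conjugate h u = (SUP y. ereal (u \<bullet> y) - h y)"

definition subdiff :: "('a::real_inner \<Rightarrow> ereal) \<Rightarrow> 'a \<Rightarrow> 'a set" where
  "subdiff h y = {s. y \<in> edom h \<and> (\<forall>w. h y + ereal (s \<bullet> (w - y)) \<le> h w)}"

definition prox :: "real \<Rightarrow> ('a::real_normed_vector \<Rightarrow> ereal) \<Rightarrow> 'a \<Rightarrow> 'a" where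
  "prox \<eta> h v = arg_min (\<lambda>w. h w + ereal (1 / (2 * \<eta>) * (norm (w - v))\<^sup>2)) (\<lambda>_. True)"

text \<open>Distance to a set, equal to \<open>\<infinity>\<close> for the empty set (\<^const>\<open>infdist\<close> would be \<open>0\<close> there).\<close>

definition edist :: "'a::metric_space \<Rightarrow> 'a set \<Rightarrow> ereal" where
  "edist x S = (INF s\<in>S. ereal (dist x s))"

definition stack :: "real^'d^'m \<Rightarrow> real^'d^'n \<Rightarrow> real^'d^('m::finite + 'n::finite)" where
  "stack M N = (\<chi> i. case i of Inl p \<Rightarrow> M $ p | Inr q \<Rightarrow> N $ q)"

definition eigvals :: "real^'k^'k \<Rightarrow> real set" where
  "eigvals M = {l. \<exists>v. v \<noteq> 0 \<and> M *v v = l *s v}"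

definition lam_max :: "real^'k^'k \<Rightarrow> real" where
  "lam_max M = Max (eigvals M)"

definition lam_min_pos :: "real^'k^'k \<Rightarrow> real" where
  "lam_min_pos M = Min {l \<in> eigvals M. l > 0}"

definition kappa :: "real^'d^'k \<Rightarrow> real" where
  "kappa M = sqrt (lam_max (M ** transpose M) / lam_min_pos (M ** transpose M))"

text \<open>The spectral norm; \<^const>\<open>norm\<close> on matrices is the Frobenius norm.\<close>

definition specnorm :: "real^'d^'k \<Rightarrow> real" where
  "specnorm M = onorm (\<lambda>x. M *v x)"

record ('d, 'n, 'm) pgdata =
  f0 :: "real^'d::finite \<Rightarrow> real"
  gradf :: "real^'d \<Rightarrow> real^'d"
  Lf :: real
  gfun :: "real^'m::finite \<Rightarrow> ereal"
  lg :: real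
  matA :: "real^'d^'n::finite"
  vecb :: "real^'n"
  matAbar :: "real^'d^'m"
  vecbbar :: "real^'m"
  xini :: "real^'d"
  yini :: "real^'m"
  sigma :: real
  tau :: real
  zini :: "(real^'m) \<times> (real^'n)"

type_synonym ('n, 'm) dual = "(real^'m) \<times> (real^'n)"

abbreviation matB :: "('d::finite, 'n::finite, 'm::finite) pgdata \<Rightarrow> real^'d^('m + 'n)" where
  "matB P \<equiv> stack (matAbar P) (matA P)"

definition F0 :: "('d::finite, 'n::finite, 'm::finite) pgdata \<Rightarrow> real^'d \<Rightarrow> ereal" where
  "F0 P x = ereal (f0 P x) + gfun P (matAbar P *v x + vecbbar P)"

definition Fsplit :: "('d::finite, 'n::finite, 'm::finite) pgdata \<Rightarrow> real^'d \<Rightarrow> real^'m \<Rightarrow> ereal" where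
  "Fsplit P x y = ereal (f0 P x) + gfun P y"

definition standing_assumptions :: "('d::finite, 'n::finite, 'm::finite) pgdata \<Rightarrow> bool" where
  "standing_assumptions P \<longleftrightarrow>
     (\<forall>x. GDERIV (f0 P) x :> gradf P x) \<and> Lf P > 0 \<and> (Lf P)-lipschitz_on UNIV (gradf P) \<and>
     (INF x. F0 P x) > -\<infinity> \<and>
     proper_fun (gfun P) \<and> lsc_fun (gfun P) \<and> convex_fun (gfun P) \<and>
     rank (matA P) = CARD('n) \<and>
     (\<exists>x. matA P *v x + vecb P = 0 \<and>
          matAbar P *v x + vecbbar P \<in> rel_interior (edom (gfun P))) \<and>
     lg P > 0 \<and> (lg P)-lipschitz_on (edom (gfun P)) (\<lambda>y. real_of_ereal (gfun P y))"

text \<open>A feasible point has finite objective value, i.e. \<open>y\<^sup>(\<^sup>0\<^sup>) \<in> dom g\<close>.\<close>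

definition algorithm_inputs :: "('d::finite, 'n::finite, 'm::finite) pgdata \<Rightarrow> bool" where
  "algorithm_inputs P \<longleftrightarrow>
     matA P *v xini P + vecb P = 0 \<and> yini P = matAbar P *v xini P + vecbbar P \<and>
     yini P \<in> edom (gfun P) \<and>
     sigma P > 0 \<and> tau P > Lf P \<and> fst (zini P) \<in> edom (conjugate (gfun P))"

definition DeltaF0 :: "('d::finite, 'n::finite, 'm::finite) pgdata \<Rightarrow> real" where
  "DeltaF0 P = real_of_ereal (F0 P (xini P) - (INF x. F0 P x))"

definition Kbar :: "('d::finite, 'n::finite, 'm::finite) pgdata \<Rightarrow> real \<Rightarrow> nat" where
  "Kbar P eps = nat \<lceil>120 * Lf P * DeltaF0 P / eps\<^sup>2\<rceil>"

definition eps_kkt :: "('d::finite, 'n::finite, 'm::finite) pgdata \<Rightarrow> real \<Rightarrow> real^'d \<Rightarrow> bool" where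
  "eps_kkt P eps x \<longleftrightarrow> (\<exists>\<gamma>.
     max (edist 0 ((\<lambda>s. gradf P x + transpose (matA P) *v \<gamma> + transpose (matAbar P) *v s) `
                     subdiff (gfun P) (matAbar P *v x + vecbbar P)))
         (ereal (norm (matA P *v x + vecb P))) \<le> ereal eps)"

definition delta_eps_kkt ::
    "('d::finite, 'n::finite, 'm::finite) pgdata \<Rightarrow> real \<Rightarrow> real \<Rightarrow> real^'d \<Rightarrow> bool" where
  "delta_eps_kkt P delta eps x \<longleftrightarrow> (\<exists>xs. eps_kkt P eps xs \<and> norm (x - xs) \<le> delta)"

text \<open>In everything below the argument \<open>x\<close> is the current outer iterate \<open>x\<^sup>(\<^sup>k\<^sup>)\<close>.\<close>

definition dres :: "('d::finite, 'n::finite, 'm::finite) pgdata \<Rightarrow> real^'d \<Rightarrow> ('n, 'm) dual \<Rightarrow> real^'d" where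
  "dres P x z = transpose (matAbar P) *v fst z + transpose (matA P) *v snd z
                + gradf P x - tau P *\<^sub>R x"

definition Dk :: "('d::finite, 'n::finite, 'm::finite) pgdata \<Rightarrow> real^'d \<Rightarrow> ('n, 'm) dual \<Rightarrow> ereal" where
  "Dk P x z = ereal (1 / (2 * tau P) * (norm (dres P x z))\<^sup>2) + conjugate (gfun P) (fst z)
              - ereal (fst z \<bullet> vecbbar P) - ereal (snd z \<bullet> vecb P)"

definition Dmin :: "('d::finite, 'n::finite, 'm::finite) pgdata \<Rightarrow> real^'d \<Rightarrow> ereal" where
  "Dmin P x = (INF z. Dk P x z)"

definition Omega :: "('d::finite, 'n::finite, 'm::finite) pgdata \<Rightarrow> real^'d \<Rightarrow> ('n, 'm) dual set" where
  "Omega P x = {z. is_arg_min (Dk P x) (\<lambda>_. True) z}"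

definition gap :: "('d::finite, 'n::finite, 'm::finite) pgdata \<Rightarrow> real^'d \<Rightarrow> real" where
  "gap P x = real_of_ereal (Dk P x (zini P) - Dmin P x)"

definition nu :: "('d::finite, 'n::finite, 'm::finite) pgdata \<Rightarrow> real^'d \<Rightarrow> real^'d" where
  "nu P x = (THE v. dres P x ` Omega P x = {v})"

definition LD :: "('d::finite, 'n::finite, 'm::finite) pgdata \<Rightarrow> real" where
  "LD P = lam_max (matB P ** transpose (matB P)) / tau P"

text \<open>The state of the inner loop is \<open>(z, z-hat, \<alpha>)\<close>.\<close>

definition apg_step ::
    "('d::finite, 'n::finite, 'm::finite) pgdata \<Rightarrow> real^'d \<Rightarrow>
     ('n, 'm) dual \<times> ('n, 'm) dual \<times> real \<Rightarrow> ('n, 'm) dual \<times> ('n, 'm) dual \<times> real" where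
  "apg_step P x = (\<lambda>(z, zh, \<alpha>).
     let v = dres P x zh;
         G1 = (1 / tau P) *\<^sub>R (matAbar P *v v) - vecbbar P;
         G2 = (1 / tau P) *\<^sub>R (matA P *v v) - vecb P;
         z' = (prox (1 / LD P) (conjugate (gfun P)) (fst zh - (1 / LD P) *\<^sub>R G1),
               snd zh - (1 / LD P) *\<^sub>R G2);
         \<alpha>' = (1 + sqrt (1 + 4 * \<alpha>\<^sup>2)) / 2
     in (z', z' + ((\<alpha> - 1) / \<alpha>') *\<^sub>R (z' - z), \<alpha>'))"

definition apg_cycle ::
    "('d::finite, 'n::finite, 'm::finite) pgdata \<Rightarrow> real^'d \<Rightarrow> nat \<Rightarrow> ('n, 'm) dual \<Rightarrow> ('n, 'm) dual" where
  "apg_cycle P x j z = fst ((apg_step P x ^^ j) (z, z, 1))"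

definition restarted_apg ::
    "('d::finite, 'n::finite, 'm::finite) pgdata \<Rightarrow> real^'d \<Rightarrow> nat \<Rightarrow> nat \<Rightarrow> ('n, 'm) dual" where
  "restarted_apg P x i j = (apg_cycle P x j ^^ i) (zini P)"

text \<open>A schedule gives the pair \<open>(i\<^sub>k, j\<^sub>k)\<close> from \<open>k\<close> and \<open>x\<^sup>(\<^sup>k\<^sup>)\<close>; a tolerance rule gives \<open>\<mu>\<^sub>k\<close>.\<close>

type_synonym 'd schedule = "nat \<Rightarrow> real^'d \<Rightarrow> nat \<times> nat"
type_synonym 'd tolerance = "nat \<Rightarrow> real^'d \<Rightarrow> real"

definition solve_dual ::
    "('d::finite, 'n::finite, 'm::finite) pgdata \<Rightarrow> 'd schedule \<Rightarrow> nat \<Rightarrow> real^'d \<Rightarrow> ('n, 'm) dual" where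
  "solve_dual P s k x = restarted_apg P x (fst (s k x)) (snd (s k x))"

primrec iterate ::
    "('d::finite, 'n::finite, 'm::finite) pgdata \<Rightarrow> 'd schedule \<Rightarrow> nat \<Rightarrow> (real^'d) \<times> (real^'m)" where
  "iterate P s 0 = (xini P, yini P)"
| "iterate P s (Suc k) =
     (let x = fst (iterate P s k);
          z = solve_dual P s k x;
          x' = x - (1 / tau P) *\<^sub>R
                 (transpose (matAbar P) *v fst z + transpose (matA P) *v snd z + gradf P x);
          y' = prox (1 / sigma P) (gfun P)
                 ((1 / sigma P) *\<^sub>R fst z + matAbar P *v x' + vecbbar P)
      in (x', y'))"

abbreviation xk ::
    "('d::finite, 'n::finite, 'm::finite) pgdata \<Rightarrow> 'd schedule \<Rightarrow> nat \<Rightarrow> real^'d" where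
  "xk P s k \<equiv> fst (iterate P s k)"

text \<open>
  The accuracy that the outer method requires of \<open>z\<^sup>(\<^sup>k\<^sup>+\<^sup>1\<^sup>)\<close>. It is not built into \<^const>\<open>iterate\<close>: whether the
  output of the restarted inner solver meets it has to be proved.
\<close>

definition step1_ok ::
    "('d::finite, 'n::finite, 'm::finite) pgdata \<Rightarrow> 'd schedule \<Rightarrow> 'd tolerance \<Rightarrow> nat \<Rightarrow> bool" where
  "step1_ok P s mu k \<longleftrightarrow>
     (let x = xk P s k; z = solve_dual P s k x
      in fst z \<in> edom (conjugate (gfun P)) \<and> edist z (Omega P x) \<le> ereal (mu k x))"

text \<open>Number of APG steps spent in the first \<open>K\<close> outer iterations.\<close>

definition inner_total ::
    "('d::finite, 'n::finite, 'm::finite) pgdata \<Rightarrow> 'd schedule \<Rightarrow> nat \<Rightarrow> nat" where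
  "inner_total P s K = (\<Sum>k<K. fst (s k (xk P s k)) * snd (s k (xk P s k)))"

definition B1 :: "('d::finite, 'n::finite, 'm::finite) pgdata \<Rightarrow> real" where
  "B1 P = 1 / tau P * specnorm (matAbar P) * specnorm (matB P) + 1 / sigma P
          + 1 / tau P * (specnorm (matAbar P) + specnorm (matA P)) * specnorm (matB P)"

definition pinv_norm :: "('d::finite, 'n::finite, 'm::finite) pgdata \<Rightarrow> real" where
  "pinv_norm P = specnorm (matrix_inv (matA P ** transpose (matA P)) ** matA P)"

definition B2 :: "('d::finite, 'n::finite, 'm::finite) pgdata \<Rightarrow> real" where
  "B2 P = 1 + pinv_norm P * specnorm (matB P)"

definition B3 :: "('d::finite, 'n::finite, 'm::finite) pgdata \<Rightarrow> real^'d \<Rightarrow> real" where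
  "B3 P x = pinv_norm P * (norm (gradf P x) + specnorm (matAbar P) * lg P)"

definition B4 :: "('d::finite, 'n::finite, 'm::finite) pgdata \<Rightarrow> real^'d \<Rightarrow> real" where
  "B4 P x = 1 / tau P * (norm (gradf P x) + specnorm (matB P) * (lg P + B3 P x))"

definition mubar ::
    "('d::finite, 'n::finite, 'm::finite) pgdata \<Rightarrow> real \<Rightarrow> real \<Rightarrow> real^'d \<Rightarrow> real" where
  "mubar P eps delta x = Min {
     eps\<^sup>2 / (480 * B1 P * lg P * Lf P),
     tau P * delta / specnorm (matB P),
     eps / (6 * specnorm (matB P)),
     eps / (B1 P * sigma P),
     eps / B1 P,
     eps\<^sup>2 / (12 * Lf P * B1 P * (B3 P x + sigma P * specnorm (matAbar P) * B4 P x + lg P)),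
     sqrt (eps\<^sup>2 / (12 * Lf P * B1 P * B2 P *
             (1 + 1 / tau P * sigma P * specnorm (matAbar P) * specnorm (matB P))))}"

definition mu_const ::
    "('d::finite, 'n::finite, 'm::finite) pgdata \<Rightarrow> real \<Rightarrow> real \<Rightarrow> 'd tolerance" where
  "mu_const P eps delta k x = mubar P eps delta x"

definition mu_decay ::
    "('d::finite, 'n::finite, 'm::finite) pgdata \<Rightarrow> real \<Rightarrow> real \<Rightarrow> 'd tolerance" where
  "mu_decay P eps delta k x = 1 / (real k + 1)\<^sup>2 * mubar P eps delta x"

definition restarts ::
    "('d::finite, 'n::finite, 'm::finite) pgdata \<Rightarrow> real \<Rightarrow> real \<Rightarrow> real^'d \<Rightarrow> nat" where
  "restarts P rho mu x = nat (max 0 \<lceil>log 2 (2 * gap P x / (rho * mu\<^sup>2))\<rceil>)"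

definition kappaD :: "('d::finite, 'n::finite, 'm::finite) pgdata \<Rightarrow> real" where
  "kappaD P = lam_min_pos (matB P ** transpose (matB P)) / tau P"

definition sched_rank ::
    "('d::finite, 'n::finite, 'm::finite) pgdata \<Rightarrow> 'd tolerance \<Rightarrow> 'd schedule" where
  "sched_rank P mu k x =
     (restarts P (kappaD P) (mu k x) x, nat \<lceil>2 * sqrt 2 * kappa (matB P)\<rceil>)"

text \<open>
  \<open>theta\<close> stands for \<open>\<theta>(A-bar, A, b-bar, b, C)\<close> if \<open>b-bar \<noteq> 0\<close> or \<open>b \<noteq> 0\<close>, and for
  \<open>\<theta>(A-bar, A, C)\<close> otherwise. The coefficient \<open>w\<close> of \<open>\<parallel>\<nu>\<^sup>(\<^sup>k\<^sup>)\<parallel>\<^sup>2\<close> is \<open>2 * \<tau>\<close> in the source; the quadratic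
  growth estimate that the Hoffman bound gives for \<^const>\<open>Dk\<close> has \<open>2 / \<tau>\<close> in its place, which is larger
  if \<open>\<tau> < 1\<close>. Only \<open>w \<ge> 2 / \<tau>\<close> therefore guarantees that the inner solver meets its tolerance.
\<close>

definition rho ::
    "('d::finite, 'n::finite, 'm::finite) pgdata \<Rightarrow> real \<Rightarrow> real \<Rightarrow> real^'d \<Rightarrow> real" where
  "rho P theta w x =
     (if vecbbar P \<noteq> 0 \<or> vecb P \<noteq> 0
      then inverse (theta\<^sup>2 * (tau P + gap P x + w * (norm (nu P x))\<^sup>2))
      else inverse (theta\<^sup>2 * tau P))"

definition sched_hoffman ::
    "('d::finite, 'n::finite, 'm::finite) pgdata \<Rightarrow> real \<Rightarrow> real \<Rightarrow> 'd tolerance \<Rightarrow> 'd schedule" where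
  "sched_hoffman P theta w mu k x =
     (restarts P (rho P theta w x) (mu k x) x, nat \<lceil>2 * sqrt (2 * LD P / rho P theta w x)\<rceil>)"

text \<open>The maximum is \<open>\<infinity>\<close> where the linear function is unbounded on the polyhedron.\<close>

definition support_function_of ::
    "(real^'m \<Rightarrow> ereal) \<Rightarrow> real^'m^'p \<Rightarrow> real^'p \<Rightarrow> bool" where
  "support_function_of h C dv \<longleftrightarrow>
     (\<forall>y. h y = (SUP u\<in>{u. \<forall>i. (C *v u) $ i \<le> dv $ i}. ereal (u \<bullet> y)))"

text \<open>
  The Hoffman inequality at \<open>x\<close>; the norm of a tuple is the Euclidean norm of the stacked vector.
  If \<open>b-bar = 0\<close> and \<open>b = 0\<close>, the middle block is \<open>0\<close> for every \<open>z\<close>, so dropping it does not change the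
  inequality and one constant \<open>theta\<close> serves for both cases.
\<close>

definition hoffman ::
    "('d::finite, 'n::finite, 'm::finite) pgdata \<Rightarrow> real^'m^'p \<Rightarrow> real^'p \<Rightarrow> real \<Rightarrow> real^'d \<Rightarrow> bool" where
  "hoffman P C dv theta x \<longleftrightarrow> (\<forall>z.
     (let r1 = dres P x z - nu P x;
          r2 = - (fst z \<bullet> vecbbar P) - snd z \<bullet> vecb P - real_of_ereal (Dmin P x)
               + 1 / (2 * tau P) * (norm (nu P x))\<^sup>2;
          r3 = (\<chi> i. max 0 ((C *v fst z - dv) $ i))
      in edist z (Omega P x) \<le>
           ereal (theta * (if vecbbar P \<noteq> 0 \<or> vecb P \<noteq> 0 then norm (r1, r2, r3) else norm (r1, r3)))))"

definition admissible :: "('d::finite, 'n::finite, 'm::finite) pgdata \<Rightarrow> real \<Rightarrow> real \<Rightarrow> bool" where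
  "admissible P eps delta \<longleftrightarrow> 0 < eps \<and> eps < min (sqrt (3 * Lf P)) 1 \<and> 0 < delta"

text \<open>
  A point found within the first \<open>\<lceil>120 L\<^sub>f \<Delta> / \<epsilon>\<^sup>2\<rceil>\<close> outer iterations (the initial point counts when
  this number is \<open>0\<close>).
\<close>

definition finds_kkt ::
    "('d::finite, 'n::finite, 'm::finite) pgdata \<Rightarrow> 'd schedule \<Rightarrow> real \<Rightarrow> real \<Rightarrow> bool" where
  "finds_kkt P s eps delta \<longleftrightarrow> (\<exists>k\<le>Kbar P eps. delta_eps_kkt P delta eps (xk P s k))"

text \<open>
  \<open>T eps delta = O(Phi eps delta)\<close> as \<open>eps \<rightarrow> 0\<close>, uniformly for bounded \<open>delta\<close>, with the explicit constant \<open>c\<close>.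
  How small \<open>eps\<close> has to be may depend on all data, which is how data-dependent factors inside the
  logarithm are absorbed.
\<close>

definition bigO_eps :: "real \<Rightarrow> (real \<Rightarrow> real \<Rightarrow> real) \<Rightarrow> (real \<Rightarrow> real \<Rightarrow> real) \<Rightarrow> bool" where
  "bigO_eps c T Phi \<longleftrightarrow>
     (\<forall>dmax>0. \<forall>\<^sub>F eps in at_right 0. \<forall>delta\<in>{0<..dmax}. T eps delta \<le> c * Phi eps delta)"

end

theory Submission
  imports Defs
begin

text \<open>
  Everything rests on the exact solution of the dual subproblem. If \<open>z\<close> minimises the dual function at an
  outer iterate \<open>x\<close>, its optimality conditions say that the point \<open>u = - \<nu> / \<tau>\<close> is feasible for (P) and that
  \<open>z\<^sub>1\<close> is a subgradient of \<open>g\<close> at the image of \<open>u\<close>; the second fact holds because \<open>g\<close> is recovered from its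
  conjugate (\<open>fenchel_moreau\<close>). So \<open>u\<close> is the exact proximal-linear step from \<open>x\<close>. A minimiser \<open>z\<close> exists by
  coercivity under full row rank; in the polyhedral cases the Hoffman inequality bounds the distance to the
  solution set by a finite number, so this set cannot be empty.

  The outer loop works with these exact points \<open>u\<^sub>k\<close> in place of the computed iterates \<open>x\<^sub>k\<close>, which need not be
  feasible. With \<open>\<tau> = 2 L\<^sub>f\<close>, comparing \<open>u\<^sub>k\<^sub>+\<^sub>1\<close> with the feasible competitor \<open>u\<^sub>k\<close> gives
  \<open>F\<^sub>0 u\<^sub>k\<^sub>+\<^sub>1 + L\<^sub>f/2 |u\<^sub>k\<^sub>+\<^sub>1 - x\<^sub>k|\<^sup>2 \<le> F\<^sub>0 u\<^sub>k + 3 L\<^sub>f/2 |u\<^sub>k - x\<^sub>k|\<^sup>2\<close> (\<open>prox_linear_descent\<close>). The tolerances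
  make \<open>|u\<^sub>k - x\<^sub>k| \<le> \<epsilon> / (12 L\<^sub>f)\<close>, so a telescoping sum forces \<open>3 L\<^sub>f |u\<^sub>k\<^sub>+\<^sub>1 - x\<^sub>k| \<le> \<epsilon>\<close> within the first
  \<open>\<lceil>120 L\<^sub>f \<Delta> / \<epsilon>\<^sup>2\<rceil>\<close> iterations (if \<open>\<Delta> = 0\<close>, already \<open>u\<^sub>1 = x\<^sub>0\<close>).
  The stationarity residual at \<open>u\<^sub>k\<^sub>+\<^sub>1\<close> is at most \<open>(L\<^sub>f + \<tau>) |u\<^sub>k\<^sub>+\<^sub>1 - x\<^sub>k|\<close>, hence at most
  \<open>\<epsilon>\<close>, and \<open>x\<^sub>k\<^sub>+\<^sub>1\<close> is within \<open>\<delta>\<close> of that point.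

  The inner loop meets its tolerance because a quadratic growth bound with constant \<open>\<rho>\<close>, together with the
  \<open>2 L |z\<^sub>0 - z|\<^sup>2 / j\<^sup>2\<close> rate of the accelerated method (\<open>momentum_rate\<close>), halves the dual gap in each cycle of
  length \<open>2 \<surd>(2 L / \<rho>)\<close>. Under full row rank the growth is strong convexity. For a polyhedral conjugate domain
  it comes from the Hoffman inequality; with nonzero shifts it is obtained on the initial level set, where
  the initial gap bounds a term that is quadratic in the gap (\<open>growth_of_hoffman\<close>).

  For the count, the iterates grow at most polynomially in \<open>1 / \<epsilon>\<close>; thus the gaps and the reciprocals of the
  tolerances are polynomial in \<open>1 / (\<delta> \<epsilon>)\<close>, and the number of restarts is at most an absolute constant times
  \<open>ln (1 / (\<delta> \<epsilon>))\<close> once \<open>\<epsilon>\<close> is small. A cycle has at most \<open>4 S\<close> steps, where the square root \<open>S\<close> in the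
  claimed bound satisfies \<open>S \<ge> 1\<close>: it is a condition number in the first case, a consequence of the Hoffman inequality
  itself in the second (\<open>hoffman_constant_lower_bound\<close>), and secured by the choice of \<open>B\<^sub>6\<close> in the third. In
  that last case the descent inequality keeps the exact points in the compact level set, which yields
  \<open>B\<^sub>5\<close> and \<open>B\<^sub>6\<close>.
\<close>

section \<open>Conjugates, subgradients and proximal points\<close>

abbreviation conj_real :: "('a::real_inner \<Rightarrow> ereal) \<Rightarrow> 'a \<Rightarrow> real" where
  "conj_real h u \<equiv> real_of_ereal (conjugate h u)"

lemma proper_fun_real:
  assumes "proper_fun h" "y \<in> edom h"
  shows "h y = ereal (real_of_ereal (h y))"
  using assms by (cases "h y") (auto simp: proper_fun_def edom_def)

text \<open>
  On the domain of a proper function all values are real, so a bound on the conjugate becomes a family of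
  real inequalities, affine in \<open>u\<close>. Closedness and convexity of the conjugate are read off from this.
\<close>

lemma conjugate_le_iff:
  assumes "proper_fun h"
  shows "conjugate h u \<le> ereal t \<longleftrightarrow> (\<forall>y\<in>edom h. u \<bullet> y - real_of_ereal (h y) \<le> t)"
proof -
  have "ereal (u \<bullet> y) - h y \<le> ereal t \<longleftrightarrow> (y \<in> edom h \<longrightarrow> u \<bullet> y - real_of_ereal (h y) \<le> t)" for y
    using assms by (cases "h y") (auto simp: proper_fun_def edom_def)
  then show ?thesis
    unfolding conjugate_def SUP_le_iff by auto
qed

lemma conjugate_not_MInf:
  assumes "proper_fun h"
  shows "conjugate h u \<noteq> - \<infinity>"
proof
  assume *: "conjugate h u = - \<infinity>"
  obtain y where y: "y \<in> edom h" using assms by (auto simp: proper_fun_def)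
  have "conjugate h u \<le> ereal (u \<bullet> y - real_of_ereal (h y) - 1)" using * by simp
  then show False using conjugate_le_iff[OF assms] y by fastforce
qed

lemma conjugate_eq_real:
  assumes "proper_fun h" "u \<in> edom (conjugate h)"
  shows "conjugate h u = ereal (conj_real h u)"
  using conjugate_not_MInf[OF assms(1), of u] assms(2)
  by (cases "conjugate h u") (auto simp: edom_def)

lemma conj_real_le_iff:
  assumes "proper_fun h" "u \<in> edom (conjugate h)"
  shows "conj_real h u \<le> t \<longleftrightarrow> (\<forall>y\<in>edom h. u \<bullet> y - real_of_ereal (h y) \<le> t)"
  using conjugate_le_iff[OF assms(1), of u t] conjugate_eq_real[OF assms] by (metis ereal_less_eq(3))

lemma fenchel_young:
  assumes "proper_fun h" "u \<in> edom (conjugate h)" "y \<in> edom h"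
  shows "u \<bullet> y \<le> real_of_ereal (h y) + conj_real h u"
  using conj_real_le_iff[OF assms(1,2), of "conj_real h u"] assms(3) by fastforce

lemma edom_conjugateI:
  assumes "proper_fun h" "\<And>y. y \<in> edom h \<Longrightarrow> u \<bullet> y - real_of_ereal (h y) \<le> t"
  shows "u \<in> edom (conjugate h) \<and> conj_real h u \<le> t"
proof -
  have "conjugate h u \<le> ereal t" using assms conjugate_le_iff by blast
  then have u: "u \<in> edom (conjugate h)" by (auto simp: edom_def)
  then show ?thesis using assms conj_real_le_iff by blast
qed

lemma closed_epigraph_conjugate:
  fixes h :: "'a::real_inner \<Rightarrow> ereal"
  assumes "proper_fun h"
  shows "closed {p :: 'a \<times> real. conjugate h (fst p) \<le> ereal (snd p)}"
proof -
  have "{p :: 'a \<times> real. conjugate h (fst p) \<le> ereal (snd p)}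
      = (\<Inter>y\<in>edom h. {p. fst p \<bullet> y - real_of_ereal (h y) \<le> snd p})"
    using conjugate_le_iff[OF assms] by auto
  moreover have "closed {p :: 'a \<times> real. fst p \<bullet> y - real_of_ereal (h y) \<le> snd p}" for y
    by (intro closed_Collect_le continuous_intros)
  ultimately show ?thesis by auto
qed

lemma conj_real_convex_comb:
  assumes h: "proper_fun h" and u: "u \<in> edom (conjugate h)" and v: "v \<in> edom (conjugate h)"
    and l: "0 \<le> l" "l \<le> (1::real)"
  shows "(1 - l) *\<^sub>R u + l *\<^sub>R v \<in> edom (conjugate h) \<and>
         conj_real h ((1 - l) *\<^sub>R u + l *\<^sub>R v) \<le> (1 - l) * conj_real h u + l * conj_real h v"
proof (rule edom_conjugateI[OF h])
  fix y assume y: "y \<in> edom h"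
  have "(1 - l) * (u \<bullet> y) \<le> (1 - l) * (real_of_ereal (h y) + conj_real h u)"
    using fenchel_young[OF h u y] l by (intro mult_left_mono) auto
  moreover have "l * (v \<bullet> y) \<le> l * (real_of_ereal (h y) + conj_real h v)"
    using fenchel_young[OF h v y] l by (intro mult_left_mono) auto
  ultimately show "((1 - l) *\<^sub>R u + l *\<^sub>R v) \<bullet> y - real_of_ereal (h y)
      \<le> (1 - l) * conj_real h u + l * conj_real h v"
    by (simp add: inner_add_left algebra_simps)
qed

lemma lsc_closed_epigraph:
  fixes h :: "'a::metric_space \<Rightarrow> ereal"
  assumes "lsc_fun h"
  shows "closed {p :: 'a \<times> real. h (fst p) \<le> ereal (snd p)}"
proof -
  have "open (- {p :: 'a \<times> real. h (fst p) \<le> ereal (snd p)})"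
    unfolding open_prod_def
  proof
    fix p :: "'a \<times> real"
    assume "p \<in> - {p. h (fst p) \<le> ereal (snd p)}"
    then have "ereal (snd p) < h (fst p)" by auto
    then obtain c where c: "ereal (snd p) < ereal c" "ereal c < h (fst p)"
      using ereal_dense2 by blast
    have "h (fst p) \<le> Liminf (at (fst p)) h" using assms by (simp add: lsc_fun_def)
    then have "eventually (\<lambda>y. ereal c < h y) (at (fst p))"
      using c(2) le_Liminf_iff by blast
    then obtain U where U: "open U" "fst p \<in> U" "\<forall>y\<in>U. y \<noteq> fst p \<longrightarrow> ereal c < h y"
      unfolding eventually_at_topological by blast
    have "p \<in> U \<times> {..<c}" using U c by (cases p) auto
    moreover have "U \<times> {..<c} \<subseteq> - {p. h (fst p) \<le> ereal (snd p)}"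
    proof
      fix q assume "q \<in> U \<times> {..<c}"
      then have "fst q \<in> U" "snd q < c" by auto
      then have "ereal (snd q) < h (fst q)" using U c
        by (metis ereal_less(1) less_ereal.simps(1) order_less_trans)
      then show "q \<in> - {p. h (fst p) \<le> ereal (snd p)}" by auto
    qed
    ultimately show "\<exists>A B. open A \<and> open B \<and> p \<in> A \<times> B \<and> A \<times> B \<subseteq> - {p. h (fst p) \<le> ereal (snd p)}"
      using U(1) by (meson open_lessThan)
  qed
  then show ?thesis by (simp add: closed_def)
qed

text \<open>
  If \<open>h y\<close> exceeded \<open>r\<close>, a hyperplane would separate \<open>(y, r)\<close> from the closed convex epigraph. A non-vertical
  hyperplane is an affine minorant of \<open>h\<close> that exceeds \<open>r\<close> at \<open>y\<close>; a vertical one is turned into such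
  minorants by adding large multiples of it to the minorant with slope \<open>a\<close>.
\<close>

theorem fenchel_moreau:
  fixes h :: "'a::euclidean_space \<Rightarrow> ereal"
  assumes h: "proper_fun h" "lsc_fun h" "convex_fun h"
    and a: "a \<in> edom (conjugate h)"
    and r: "\<And>w. w \<in> edom (conjugate h) \<Longrightarrow> w \<bullet> y - conj_real h w \<le> r"
  shows "h y \<le> ereal r"
proof (rule ccontr)
  assume "\<not> h y \<le> ereal r"
  define E where "E = {p :: 'a \<times> real. h (fst p) \<le> ereal (snd p)}"
  have "(y, r) \<notin> E" using \<open>\<not> h y \<le> ereal r\<close> by (simp add: E_def)
  moreover have "convex E" using h(3) by (simp add: E_def convex_fun_def)
  moreover have "closed E" using lsc_closed_epigraph[OF h(2)] by (simp add: E_def)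
  ultimately obtain q \<beta> where q: "q \<bullet> (y, r) < \<beta>" "\<forall>x\<in>E. q \<bullet> x > \<beta>"
    using separating_hyperplane_closed_point by metis
  obtain p s where ps: "q = (p, s)" by (cases q)
  have sep: "\<beta> < p \<bullet> w + s * t" if "w \<in> edom h" "real_of_ereal (h w) \<le> t" for w t
  proof -
    have "(w, t) \<in> E" using that proper_fun_real[OF h(1) that(1)]
      by (metis (mono_tags, lifting) E_def ereal_less_eq(3) fst_conv mem_Collect_eq snd_conv)
    then show ?thesis using q(2) ps by fastforce
  qed
  have yr: "p \<bullet> y + s * r < \<beta>" using q(1) ps by simp
  obtain y0 where y0: "y0 \<in> edom h" using h(1) by (auto simp: proper_fun_def)
  \<comment> \<open>The epigraph is unbounded upwards, so its normal cannot point downwards.\<close>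
  have "s \<ge> 0"
  proof (rule ccontr)
    assume "\<not> s \<ge> 0"
    then have s: "s < 0" by simp
    define t where "t = max (real_of_ereal (h y0)) ((\<beta> - p \<bullet> y0) / s)"
    have "s * t \<le> s * ((\<beta> - p \<bullet> y0) / s)" using s by (intro mult_left_mono_neg) (auto simp: t_def)
    also have "\<dots> = \<beta> - p \<bullet> y0" using s by simp
    finally show False using sep[OF y0, of t] by (auto simp: t_def)
  qed
  show False
  proof (cases "s = 0")
    case True
    \<comment> \<open>A vertical hyperplane: tilting the minorant \<open>a\<close> along it drives the biconjugate to infinity.\<close>
    have tilt: "a \<bullet> y - conj_real h a + l * (\<beta> - p \<bullet> y) \<le> r" if "l \<ge> 0" for l
    proof -
      have "a - l *\<^sub>R p \<in> edom (conjugate h) \<and> conj_real h (a - l *\<^sub>R p) \<le> conj_real h a - l * \<beta>"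
      proof (rule edom_conjugateI[OF h(1)])
        fix w assume w: "w \<in> edom h"
        have "l * \<beta> \<le> l * (p \<bullet> w)" using sep[OF w, of "real_of_ereal (h w)"] True that
          by (intro mult_left_mono) auto
        then show "(a - l *\<^sub>R p) \<bullet> w - real_of_ereal (h w) \<le> conj_real h a - l * \<beta>"
          using fenchel_young[OF h(1) a w] by (simp add: inner_diff_left)
      qed
      then show ?thesis using r[of "a - l *\<^sub>R p"] by (simp add: inner_diff_left algebra_simps)
    qed
    have pos: "\<beta> - p \<bullet> y > 0" using yr True by simp
    define l where "l = \<bar>r - (a \<bullet> y - conj_real h a)\<bar> / (\<beta> - p \<bullet> y) + 1"
    have "l \<ge> 0" using pos by (simp add: l_def)
    moreover have "l * (\<beta> - p \<bullet> y) = \<bar>r - (a \<bullet> y - conj_real h a)\<bar> + (\<beta> - p \<bullet> y)"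
      using pos by (simp add: l_def field_simps)
    ultimately show False using tilt[of l] pos by linarith
  next
    case False
    then have s: "s > 0" using \<open>s \<ge> 0\<close> by simp
    define w where "w = - (1 / s) *\<^sub>R p"
    have "w \<in> edom (conjugate h) \<and> conj_real h w \<le> - \<beta> / s"
    proof (rule edom_conjugateI[OF h(1)])
      fix x assume x: "x \<in> edom h"
      have "\<beta> \<le> p \<bullet> x + s * real_of_ereal (h x)" using sep[OF x, of "real_of_ereal (h x)"] by simp
      then have "\<beta> / s \<le> (p \<bullet> x + s * real_of_ereal (h x)) / s" using s by (intro divide_right_mono) auto
      then show "w \<bullet> x - real_of_ereal (h x) \<le> - \<beta> / s" using s by (simp add: w_def add_divide_distrib)
    qed
    then have "w \<bullet> y + \<beta> / s \<le> r" using r[of w] by simp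
    then have "(\<beta> - p \<bullet> y) / s \<le> r" by (simp add: w_def diff_divide_distrib)
    then have "\<beta> \<le> p \<bullet> y + s * r" using s by (simp add: pos_divide_le_eq mult.commute)
    then show False using yr by simp
  qed
qed

text \<open>
  Inverting the subdifferential: the hypothesis says that \<open>y\<close> is a subgradient of the conjugate at \<open>z\<close>, which
  bounds the biconjugate at \<open>y\<close> by \<open>z \<bullet> y - conj_real h z\<close>.
\<close>

lemma subdiff_conjugate_inverse:
  fixes h :: "'a::euclidean_space \<Rightarrow> ereal"
  assumes h: "proper_fun h" "lsc_fun h" "convex_fun h"
    and z: "z \<in> edom (conjugate h)"
    and sub: "\<And>w. w \<in> edom (conjugate h) \<Longrightarrow> conj_real h z + y \<bullet> (w - z) \<le> conj_real h w"
  shows "z \<in> subdiff h y"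
proof -
  have "h y \<le> ereal (z \<bullet> y - conj_real h z)"
  proof (rule fenchel_moreau[OF h z])
    fix w assume "w \<in> edom (conjugate h)"
    then show "w \<bullet> y - conj_real h w \<le> z \<bullet> y - conj_real h z"
      using sub[of w] by (simp add: inner_diff_right inner_commute)
  qed
  then have y: "y \<in> edom h" and le: "real_of_ereal (h y) \<le> z \<bullet> y - conj_real h z"
    using h(1) by (cases "h y"; auto simp: edom_def proper_fun_def)+
  have "h y + ereal (z \<bullet> (w - y)) \<le> h w" for w
  proof (cases "w \<in> edom h")
    case True
    have "real_of_ereal (h y) + z \<bullet> (w - y) \<le> real_of_ereal (h w)"
      using le fenchel_young[OF h(1) z True] by (simp add: inner_diff_right)
    then show ?thesis
      using proper_fun_real[OF h(1) True] proper_fun_real[OF h(1) y]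
      by (metis ereal_less_eq(3) plus_ereal.simps(1))
  next
    case False then show ?thesis by (simp add: edom_def)
  qed
  then show ?thesis using y by (simp add: subdiff_def)
qed

lemma coercive_quadratic_bound:
  fixes a b e T r :: real
  assumes "a > 0" "a * r\<^sup>2 - b * r - e \<le> T" "r \<ge> 0"
  shows "r \<le> max 1 ((b + \<bar>e + T\<bar>) / a)"
proof (cases "r \<le> 1")
  case False
  have "a * r * r \<le> b * r + \<bar>e + T\<bar>" using assms by (simp add: power2_eq_square algebra_simps)
  also have "\<dots> \<le> b * r + \<bar>e + T\<bar> * r" using False by (simp add: mult_le_cancel_left1)
  finally have "(a * r) * r \<le> (b + \<bar>e + T\<bar>) * r" by (simp add: algebra_simps)
  then have "a * r \<le> b + \<bar>e + T\<bar>" using False by simp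
  then show ?thesis using assms(1) by (simp add: field_simps le_max_iff_disj)
qed auto

text \<open>
  The conjugate of a proper function is minorised by an affine function, so a quadratically coercive
  perturbation makes sublevel sets bounded. The conjugate is only lower
  semicontinuous, so the height is minimised over the closed epigraph, cut off at the height of a
  known point. The map \<open>\<pi>\<close> lets the conjugate
  depend on one component only.
\<close>

lemma conjugate_plus_coercive_attains_min:
  fixes h :: "'a::euclidean_space \<Rightarrow> ereal" and \<pi> :: "'b::euclidean_space \<Rightarrow> 'a"
  assumes h: "proper_fun h"
    and cont: "continuous_on UNIV \<pi>" "continuous_on UNIV q" and \<pi>: "\<And>z. norm (\<pi> z) \<le> norm z"
    and co: "a > 0" "\<And>z. a * (norm z)\<^sup>2 - b * norm z - e \<le> q z"
    and zi: "\<pi> zi \<in> edom (conjugate h)"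
  shows "\<exists>z. is_arg_min (\<lambda>z. conjugate h (\<pi> z) + ereal (q z)) (\<lambda>_. True) z"
proof -
  let ?H = "\<lambda>z. conjugate h (\<pi> z) + ereal (q z)"
  obtain y0 where y0: "y0 \<in> edom h" using h by (auto simp: proper_fun_def)
  define T where "T = conj_real h (\<pi> zi) + q zi"
  define b' where "b' = b + norm y0"
  define e' where "e' = e + real_of_ereal (h y0)"
  have iff: "?H z \<le> ereal t \<longleftrightarrow> conjugate h (\<pi> z) \<le> ereal (t - q z)" for z t
    by (cases "conjugate h (\<pi> z)") auto
  have low: "a * (norm z)\<^sup>2 - b' * norm z - e' \<le> t" if "?H z \<le> ereal t" for z t
  proof -
    have "\<pi> z \<bullet> y0 - real_of_ereal (h y0) \<le> t - q z"
      using that iff conjugate_le_iff[OF h] y0 by blast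
    moreover have "\<bar>\<pi> z \<bullet> y0\<bar> \<le> norm z * norm y0"
      using Cauchy_Schwarz_ineq2[of "\<pi> z" y0] \<pi>[of z] by (meson mult_right_mono norm_ge_zero order_trans)
    ultimately show ?thesis using co(2)[of z] by (simp add: b'_def e'_def algebra_simps)
  qed
  define K where "K = {p :: 'b \<times> real. ?H (fst p) \<le> ereal (snd p) \<and> snd p \<le> T}"
  define R where "R = max 1 ((b' + \<bar>e' + T\<bar>) / a)"
  have K_norm: "norm z \<le> R" if "(z, t) \<in> K" for z t
  proof -
    have "?H z \<le> ereal T" using that by (auto simp: K_def intro: order_trans)
    from coercive_quadratic_bound[OF co(1) low[OF this]] show ?thesis by (simp add: R_def)
  qed
  have K_sub: "K \<subseteq> cball 0 R \<times> {- \<bar>b'\<bar> * R - e' .. T}"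
  proof
    fix p assume p: "p \<in> K"
    obtain z t where zt: "p = (z, t)" by (cases p)
    have "norm z \<le> R" using K_norm p zt by blast
    moreover have "- \<bar>b'\<bar> * R - e' \<le> t"
    proof -
      have "a * (norm z)\<^sup>2 - b' * norm z - e' \<le> t" using low p zt by (auto simp: K_def)
      moreover have "b' * norm z \<le> \<bar>b'\<bar> * R" using \<open>norm z \<le> R\<close>
        by (meson abs_ge_self abs_ge_zero mult_mono norm_ge_zero order_trans)
      moreover have "a * (norm z)\<^sup>2 \<ge> 0" using co(1) by simp
      ultimately show ?thesis by linarith
    qed
    ultimately show "p \<in> cball 0 R \<times> {- \<bar>b'\<bar> * R - e' .. T}" using p zt by (auto simp: K_def)
  qed
  have "closed K"
  proof -
    have "K = (\<lambda>p. (\<pi> (fst p), snd p - q (fst p))) -` {p. conjugate h (fst p) \<le> ereal (snd p)}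
        \<inter> {p. snd p \<le> T}"
      using iff by (auto simp: K_def)
    moreover have "continuous_on UNIV (\<lambda>p :: 'b \<times> real. \<pi> (fst p))"
      "continuous_on UNIV (\<lambda>p :: 'b \<times> real. q (fst p))"
      by (rule continuous_on_compose2[OF cont(1)] continuous_on_compose2[OF cont(2)];
          auto intro: continuous_intros)+
    then have "continuous_on UNIV (\<lambda>p :: 'b \<times> real. (\<pi> (fst p), snd p - q (fst p)))"
      by (intro continuous_on_Pair continuous_on_diff continuous_on_snd continuous_on_id)
    then have "closed ((\<lambda>p. (\<pi> (fst p), snd p - q (fst p))) -` {p. conjugate h (fst p) \<le> ereal (snd p)})"
      by (intro closed_vimage[OF closed_epigraph_conjugate[OF h]])
    moreover have "closed {p :: 'b \<times> real. snd p \<le> T}"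
      by (intro closed_Collect_le continuous_intros)
    ultimately show ?thesis by auto
  qed
  moreover have "bounded K"
    by (rule bounded_subset[OF _ K_sub]) (intro bounded_Times bounded_cball bounded_closed_interval)
  ultimately have "compact K" by (simp add: compact_eq_bounded_closed)
  moreover have "?H zi = ereal T"
    by (metis conjugate_eq_real[OF h zi] T_def plus_ereal.simps(1))
  then have "(zi, T) \<in> K" by (simp add: K_def)
  ultimately have "\<exists>p\<in>K. \<forall>p'\<in>K. snd p \<le> snd p'"
    by (intro continuous_attains_inf continuous_on_snd continuous_on_id) auto
  then obtain p where p: "p \<in> K" "\<forall>p'\<in>K. snd p \<le> snd p'" by blast
  have "\<not> ?H z < ?H (fst p)" for z
  proof
    assume less: "?H z < ?H (fst p)"
    have Hp: "?H (fst p) \<le> ereal (snd p)" "snd p \<le> T" using p(1) by (auto simp: K_def)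
    have "?H z \<noteq> -\<infinity>" using conjugate_not_MInf[OF h] by simp
    then obtain t where t: "?H z = ereal t" using less by (cases "?H z") auto
    then have lt: "t < snd p" using less Hp(1) by (metis less_ereal.simps(1) order_less_le_trans)
    then have "(z, t) \<in> K" using t Hp(2) by (auto simp: K_def)
    then show False using p(2) lt by fastforce
  qed
  then show ?thesis by (auto simp: is_arg_min_def)
qed

text \<open>
  Divide by \<open>t\<close> and let \<open>t\<close> tend to zero. This is how every optimality condition below is obtained.
\<close>

lemma first_order_of_quadratic_perturbation:
  fixes d l q :: real
  assumes "\<And>t. 0 < t \<Longrightarrow> t \<le> 1 \<Longrightarrow> 0 \<le> t * d + t * l + t\<^sup>2 * q"
  shows "0 \<le> d + l"
proof (rule ccontr)
  assume "\<not> 0 \<le> d + l"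
  then have neg: "d + l < 0" by simp
  define Q where "Q = \<bar>q\<bar> + 1"
  have Q: "Q > 0" "q \<le> Q" by (auto simp: Q_def)
  define t where "t = min 1 (- (d + l) / (2 * Q))"
  have t: "0 < t" "t \<le> 1" using neg Q by (auto simp: t_def divide_pos_pos)
  have "t * (d + l + t * q) \<ge> 0" using assms[OF t] by (simp add: power2_eq_square algebra_simps)
  then have "d + l + t * q \<ge> 0" using t by (simp add: zero_le_mult_iff)
  moreover have "t * q \<le> t * Q" using t Q by (intro mult_left_mono) auto
  moreover have "t \<le> - (d + l) / (2 * Q)" by (simp add: t_def)
  then have "t * Q \<le> - (d + l) / 2" using Q by (simp add: field_simps)
  ultimately have "0 \<le> (d + l) + (- (d + l) / 2)" by (meson add_left_mono order_trans)
  also have "\<dots> = (d + l) / 2" by (simp add: field_simps)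
  finally show False using neg by simp
qed

text \<open>
  Moving from the minimiser towards \<open>u\<close>, the convex part changes at most linearly in \<open>t\<close> and \<open>q\<close> changes by
  \<open>t * l + t\<^sup>2 * Q\<close>; the first-order term must therefore be nonnegative.
\<close>

lemma composite_min_variational:
  assumes h: "proper_fun h"
    and mem: "\<pi> z \<in> edom (conjugate h)" "\<pi> u \<in> edom (conjugate h)"
    and lin: "\<And>t. \<pi> (z + t *\<^sub>R (u - z)) = (1 - t) *\<^sub>R \<pi> z + t *\<^sub>R \<pi> u"
    and q: "\<And>t. q (z + t *\<^sub>R (u - z)) = q z + t * l + t\<^sup>2 * Q"
    and min: "is_arg_min (\<lambda>z. conjugate h (\<pi> z) + ereal (q z)) (\<lambda>_. True) z"
  shows "conj_real h (\<pi> z) \<le> conj_real h (\<pi> u) + l"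
proof -
  have "0 \<le> (conj_real h (\<pi> u) - conj_real h (\<pi> z)) + l"
  proof (rule first_order_of_quadratic_perturbation)
    fix t :: real assume t: "0 < t" "t \<le> 1"
    let ?w = "z + t *\<^sub>R (u - z)"
    have w: "\<pi> ?w \<in> edom (conjugate h)"
      "conj_real h (\<pi> ?w) \<le> (1 - t) * conj_real h (\<pi> z) + t * conj_real h (\<pi> u)"
      using conj_real_convex_comb[OF h mem, of t] t lin by auto
    have "conjugate h (\<pi> z) + ereal (q z) \<le> conjugate h (\<pi> ?w) + ereal (q ?w)"
      using min by (auto simp: is_arg_min_def not_less)
    then have "conj_real h (\<pi> z) + q z \<le> conj_real h (\<pi> ?w) + q ?w"
      using conjugate_eq_real[OF h mem(1)] conjugate_eq_real[OF h w(1)]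
      by (metis ereal_less_eq(3) plus_ereal.simps(1))
    then show "0 \<le> t * (conj_real h (\<pi> u) - conj_real h (\<pi> z)) + t * l + t\<^sup>2 * Q"
      using w(2) q by (simp add: algebra_simps)
  qed
  then show ?thesis by simp
qed

lemma prox_conjugate:
  fixes h :: "'a::euclidean_space \<Rightarrow> ereal" and v :: 'a
  assumes h: "proper_fun h" and dom: "a \<in> edom (conjugate h)" and L: "L > 0"
  defines "p \<equiv> prox (1 / L) (conjugate h) v"
  shows "p \<in> edom (conjugate h)"
    and "u \<in> edom (conjugate h) \<Longrightarrow> conj_real h p + L * ((v - p) \<bullet> (u - p)) \<le> conj_real h u"
proof -
  define q where "q = (\<lambda>w. L / 2 * (norm (w - v))\<^sup>2)"
  have ex: "\<exists>z. is_arg_min (\<lambda>w. conjugate h (id w) + ereal (q w)) (\<lambda>_. True) z"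
  proof (rule conjugate_plus_coercive_attains_min[OF h, where a = "L / 2" and b = "L * norm v" and e = 0])
    fix z :: 'a
    have "(norm (z - v))\<^sup>2 = (norm z)\<^sup>2 - 2 * (z \<bullet> v) + (norm v)\<^sup>2"
      by (simp add: power2_norm_eq_inner inner_diff algebra_simps inner_commute)
    moreover have "z \<bullet> v \<le> norm z * norm v" by (rule norm_cauchy_schwarz)
    ultimately have "(norm (z - v))\<^sup>2 \<ge> (norm z)\<^sup>2 - 2 * (norm z * norm v)" by (smt (verit) zero_le_power2)
    then have "L / 2 * (norm (z - v))\<^sup>2 \<ge> L / 2 * ((norm z)\<^sup>2 - 2 * (norm z * norm v))"
      using L by (intro mult_left_mono) auto
    then show "L / 2 * (norm z)\<^sup>2 - L * norm v * norm z - 0 \<le> q z"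
      by (simp add: q_def algebra_simps)
  qed (use L dom in \<open>auto simp: q_def intro!: continuous_intros\<close>)
  have "p = arg_min (\<lambda>w. conjugate h (id w) + ereal (q w)) (\<lambda>_. True)"
    by (simp add: p_def prox_def q_def mult.commute)
  then have min: "is_arg_min (\<lambda>w. conjugate h (id w) + ereal (q w)) (\<lambda>_. True) p"
    using someI_ex[OF ex] by (simp add: arg_min_def)
  have "conjugate h p + ereal (q p) \<le> conjugate h a + ereal (q a)"
    using min by (auto simp: is_arg_min_def not_less)
  then show p: "p \<in> edom (conjugate h)" using dom
    by (cases "conjugate h a"; cases "conjugate h p") (auto simp: edom_def)
  assume u: "u \<in> edom (conjugate h)"
  have "conj_real h (id p) \<le> conj_real h (id u) + L * ((p - v) \<bullet> (u - p))"
  proof (rule composite_min_variational[OF h _ _ _ _ min])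
    fix t :: real
    have "p + t *\<^sub>R (u - p) - v = (p - v) + t *\<^sub>R (u - p)" by simp
    then have "(norm (p + t *\<^sub>R (u - p) - v))\<^sup>2
        = (norm (p - v))\<^sup>2 + 2 * t * ((p - v) \<bullet> (u - p)) + t\<^sup>2 * (norm (u - p))\<^sup>2"
      unfolding power2_norm_eq_inner
      by (simp only: inner_add_left inner_add_right) (simp add: power2_eq_square inner_commute)
    then show "q (p + t *\<^sub>R (u - p)) = q p + t * (L * ((p - v) \<bullet> (u - p))) + t\<^sup>2 * (L / 2 * (norm (u - p))\<^sup>2)"
      unfolding q_def by (simp only:) (simp add: distrib_left)
  qed (use p u in \<open>auto simp: algebra_simps\<close>)
  moreover have "(p - v) \<bullet> (u - p) = - ((v - p) \<bullet> (u - p))"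
    by (simp add: inner_diff_left)
  ultimately show "conj_real h p + L * ((v - p) \<bullet> (u - p)) \<le> conj_real h u"
    by simp
qed

section \<open>Spectral bounds for stacked matrices\<close>

text \<open>
  The library simplification to row-vector products would hide the adjoint structure.
\<close>

declare transpose_matrix_vector [simp del]

text \<open>
  A pair of dual blocks as one vector, so that spectral facts about the stacked matrix apply to pairs.
\<close>

definition stackv :: "(real^'m) \<times> (real^'n) \<Rightarrow> real^('m::finite + 'n::finite)" where
  "stackv z = (\<chi> i. case i of Inl p \<Rightarrow> fst z $ p | Inr q \<Rightarrow> snd z $ q)"

lemma sum_UNIV_Plus:
  "(\<Sum>i\<in>(UNIV :: ('m::finite + 'n::finite) set). f i) = (\<Sum>p\<in>UNIV. f (Inl p)) + (\<Sum>q\<in>UNIV. f (Inr q))"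
  by (subst UNIV_Plus_UNIV[symmetric], subst sum.Plus) auto

lemma inner_stackv: "stackv z \<bullet> stackv w = z \<bullet> w"
  by (simp add: stackv_def inner_vec_def sum_UNIV_Plus inner_prod_def)

lemma norm_stackv: "norm (stackv z) = norm z"
  by (simp add: norm_eq_sqrt_inner inner_stackv)

lemma transpose_stack_stackv:
  "transpose (stack M N) *v stackv z = transpose M *v fst z + transpose N *v snd z"
  by (simp add: vec_eq_iff matrix_vector_mult_def transpose_def stack_def stackv_def sum_UNIV_Plus)

lemma inner_transpose_mult:
  fixes M :: "real^'d^'k"
  shows "(transpose M *v x) \<bullet> y = x \<bullet> (M *v y)"
  by (simp add: dot_lmul_matrix transpose_matrix_vector)

lemma inner_gram_mult:
  fixes M :: "real^'d^'k"
  shows "((M ** transpose M) *v v) \<bullet> w = (transpose M *v v) \<bullet> (transpose M *v w)"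
  using inner_transpose_mult[of M w "transpose M *v v"]
  by (simp only: inner_commute matrix_vector_mul_assoc)

lemma specnorm_nonneg: "0 \<le> specnorm (M :: real^'d^'k)"
  unfolding specnorm_def by (intro onorm_pos_le matrix_vector_mul_bounded_linear)

lemma norm_mult_le_specnorm:
  fixes M :: "real^'d^'k"
  shows "norm (M *v x) \<le> specnorm M * norm x"
  unfolding specnorm_def by (intro onorm matrix_vector_mul_bounded_linear)

lemma norm_transpose_mult_le_specnorm:
  fixes M :: "real^'d^'k"
  shows "norm (transpose M *v y) \<le> specnorm M * norm y"
proof (cases "transpose M *v y = 0")
  case True then show ?thesis by (simp add: specnorm_nonneg)
next
  case False
  have "norm (transpose M *v y) * norm (transpose M *v y) = y \<bullet> (M *v (transpose M *v y))"
    by (metis inner_transpose_mult norm_eq_sqrt_inner real_sqrt_mult_self abs_of_nonneg inner_ge_zero)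
  also have "\<dots> \<le> norm y * norm (M *v (transpose M *v y))" by (rule norm_cauchy_schwarz)
  also have "\<dots> \<le> norm y * (specnorm M * norm (transpose M *v y))"
    by (intro mult_left_mono norm_mult_le_specnorm) auto
  finally have "norm (transpose M *v y) * norm (transpose M *v y)
      \<le> (specnorm M * norm y) * norm (transpose M *v y)" by (simp add: algebra_simps)
  then show ?thesis using False by simp
qed

text \<open>
  A positive semidefinite form vanishes on the diagonal only along its kernel: perturb \<open>v\<close> in the
  direction \<open>- T v\<close>.
\<close>

lemma psd_form_kernel:
  fixes T :: "'a::real_inner \<Rightarrow> 'a"
  assumes T: "linear T" and sym: "\<And>v w. T v \<bullet> w = v \<bullet> T w"
    and psd: "\<And>v. 0 \<le> T v \<bullet> v" and zero: "T v \<bullet> v = 0"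
  shows "T v = 0"
proof -
  have "0 \<le> 2 * (T v \<bullet> (- T v)) + 0"
  proof (rule first_order_of_quadratic_perturbation)
    fix t :: real
    have "0 \<le> T (v + t *\<^sub>R (- T v)) \<bullet> (v + t *\<^sub>R (- T v))" by (rule psd)
    also have "\<dots> = t * (2 * (T v \<bullet> (- T v))) + t\<^sup>2 * (T (T v) \<bullet> T v)"
      using zero sym[of "T v" v] T
      by (simp add: linear_add linear_diff linear_scale inner_add inner_diff power2_eq_square algebra_simps)
    finally show "0 \<le> t * (2 * (T v \<bullet> (- T v))) + t * 0 + t\<^sup>2 * (T (T v) \<bullet> T v)" by simp
  qed
  then show ?thesis by (simp add: inner_gt_zero_iff) (metis inner_gt_zero_iff not_less)
qed

text \<open>
  Eigenvectors of a symmetric matrix for different eigenvalues are orthogonal, hence independent. Finiteness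
  is what gives the maximum and minimum of the spectrum their meaning.
\<close>

lemma finite_eigvals_gram:
  fixes M :: "real^'d^'k"
  shows "finite (eigvals (M ** transpose M))"
proof -
  let ?G = "M ** transpose M"
  define e where "e l = (SOME v. v \<noteq> 0 \<and> ?G *v v = l *s v)" for l
  have e: "e l \<noteq> 0" "?G *v e l = l *\<^sub>R e l" if "l \<in> eigvals ?G" for l
  proof -
    have "\<exists>v. v \<noteq> 0 \<and> ?G *v v = l *s v" using that by (simp add: eigvals_def)
    from someI_ex[OF this] show "e l \<noteq> 0" "?G *v e l = l *\<^sub>R e l"
      by (auto simp: e_def scalar_mult_eq_scaleR)
  qed
  have orth: "e l \<bullet> e m = 0" if "l \<in> eigvals ?G" "m \<in> eigvals ?G" "l \<noteq> m" for l m
  proof -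
    have "l * (e l \<bullet> e m) = (?G *v e l) \<bullet> e m" using e(2)[OF that(1)] by simp
    also have "\<dots> = (?G *v e m) \<bullet> e l"
      unfolding inner_gram_mult by (rule inner_commute)
    also have "\<dots> = m * (e l \<bullet> e m)" using e(2)[OF that(2)] by (simp add: inner_commute)
    finally show ?thesis using that(3) by simp
  qed
  have inj: "inj_on e (eigvals ?G)"
    by (rule inj_onI) (metis orth e(1) inner_eq_zero_iff)
  have "pairwise orthogonal (e ` eigvals ?G)"
    unfolding pairwise_def orthogonal_def using orth by fastforce
  moreover have "0 \<notin> e ` eigvals ?G" using e(1) by auto
  ultimately have "independent (e ` eigvals ?G)" by (rule pairwise_orthogonal_independent)
  then have "finite (e ` eigvals ?G)" by (rule independent_imp_finite)
  then show ?thesis using inj finite_imageD by blast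
qed

text \<open>
  The sign \<open>s\<close> treats maximum and minimum together: \<open>s (m I - M M\<^sup>T)\<close> is positive semidefinite and its
  quadratic form vanishes at \<open>v\<close>.
\<close>

lemma extremal_direction_is_eigenvector:
  fixes M :: "real^'d^'k"
  assumes s: "s = 1 \<or> s = (-1 :: real)"
    and bound: "\<And>v. s * (norm (transpose M *v v))\<^sup>2 \<le> s * m * (norm v)\<^sup>2"
    and v: "norm v = 1" "(norm (transpose M *v v))\<^sup>2 = m"
  shows "m \<in> eigvals (M ** transpose M)"
proof -
  let ?G = "M ** transpose M"
  define T where "T w = s *\<^sub>R (m *\<^sub>R w - ?G *v w)" for w
  have "T v = 0"
  proof (rule psd_form_kernel[of T])
    show "linear T"
      by (intro linearI) (auto simp: T_def matrix_vector_right_distrib matrix_vector_mult_scaleR algebra_simps)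
    show "T x \<bullet> y = x \<bullet> T y" for x y
    proof -
      have "x \<bullet> (?G *v y) = (?G *v x) \<bullet> y" 
        using inner_commute[of "transpose M *v x" "transpose M *v y"] inner_commute[of x "?G *v y"]
        by (simp only: inner_gram_mult)
      then show ?thesis by (simp add: T_def inner_diff)
    qed
    show "0 \<le> T x \<bullet> x" for x
      using bound[of x] by (simp add: T_def inner_diff inner_gram_mult power2_norm_eq_inner algebra_simps)
    show "T v \<bullet> v = 0" using v
      by (simp add: T_def inner_diff inner_gram_mult flip: power2_norm_eq_inner)
  qed
  then have "?G *v v = m *s v" using s by (auto simp: T_def scalar_mult_eq_scaleR)
  moreover have "v \<noteq> 0" using v(1) by auto
  ultimately show ?thesis by (auto simp: eigvals_def)
qed

lemma rayleigh_extremum: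
  fixes M :: "real^'d^'k"
  assumes s: "s = 1 \<or> s = (-1 :: real)"
  obtains m v where "m \<in> eigvals (M ** transpose M)" "norm v = 1" "(norm (transpose M *v v))\<^sup>2 = m"
    "\<And>v. s * (norm (transpose M *v v))\<^sup>2 \<le> s * m * (norm v)\<^sup>2"
proof -
  let ?f = "\<lambda>v. s * (norm (transpose M *v v))\<^sup>2"
  have "\<exists>v\<in>sphere (0::real^'k) 1. \<forall>w\<in>sphere 0 1. ?f w \<le> ?f v"
  proof (rule continuous_attains_sup)
    show "sphere (0::real^'k) 1 \<noteq> {}"
      by (metis SOME_Basis mem_sphere_0 norm_Basis empty_iff)
    show "continuous_on (sphere 0 1) ?f"
      by (intro continuous_intros linear_continuous_on matrix_vector_mul_bounded_linear)
  qed auto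
  then obtain v where v: "norm v = 1" "\<And>w. norm w = 1 \<Longrightarrow> ?f w \<le> ?f v" by auto
  define m where "m = (norm (transpose M *v v))\<^sup>2"
  have bound: "?f w \<le> s * m * (norm w)\<^sup>2" for w
  proof (cases "w = 0")
    case False
    have "?f ((1 / norm w) *\<^sub>R w) \<le> ?f v" using False by (intro v(2)) simp
    moreover have "?f ((1 / norm w) *\<^sub>R w) = ?f w / (norm w)\<^sup>2"
      by (simp add: matrix_vector_mult_scaleR power_divide)
    ultimately show ?thesis using False by (simp add: m_def field_simps)
  qed simp
  have "m \<in> eigvals (M ** transpose M)"
    using extremal_direction_is_eigenvector[OF s bound v(1)] by (simp add: m_def)
  then show ?thesis using that v(1) bound m_def by blast
qed

lemma gram_quadratic_le_lam_max:
  fixes M :: "real^'d^'k"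
  shows "(norm (transpose M *v v))\<^sup>2 \<le> lam_max (M ** transpose M) * (norm v)\<^sup>2"
proof -
  obtain m where m: "m \<in> eigvals (M ** transpose M)"
    "\<And>v. 1 * (norm (transpose M *v v))\<^sup>2 \<le> 1 * m * (norm v)\<^sup>2"
    by (rule rayleigh_extremum[where s = 1]) auto
  have "m \<le> lam_max (M ** transpose M)"
    unfolding lam_max_def by (intro Max_ge finite_eigvals_gram m)
  then have "m * (norm v)\<^sup>2 \<le> lam_max (M ** transpose M) * (norm v)\<^sup>2" by (intro mult_right_mono) auto
  then show ?thesis using m(2)[of v] by simp
qed

lemma lam_max_pos:
  fixes M :: "real^'d^'k"
  assumes "transpose M *v v \<noteq> 0"
  shows "lam_max (M ** transpose M) > 0"
proof -
  have "0 < (norm (transpose M *v v))\<^sup>2" using assms by simp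
  also have "\<dots> \<le> lam_max (M ** transpose M) * (norm v)\<^sup>2" by (rule gram_quadratic_le_lam_max)
  finally show ?thesis by (simp add: zero_less_mult_iff)
qed

lemma gram_quadratic_ge_lam_min_pos:
  fixes M :: "real^'d^'k"
  assumes inj: "\<And>v. transpose M *v v = 0 \<Longrightarrow> v = 0"
  shows "lam_min_pos (M ** transpose M) * (norm v)\<^sup>2 \<le> (norm (transpose M *v v))\<^sup>2"
    and "0 < lam_min_pos (M ** transpose M)"
    and "lam_min_pos (M ** transpose M) \<le> lam_max (M ** transpose M)"
proof -
  let ?E = "{l \<in> eigvals (M ** transpose M). l > 0}"
  obtain m v0 where m: "m \<in> eigvals (M ** transpose M)" "norm v0 = 1" "(norm (transpose M *v v0))\<^sup>2 = m"
    "\<And>v. (-1) * (norm (transpose M *v v))\<^sup>2 \<le> (-1) * m * (norm v)\<^sup>2"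
    by (rule rayleigh_extremum[where s = "-1"]) auto
  have "transpose M *v v0 \<noteq> 0" using inj[of v0] m(2) by auto
  then have "m > 0" using m(3) by auto
  then have mE: "m \<in> ?E" using m(1) by simp
  have fin: "finite ?E" using finite_eigvals_gram[of M] by simp
  have le: "lam_min_pos (M ** transpose M) \<le> m"
    unfolding lam_min_pos_def using Min_le[OF fin mE] .
  then have "lam_min_pos (M ** transpose M) * (norm v)\<^sup>2 \<le> m * (norm v)\<^sup>2" by (intro mult_right_mono) auto
  then show "lam_min_pos (M ** transpose M) * (norm v)\<^sup>2 \<le> (norm (transpose M *v v))\<^sup>2"
    using m(4)[of v] by simp
  show "0 < lam_min_pos (M ** transpose M)"
    unfolding lam_min_pos_def using Min_in[OF fin] mE by blast
  have "m \<le> lam_max (M ** transpose M)"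
    unfolding lam_max_def by (intro Max_ge finite_eigvals_gram m)
  then show "lam_min_pos (M ** transpose M) \<le> lam_max (M ** transpose M)" using le by simp
qed

lemma full_row_rank_transpose_inj:
  fixes M :: "real^'d^'k"
  assumes "rank M = CARD('k)" "transpose M *v v = 0"
  shows "v = 0"
proof -
  have "inj ((*v) (transpose M))" using assms(1) full_rank_injective[of "transpose M"] by (simp add: rank_transpose)
  then show ?thesis using assms(2) by (metis injD matrix_vector_mult_0_right)
qed

section \<open>The accelerated method with restarts\<close>

text \<open>
  The acceleration scheme over an arbitrary basic step \<open>T\<close>, so that its rate depends on a descent inequality
  for \<open>T\<close> alone. A state consists of the iterate, the extrapolated point and the momentum parameter.
\<close>

definition momentum_step :: "('a::real_vector \<Rightarrow> 'a) \<Rightarrow> 'a \<times> 'a \<times> real \<Rightarrow> 'a \<times> 'a \<times> real" where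
  "momentum_step T = (\<lambda>(z, zh, \<alpha>).
     let z' = T zh; \<alpha>' = (1 + sqrt (1 + 4 * \<alpha>\<^sup>2)) / 2
     in (z', z' + ((\<alpha> - 1) / \<alpha>') *\<^sub>R (z' - z), \<alpha>'))"

lemma momentum_parameter:
  fixes \<alpha> :: real
  defines "\<alpha>' \<equiv> (1 + sqrt (1 + 4 * \<alpha>\<^sup>2)) / 2"
  shows "\<alpha>' * (\<alpha>' - 1) = \<alpha>\<^sup>2" "\<alpha>' \<ge> \<alpha> + 1 / 2"
proof -
  define r where "r = sqrt (1 + 4 * \<alpha>\<^sup>2)"
  have r: "r = 2 * \<alpha>' - 1" by (simp add: \<alpha>'_def r_def add_divide_distrib)
  have "\<alpha>' * (\<alpha>' - 1) = (r\<^sup>2 - 1) / 4"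
    by (simp add: r power2_eq_square algebra_simps)
  also have "r\<^sup>2 = 1 + 4 * \<alpha>\<^sup>2" by (simp add: r_def)
  finally show "\<alpha>' * (\<alpha>' - 1) = \<alpha>\<^sup>2" by simp
  have "2 * \<alpha> \<le> sqrt (1 + 4 * \<alpha>\<^sup>2)" by (rule real_le_rsqrt) (simp add: power_mult_distrib)
  then show "\<alpha>' \<ge> \<alpha> + 1 / 2" by (simp add: \<alpha>'_def)
qed

text \<open>
  As functions of \<open>y\<close>, both sides have the same quadratic and linear part; the difference in two arguments
  removes the constants. This turns the weighted sum of two step inequalities into a telescoping term.
\<close>

lemma lyapunov_identity:
  fixes y z s :: "'a::real_inner"
  shows "(norm (a *\<^sub>R y - (a - 1) *\<^sub>R z - s))\<^sup>2 - (norm (a *\<^sub>R y' - (a - 1) *\<^sub>R z - s))\<^sup>2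
    = a * (a - 1) * ((norm (y - z))\<^sup>2 - (norm (y' - z))\<^sup>2) + a * ((norm (y - s))\<^sup>2 - (norm (y' - s))\<^sup>2)"
  unfolding power2_norm_eq_inner
  by (simp add: inner_diff_left inner_diff_right inner_commute power2_eq_square algebra_simps)

text \<open>
  The quantity \<open>2/L * a * (a - 1) * (D z - D s) + |a y - (a - 1) z - s|\<^sup>2\<close> does not increase along the states
  \<open>(z, y, a)\<close>: take \<open>a * (a - 1)\<close> times the step inequality with competitor \<open>z\<close> plus \<open>a\<close> times the one with
  competitor \<open>s\<close>. Initially \<open>a = 1\<close> and only the distance is left; later \<open>a \<ge> j / 2 + 1\<close>, which gives the
  factor \<open>j\<^sup>2 / 4\<close>.
\<close>

lemma momentum_rate:
  fixes D :: "'a::real_inner \<Rightarrow> real"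
  assumes L: "L > 0" and T: "\<And>y. T y \<in> S"
    and step: "\<And>y u. u \<in> S \<Longrightarrow> D (T y) + L / 2 * (norm (T y - u))\<^sup>2 \<le> D u + L / 2 * (norm (y - u))\<^sup>2"
    and z0: "z0 \<in> S" and s: "s \<in> S" and opt: "\<And>u. u \<in> S \<Longrightarrow> D s \<le> D u"
  shows "fst ((momentum_step T ^^ j) (z0, z0, 1)) \<in> S"
    and "(D (fst ((momentum_step T ^^ j) (z0, z0, 1))) - D s) * (real j)\<^sup>2 \<le> 2 * L * (norm (z0 - s))\<^sup>2"
proof -
  let ?st = "\<lambda>j. (momentum_step T ^^ j) (z0, z0, 1)"
  have inv: "\<exists>z y a. ?st j = (z, y, a) \<and> z \<in> S \<and> a \<ge> real j / 2 + 1 \<and>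
     2 / L * (a * (a - 1)) * (D z - D s) + (norm (a *\<^sub>R y - (a - 1) *\<^sub>R z - s))\<^sup>2 \<le> (norm (z0 - s))\<^sup>2" for j
  proof (induction j)
    case 0 then show ?case using z0 by simp
  next
    case (Suc j)
    then obtain z y a where st: "?st j = (z, y, a)" and z: "z \<in> S" and a: "a \<ge> real j / 2 + 1"
      and lyap: "2 / L * (a * (a - 1)) * (D z - D s) + (norm (a *\<^sub>R y - (a - 1) *\<^sub>R z - s))\<^sup>2 \<le> (norm (z0 - s))\<^sup>2"
      by blast
    define b where "b = (1 + sqrt (1 + 4 * a\<^sup>2)) / 2"
    have b: "b * (b - 1) = a\<^sup>2" "b \<ge> a + 1 / 2" using momentum_parameter[of a] by (auto simp: b_def)
    \<comment> \<open>The extrapolation weight is what makes the two combinations in \<open>comb\<close> agree.\<close>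
    define y' where "y' = T y + ((a - 1) / b) *\<^sub>R (T y - z)"
    have st': "?st (Suc j) = (T y, y', b)"
      using st by (simp add: momentum_step_def Let_def b_def y'_def)
    have "b \<noteq> 0" using a b by linarith
    have "b *\<^sub>R y' = b *\<^sub>R T y + (a - 1) *\<^sub>R (T y - z)"
      using \<open>b \<noteq> 0\<close> by (simp add: y'_def scaleR_add_right)
    then have comb: "b *\<^sub>R y' - (b - 1) *\<^sub>R T y - s = a *\<^sub>R T y - (a - 1) *\<^sub>R z - s"
      by (simp add: algebra_simps)
    have "a * (a - 1) * (D (T y) - D z) \<le> a * (a - 1) * (L / 2 * ((norm (y - z))\<^sup>2 - (norm (T y - z))\<^sup>2))"
      using step[OF z, of y] a by (intro mult_left_mono) (auto simp: algebra_simps)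
    moreover have "a * (D (T y) - D s) \<le> a * (L / 2 * ((norm (y - s))\<^sup>2 - (norm (T y - s))\<^sup>2))"
      using step[OF s, of y] a by (intro mult_left_mono) (auto simp: algebra_simps)
    moreover have "a * (a - 1) * (h * p) + a * (h * q) = h * (a * (a - 1) * p + a * q)" for h p q :: real
      by (simp add: algebra_simps)
    ultimately have "a * (a - 1) * (D (T y) - D z) + a * (D (T y) - D s)
        \<le> L / 2 * (a * (a - 1) * ((norm (y - z))\<^sup>2 - (norm (T y - z))\<^sup>2) + a * ((norm (y - s))\<^sup>2 - (norm (T y - s))\<^sup>2))"
      by (metis add_mono)
    also have "\<dots> = L / 2 * ((norm (a *\<^sub>R y - (a - 1) *\<^sub>R z - s))\<^sup>2 - (norm (a *\<^sub>R T y - (a - 1) *\<^sub>R z - s))\<^sup>2)"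
      by (simp only: lyapunov_identity)
    finally have main: "a\<^sup>2 * (D (T y) - D s) - a * (a - 1) * (D z - D s)
        \<le> L / 2 * ((norm (a *\<^sub>R y - (a - 1) *\<^sub>R z - s))\<^sup>2 - (norm (a *\<^sub>R T y - (a - 1) *\<^sub>R z - s))\<^sup>2)"
      by (simp add: algebra_simps power2_eq_square)
    have "2 / L * (a\<^sup>2 * (D (T y) - D s) - a * (a - 1) * (D z - D s))
        \<le> 2 / L * (L / 2 * ((norm (a *\<^sub>R y - (a - 1) *\<^sub>R z - s))\<^sup>2 - (norm (a *\<^sub>R T y - (a - 1) *\<^sub>R z - s))\<^sup>2))"
      using L main by (intro mult_left_mono) auto
    moreover have "2 / L * (L / 2 * x) = x" for x using L by simp
    ultimately have "2 / L * (a\<^sup>2 * (D (T y) - D s)) - 2 / L * (a * (a - 1) * (D z - D s))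
        \<le> (norm (a *\<^sub>R y - (a - 1) *\<^sub>R z - s))\<^sup>2 - (norm (a *\<^sub>R T y - (a - 1) *\<^sub>R z - s))\<^sup>2"
      by (simp only: right_diff_distrib[of "2 / L"])
    then have "2 / L * (b * (b - 1)) * (D (T y) - D s) + (norm (b *\<^sub>R y' - (b - 1) *\<^sub>R T y - s))\<^sup>2
        \<le> 2 / L * (a * (a - 1)) * (D z - D s) + (norm (a *\<^sub>R y - (a - 1) *\<^sub>R z - s))\<^sup>2"
      unfolding comb b(1) mult.assoc by linarith
    with lyap have "2 / L * (b * (b - 1)) * (D (T y) - D s) + (norm (b *\<^sub>R y' - (b - 1) *\<^sub>R T y - s))\<^sup>2
        \<le> (norm (z0 - s))\<^sup>2" by linarith
    moreover have "b \<ge> real (Suc j) / 2 + 1" using a b(2) by (simp add: add_divide_distrib)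
    ultimately show ?case using st' T by blast
  qed
  obtain z y a where st: "?st j = (z, y, a)" and z: "z \<in> S" and a: "a \<ge> real j / 2 + 1"
    and lyap: "2 / L * (a * (a - 1)) * (D z - D s) + (norm (a *\<^sub>R y - (a - 1) *\<^sub>R z - s))\<^sup>2 \<le> (norm (z0 - s))\<^sup>2"
    using inv[of j] by blast
  show "fst (?st j) \<in> S" using st z by simp
  have "(real j / 2) * (real j / 2) \<le> a * (a - 1)" using a by (intro mult_mono) auto
  then have "(real j)\<^sup>2 \<le> 4 * (a * (a - 1))" by (simp add: power2_eq_square)
  then have "(D z - D s) * (real j)\<^sup>2 \<le> (D z - D s) * (4 * (a * (a - 1)))"
    using opt[OF z] by (intro mult_left_mono) auto
  also have "\<dots> = 2 * L * (2 / L * (a * (a - 1)) * (D z - D s))" using L by simp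
  also have "\<dots> \<le> 2 * L * (norm (z0 - s))\<^sup>2"
  proof (rule mult_left_mono)
    show "2 / L * (a * (a - 1)) * (D z - D s) \<le> (norm (z0 - s))\<^sup>2"
      using lyap zero_le_power2[of "norm (a *\<^sub>R y - (a - 1) *\<^sub>R z - s)"] by linarith
  qed (use L in simp)
  finally show "(D (fst (?st j)) - D s) * (real j)\<^sup>2 \<le> 2 * L * (norm (z0 - s))\<^sup>2"
    using st by simp
qed

lemma edist_eq_infdist: "S \<noteq> {} \<Longrightarrow> edist x S = ereal (infdist x S)"
  unfolding edist_def infdist_notempty
  by (subst ereal_Inf') (auto simp: image_image intro: bdd_belowI[of _ 0])

lemma le_infdist_sq:
  assumes "S \<noteq> {}" "c > 0" "\<And>s. s \<in> S \<Longrightarrow> a \<le> c * (dist x s)\<^sup>2"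
  shows "a \<le> c * (infdist x S)\<^sup>2"
proof (cases "a \<le> 0")
  case True
  then show ?thesis using assms(2) by (meson le_less_trans mult_nonneg_nonneg not_less order_less_imp_le zero_le_power2)
next
  case False
  have "sqrt (a / c) \<le> dist x s" if "s \<in> S" for s
    using assms(2) assms(3)[OF that] by (intro real_le_lsqrt) (auto simp: field_simps)
  then have "sqrt (a / c) \<le> infdist x S"
    using assms(1) by (simp add: infdist_notempty cINF_greatest)
  then have "(sqrt (a / c))\<^sup>2 \<le> (infdist x S)\<^sup>2" using assms(2) False by (intro power_mono) auto
  then show ?thesis using assms(2) False by (simp add: field_simps)
qed

text \<open>
  One cycle shrinks the gap to \<open>2 L dist\<^sup>2 / j\<^sup>2\<close>, the growth bound turns the squared distance into \<open>2 / \<rho>\<close>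
  times the old gap, and \<open>j\<^sup>2 \<ge> 8 L / \<rho>\<close> makes the product at most one half. Every cycle starts in the
  initial level set, which is why growth is assumed there.
\<close>

lemma restarted_momentum_halving:
  fixes D :: "'a::real_inner \<Rightarrow> real"
  assumes L: "L > 0" and T: "\<And>y. T y \<in> S"
    and step: "\<And>y u. u \<in> S \<Longrightarrow> D (T y) + L / 2 * (norm (T y - u))\<^sup>2 \<le> D u + L / 2 * (norm (y - u))\<^sup>2"
    and z0: "z0 \<in> S"
    and \<Omega>: "\<Omega> \<noteq> {}" "\<Omega> \<subseteq> S" "\<And>s. s \<in> \<Omega> \<Longrightarrow> D s = m" and opt: "\<And>u. u \<in> S \<Longrightarrow> m \<le> D u"
    and \<rho>: "\<rho> > 0"
    and growth: "\<And>z. z \<in> S \<Longrightarrow> D z \<le> D z0 \<Longrightarrow> \<rho> / 2 * (infdist z \<Omega>)\<^sup>2 \<le> D z - m"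
    and j: "2 * sqrt (2 * L / \<rho>) \<le> real j"
  defines "c \<equiv> \<lambda>z. fst ((momentum_step T ^^ j) (z, z, 1))"
  shows "(c ^^ i) z0 \<in> S" "D ((c ^^ i) z0) - m \<le> (1 / 2) ^ i * (D z0 - m)"
proof -
  have "(2 * sqrt (2 * L / \<rho>))\<^sup>2 \<le> (real j)\<^sup>2" using j L \<rho> by (intro power_mono) auto
  then have j2: "8 * L / \<rho> \<le> (real j)\<^sup>2" using L \<rho> by (simp add: power_mult_distrib)
  then have j0: "0 < (real j)\<^sup>2" using L \<rho> by (meson divide_pos_pos less_le_trans mult_pos_pos zero_less_numeral)
  have cycle: "c z \<in> S \<and> D (c z) - m \<le> (D z - m) / 2" if z: "z \<in> S" "D z \<le> D z0" for z
  proof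
    obtain s where s: "s \<in> \<Omega>" using \<Omega>(1) by blast
    have opt': "\<And>u. u \<in> S \<Longrightarrow> D s' \<le> D u" if "s' \<in> \<Omega>" for s' using \<Omega>(3)[OF that] opt by simp
    show "c z \<in> S" unfolding c_def
      using momentum_rate(1)[where T=T and D=D and S=S, OF L T step z(1) _ opt'[OF s]] s \<Omega>(2) by blast
    have "(D (c z) - m) * (real j)\<^sup>2 \<le> 2 * L * (dist z s')\<^sup>2" if s': "s' \<in> \<Omega>" for s'
      using momentum_rate(2)[where T=T and D=D and S=S, OF L T step z(1) _ opt'[OF s']] s' \<Omega>(2) \<Omega>(3)[OF s']
      unfolding c_def dist_norm by auto
    from le_infdist_sq[OF \<Omega>(1) _ this] L
    have "(D (c z) - m) * (real j)\<^sup>2 \<le> 2 * L * (infdist z \<Omega>)\<^sup>2" by simp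
    also have "\<dots> = 4 * L / \<rho> * (\<rho> / 2 * (infdist z \<Omega>)\<^sup>2)" using \<rho> by simp
    also have "\<dots> \<le> 4 * L / \<rho> * (D z - m)"
      using growth[OF z] L \<rho> by (intro mult_left_mono) auto
    also have "\<dots> = (8 * L / \<rho>) * ((D z - m) / 2)" by simp
    also have "\<dots> \<le> (real j)\<^sup>2 * ((D z - m) / 2)"
      using j2 opt[OF z(1)] by (intro mult_right_mono) auto
    finally show "D (c z) - m \<le> (D z - m) / 2" using j0
      by (metis mult.commute mult_le_cancel_left_pos)
  qed
  have "(c ^^ i) z0 \<in> S \<and> D ((c ^^ i) z0) - m \<le> (1 / 2) ^ i * (D z0 - m)"
  proof (induction i)
    case (Suc i)
    have "(1 / 2) ^ i * (D z0 - m) \<le> 1 * (D z0 - m)"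
      using opt[OF z0] by (intro mult_right_mono) (auto simp: power_le_one)
    from order_trans[OF conjunct2[OF Suc] this] have "D ((c ^^ i) z0) \<le> D z0" by simp
    then show ?case using cycle[of "(c ^^ i) z0"] Suc by simp
  qed (use z0 in simp)
  then show "(c ^^ i) z0 \<in> S" "D ((c ^^ i) z0) - m \<le> (1 / 2) ^ i * (D z0 - m)" by auto
qed

lemma half_power_restarts:
  assumes "\<rho> > 0" "\<mu> > 0" "g \<ge> 0"
  shows "2 / \<rho> * ((1 / 2) ^ nat (max 0 \<lceil>log 2 (2 * g / (\<rho> * \<mu>\<^sup>2))\<rceil>) * g) \<le> \<mu>\<^sup>2"
proof (cases "g = 0")
  case False
  define X where "X = 2 * g / (\<rho> * \<mu>\<^sup>2)"
  define i where "i = nat (max 0 \<lceil>log 2 X\<rceil>)"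
  have X: "X > 0" using assms False by (simp add: X_def)
  have "log 2 X \<le> real i" unfolding i_def by linarith
  then have "X \<le> 2 powr (real i)" using X by (simp add: log_le_iff)
  then have "X \<le> 2 ^ i" by (simp add: powr_realpow)
  then have "2 * g \<le> 2 ^ i * (\<rho> * \<mu>\<^sup>2)" using assms by (simp add: X_def pos_divide_le_eq)
  then have "2 / \<rho> * ((1 / 2) ^ i * g) \<le> \<mu>\<^sup>2" using assms by (simp add: power_divide field_simps)
  then show ?thesis by (simp add: i_def X_def)
qed (use assms in auto)

section \<open>The dual subproblem\<close>

definition stack_adj :: "('d::finite, 'n::finite, 'm::finite) pgdata \<Rightarrow> ('n, 'm) dual \<Rightarrow> real^'d" where
  "stack_adj P z = transpose (matAbar P) *v fst z + transpose (matA P) *v snd z"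

definition dual_quad :: "('d::finite, 'n::finite, 'm::finite) pgdata \<Rightarrow> real^'d \<Rightarrow> ('n, 'm) dual \<Rightarrow> real" where
  "dual_quad P x z = 1 / (2 * tau P) * (norm (dres P x z))\<^sup>2 - z \<bullet> (vecbbar P, vecb P)"

definition dual_grad :: "('d::finite, 'n::finite, 'm::finite) pgdata \<Rightarrow> real^'d \<Rightarrow> ('n, 'm) dual \<Rightarrow> ('n, 'm) dual" where
  "dual_grad P x z = ((1 / tau P) *\<^sub>R (matAbar P *v dres P x z) - vecbbar P,
                  (1 / tau P) *\<^sub>R (matA P *v dres P x z) - vecb P)"

definition dual_dom :: "('d::finite, 'n::finite, 'm::finite) pgdata \<Rightarrow> ('n, 'm) dual set" where
  "dual_dom P = {z. fst z \<in> edom (conjugate (gfun P))}"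

definition dual_val :: "('d::finite, 'n::finite, 'm::finite) pgdata \<Rightarrow> real^'d \<Rightarrow> ('n, 'm) dual \<Rightarrow> real" where
  "dual_val P x z = conj_real (gfun P) (fst z) + dual_quad P x z"

text \<open>
  The proximal gradient step with step size \<open>1 / LD P\<close>; the conjugate acts on the first block only, so the
  second block takes a plain gradient step.
\<close>

definition dual_prox_step :: "('d::finite, 'n::finite, 'm::finite) pgdata \<Rightarrow> real^'d \<Rightarrow> ('n, 'm) dual \<Rightarrow> ('n, 'm) dual" where
  "dual_prox_step P x z = (prox (1 / LD P) (conjugate (gfun P)) (fst z - (1 / LD P) *\<^sub>R fst (dual_grad P x z)),
                  snd z - (1 / LD P) *\<^sub>R snd (dual_grad P x z))"

text \<open>
  The exact proximal-linear step: the point to which the outer update would lead if the dual subproblem were solved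
  exactly.
\<close>

definition exact_step :: "('d::finite, 'n::finite, 'm::finite) pgdata \<Rightarrow> real^'d \<Rightarrow> real^'d" where
  "exact_step P x = - (1 / tau P) *\<^sub>R nu P x"

lemma linear_stack_adj: "linear (stack_adj P)"
  by (rule linearI)
    (auto simp: stack_adj_def matrix_vector_right_distrib matrix_vector_mult_scaleR algebra_simps)

lemma stack_adj_stackv: "stack_adj P z = transpose (matB P) *v stackv z"
  by (simp add: stack_adj_def transpose_stack_stackv)

lemma norm_stack_adj_le: "norm (stack_adj P z) \<le> specnorm (matB P) * norm z"
  using norm_transpose_mult_le_specnorm[of "matB P" "stackv z"] by (simp add: stack_adj_stackv norm_stackv)

lemma norm_stack_adj_sq_le: "(norm (stack_adj P z))\<^sup>2 \<le> lam_max (matB P ** transpose (matB P)) * (norm z)\<^sup>2"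
  using gram_quadratic_le_lam_max[of "matB P" "stackv z"] by (simp add: stack_adj_stackv norm_stackv)

lemma inner_stack_adj: "stack_adj P z \<bullet> x = fst z \<bullet> (matAbar P *v x) + snd z \<bullet> (matA P *v x)"
  by (simp add: stack_adj_def inner_add_left inner_transpose_mult)

lemma dres_stack_adj: "dres P x z = stack_adj P z + gradf P x - tau P *\<^sub>R x"
  by (simp add: dres_def stack_adj_def)

lemma dres_add: "dres P x (z + w) = dres P x z + stack_adj P w"
  by (simp add: dres_stack_adj linear_add[OF linear_stack_adj])

lemma apg_step_eq: "apg_step P x = momentum_step (dual_prox_step P x)"
  by (auto simp: fun_eq_iff apg_step_def momentum_step_def dual_prox_step_def dual_grad_def Let_def)

lemma inner_dual_grad:
  "dual_grad P x z \<bullet> w = (1 / tau P) * (dres P x z \<bullet> stack_adj P w) - w \<bullet> (vecbbar P, vecb P)"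
  using inner_stack_adj[of P w "dres P x z"]
  by (simp add: dual_grad_def inner_prod_def inner_diff inner_commute flip: add_divide_distrib)

text \<open>
  The smooth part of the dual function is quadratic, so its second-order expansion is exact.
\<close>

lemma dual_quad_add:
  "dual_quad P x (z + w) = dual_quad P x z + dual_grad P x z \<bullet> w + 1 / (2 * tau P) * (norm (stack_adj P w))\<^sup>2"
proof -
  have "(norm (dres P x (z + w)))\<^sup>2 = (norm (dres P x z))\<^sup>2 + 2 * (dres P x z \<bullet> stack_adj P w) + (norm (stack_adj P w))\<^sup>2"
    unfolding dres_add power2_norm_eq_inner by (simp add: inner_add inner_commute)
  then show ?thesis
    by (simp add: dual_quad_def inner_dual_grad inner_add_left distrib_left)
qed

locale pg_problem =
  fixes P :: "('d::finite, 'n::finite, 'm::finite) pgdata"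
  assumes std: "standing_assumptions P" and inp: "algorithm_inputs P" and tau: "tau P = 2 * Lf P"
begin

lemma gfun: "proper_fun (gfun P)" "lsc_fun (gfun P)" "convex_fun (gfun P)"
  using std by (auto simp: standing_assumptions_def)

lemma Lf_pos: "Lf P > 0" and lg_pos: "lg P > 0" and sigma_pos: "sigma P > 0"
  and tau_pos: "tau P > 0"
  using std inp by (auto simp: standing_assumptions_def algorithm_inputs_def)

lemma zini_dual_dom: "zini P \<in> dual_dom P"
  using inp by (auto simp: algorithm_inputs_def dual_dom_def)

lemma transpose_A_inj: "transpose (matA P) *v v = 0 \<Longrightarrow> v = 0"
  using std full_row_rank_transpose_inj by (auto simp: standing_assumptions_def)

text \<open>
  The full row rank of \<open>A\<close> makes the second dual block act nontrivially; this keeps the norms and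
  eigenvalues that occur in denominators positive.
\<close>

lemma stack_adj_nonzero: "\<exists>v. v \<noteq> 0 \<and> stack_adj P (0, v) \<noteq> 0"
proof -
  have "(axis undefined 1 :: real^'n) \<noteq> 0" by (simp add: axis_eq_0_iff)
  moreover have "stack_adj P (0, v) = transpose (matA P) *v v" for v by (simp add: stack_adj_def)
  ultimately show ?thesis using transpose_A_inj by metis
qed

lemma specnorm_B_pos: "specnorm (matB P) > 0"
proof -
  obtain v where v: "stack_adj P (0, v) \<noteq> 0" using stack_adj_nonzero by blast
  have "0 < norm (stack_adj P (0, v))" using v by simp
  also have "\<dots> \<le> specnorm (matB P) * norm (0 :: real^'m, v)" by (rule norm_stack_adj_le)
  finally show ?thesis by (simp add: zero_less_mult_iff)
qed

lemma lam_max_B_pos: "lam_max (matB P ** transpose (matB P)) > 0"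
proof -
  obtain v where v: "stack_adj P (0, v) \<noteq> 0" using stack_adj_nonzero by blast
  show ?thesis using lam_max_pos v unfolding stack_adj_stackv by blast
qed

lemma LD_pos: "LD P > 0"
  using lam_max_B_pos tau_pos by (simp add: LD_def)

lemma norm_stack_adj_sq_le_LD: "1 / (2 * tau P) * (norm (stack_adj P z))\<^sup>2 \<le> LD P / 2 * (norm z)\<^sup>2"
  using norm_stack_adj_sq_le[of P z] tau_pos by (simp add: LD_def field_simps)

lemma Dk_eq: "Dk P x z = conjugate (gfun P) (fst z) + ereal (dual_quad P x z)"
  using conjugate_not_MInf[OF gfun(1), of "fst z"]
  by (cases "conjugate (gfun P) (fst z)") (auto simp: Dk_def dual_quad_def inner_prod_def)

lemma Dk_real: "z \<in> dual_dom P \<Longrightarrow> Dk P x z = ereal (dual_val P x z)"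
  using conjugate_eq_real[OF gfun(1), of "fst z"] unfolding Dk_eq dual_val_def dual_dom_def
  by (metis mem_Collect_eq plus_ereal.simps(1))

lemma Dk_infinite: "z \<notin> dual_dom P \<Longrightarrow> Dk P x z = \<infinity>"
  by (simp add: Dk_eq dual_dom_def edom_def)

lemma Omega_iff: "z \<in> Omega P x \<longleftrightarrow> z \<in> dual_dom P \<and> (\<forall>u\<in>dual_dom P. dual_val P x z \<le> dual_val P x u)"
proof -
  have "z \<in> Omega P x \<longleftrightarrow> (\<forall>u. Dk P x z \<le> Dk P x u)"
    by (auto simp: Omega_def is_arg_min_def not_less)
  also have "\<dots> \<longleftrightarrow> z \<in> dual_dom P \<and> (\<forall>u\<in>dual_dom P. dual_val P x z \<le> dual_val P x u)"
    using Dk_real Dk_infinite zini_dual_dom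
    by (metis PInfty_neq_ereal(1) ereal_infty_less_eq(1) ereal_less_eq(1) ereal_less_eq(3))
  finally show ?thesis .
qed

lemma Omega_variational:
  assumes z: "z \<in> Omega P x" and u: "u \<in> dual_dom P"
  shows "conj_real (gfun P) (fst z) \<le> conj_real (gfun P) (fst u) + dual_grad P x z \<bullet> (u - z)"
proof (rule composite_min_variational[where \<pi> = fst and q = "dual_quad P x" and z = z and u = u
      and Q = "1 / (2 * tau P) * (norm (stack_adj P (u - z)))\<^sup>2", OF gfun(1)])
  show "is_arg_min (\<lambda>z. conjugate (gfun P) (fst z) + ereal (dual_quad P x z)) (\<lambda>_. True) z"
    using z by (simp add: Omega_def Dk_eq[abs_def])
  show "dual_quad P x (z + t *\<^sub>R (u - z))
      = dual_quad P x z + t * (dual_grad P x z \<bullet> (u - z)) + t\<^sup>2 * (1 / (2 * tau P) * (norm (stack_adj P (u - z)))\<^sup>2)" for t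
    unfolding dual_quad_add by (simp add: linear_scale[OF linear_stack_adj] power_mult_distrib)
qed (use z u in \<open>auto simp: Omega_iff dual_dom_def algebra_simps\<close>)

text \<open>
  By the exact expansion at a minimiser, the gap is its first-order part, which is nonnegative, plus this term.
\<close>

lemma Omega_growth_residual:
  assumes z: "z \<in> Omega P x" and u: "u \<in> dual_dom P"
  shows "1 / (2 * tau P) * (norm (stack_adj P (u - z)))\<^sup>2 \<le> dual_val P x u - dual_val P x z"
  using Omega_variational[OF z u] dual_quad_add[of P x z "u - z"] by (simp add: dual_val_def)

text \<open>
  Two minimisers have the same value, so the growth of the residual forces equal residuals.
\<close>

lemma nu_eq:
  assumes z: "z \<in> Omega P x"
  shows "nu P x = dres P x z"
proof -
  have "dres P x u = dres P x z" if u: "u \<in> Omega P x" for u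
  proof -
    have "dual_val P x u = dual_val P x z" using z u by (auto simp: Omega_iff intro: antisym)
    then have "1 / (2 * tau P) * (norm (stack_adj P (u - z)))\<^sup>2 \<le> 0"
      using Omega_growth_residual[OF z, of u] u by (simp add: Omega_iff)
    then have "stack_adj P (u - z) = 0" using tau_pos by (simp add: divide_le_0_iff)
    then show ?thesis using dres_add[of P x z "u - z"] by simp
  qed
  then have "dres P x ` Omega P x = {dres P x z}" using z by blast
  then show ?thesis unfolding nu_def by (intro the_equality) auto
qed

lemma exact_step_eq: "z \<in> Omega P x \<Longrightarrow> exact_step P x = x - (1 / tau P) *\<^sub>R (stack_adj P z + gradf P x)"
  using tau_pos by (simp add: exact_step_def nu_eq dres_stack_adj algebra_simps)

lemma dual_grad_exact_step:
  assumes "z \<in> Omega P x"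
  shows "dual_grad P x z = - (matAbar P *v exact_step P x + vecbbar P, matA P *v exact_step P x + vecb P)"
  using nu_eq[OF assms] 
    by (simp add: dual_grad_def exact_step_def matrix_vector_mult_scaleR linear_neg[OF matrix_vector_mul_linear])

text \<open>
  The partial optimality conditions of the dual problem: the free second block gives feasibility, the first block says
  that the image of the exact step is a subgradient of the conjugate, which is then inverted.
\<close>

lemma exact_step_kkt:
  assumes z: "z \<in> Omega P x"
  shows "matA P *v exact_step P x + vecb P = 0"
    and "fst z \<in> subdiff (gfun P) (matAbar P *v exact_step P x + vecbbar P)"
proof -
  let ?r = "matA P *v exact_step P x + vecb P" and ?y = "matAbar P *v exact_step P x + vecbbar P"
  have zd: "z \<in> dual_dom P" using z by (simp add: Omega_iff)
  have "0 \<le> dual_grad P x z \<bullet> ((fst z, snd z + ?r) - z)"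
    using Omega_variational[OF z, of "(fst z, snd z + ?r)"] zd by (simp add: dual_dom_def)
  then have "?r \<bullet> ?r \<le> 0" 
    by (simp add: dual_grad_exact_step[OF z] inner_prod_def inner_add inner_diff inner_commute)
  then show "?r = 0" by (metis inner_gt_zero_iff not_less)
  show "fst z \<in> subdiff (gfun P) ?y"
  proof (rule subdiff_conjugate_inverse[OF gfun])
    show "fst z \<in> edom (conjugate (gfun P))" using zd by (simp add: dual_dom_def)
    fix w assume "w \<in> edom (conjugate (gfun P))"
    then show "conj_real (gfun P) (fst z) + ?y \<bullet> (w - fst z) \<le> conj_real (gfun P) w"
      using Omega_variational[OF z, of "(w, snd z)"]
      by (simp add: dual_dom_def dual_grad_exact_step[OF z] inner_prod_def inner_add inner_diff inner_commute)
  qed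
qed

lemma Dmin_eq:
  assumes "z \<in> Omega P x"
  shows "Dmin P x = ereal (dual_val P x z)"
proof -
  have "\<forall>u. Dk P x z \<le> Dk P x u" using assms by (auto simp: Omega_def is_arg_min_def not_less)
  then have "Dmin P x = Dk P x z" unfolding Dmin_def by (intro antisym INF_lower INF_greatest) auto
  then show ?thesis using Dk_real assms by (simp add: Omega_iff)
qed

lemma gap_eq:
  assumes "z \<in> Omega P x"
  shows "gap P x = dual_val P x (zini P) - dual_val P x z" "gap P x \<ge> 0"
  using assms zini_dual_dom by (auto simp: gap_def Dk_real Dmin_eq Omega_iff)

lemma dual_prox_step_dual_dom: "dual_prox_step P x z \<in> dual_dom P"
  using prox_conjugate(1)[OF gfun(1) _ LD_pos] zini_dual_dom by (auto simp: dual_dom_def dual_prox_step_def)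

text \<open>
  The usual proximal gradient inequality. The quadratic part lies above its linearisation, and below it plus
  \<open>L/2 |.|\<^sup>2\<close>; the proximal point supplies the variational inequality for the conjugate; completing the
  square gives the difference of squared distances to \<open>u\<close>.
\<close>

lemma dual_prox_step_descent:
  assumes u: "u \<in> dual_dom P"
  shows "dual_val P x (dual_prox_step P x y) + LD P / 2 * (norm (dual_prox_step P x y - u))\<^sup>2
    \<le> dual_val P x u + LD P / 2 * (norm (y - u))\<^sup>2"
proof -
  let ?L = "LD P" and ?p = "dual_prox_step P x y" and ?G = "dual_grad P x y"
  define v where "v = fst y - (1 / ?L) *\<^sub>R fst ?G"
  have pf: "fst ?p = prox (1 / ?L) (conjugate (gfun P)) v" by (simp add: dual_prox_step_def v_def)
  have "conj_real (gfun P) (fst ?p) + ?L * ((v - fst ?p) \<bullet> (fst u - fst ?p)) \<le> conj_real (gfun P) (fst u)"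
    unfolding pf using u by (intro prox_conjugate(2)[OF gfun(1) _ LD_pos]) (auto simp: dual_dom_def)
  moreover have "?L * ((v - fst ?p) \<bullet> (fst u - fst ?p)) = (?L *\<^sub>R (y - ?p) - ?G) \<bullet> (u - ?p)"
  proof -
    have "?L *\<^sub>R (v - fst ?p) = ?L *\<^sub>R (fst y - fst ?p) - fst ?G"
      using LD_pos by (simp add: v_def algebra_simps)
    moreover have "?L *\<^sub>R (snd y - snd ?p) - snd ?G = 0"
      using LD_pos by (simp add: dual_prox_step_def)
    ultimately show ?thesis
      by (simp add: inner_prod_def flip: inner_scaleR_left)
  qed
  ultimately have prox: "conj_real (gfun P) (fst ?p) + (?L *\<^sub>R (y - ?p) - ?G) \<bullet> (u - ?p) \<le> conj_real (gfun P) (fst u)"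
    by simp
  have qu: "dual_quad P x y + ?G \<bullet> (u - y) \<le> dual_quad P x u"
    using dual_quad_add[of P x y "u - y"] tau_pos by simp
  have qp: "dual_quad P x ?p \<le> dual_quad P x y + ?G \<bullet> (?p - y) + ?L / 2 * (norm (?p - y))\<^sup>2"
    using dual_quad_add[of P x y "?p - y"] norm_stack_adj_sq_le_LD[of "?p - y"] by simp
  have id: "?L * ((y - ?p) \<bullet> (u - ?p)) - ?L / 2 * (norm (?p - y))\<^sup>2
      = ?L / 2 * (norm (?p - u))\<^sup>2 - ?L / 2 * (norm (y - u))\<^sup>2"
    unfolding power2_norm_eq_inner by (simp add: inner_diff inner_commute algebra_simps)
  have "?G \<bullet> (u - y) = ?G \<bullet> (u - ?p) + ?G \<bullet> (?p - y)" by (simp add: inner_diff_right)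
  then show ?thesis using prox qu qp id by (simp add: dual_val_def inner_diff_left)
qed

text \<open>
  The restarts halve the gap until it is at most \<open>\<rho> \<mu>\<^sup>2 / 2\<close>; the growth bound turns this into distance \<open>\<mu>\<close>.
\<close>

lemma solve_dual_accuracy:
  assumes \<Omega>: "Omega P x \<noteq> {}" and \<rho>: "\<rho> > 0" and \<mu>: "\<mu> > 0"
    and growth: "\<And>z s. z \<in> dual_dom P \<Longrightarrow> dual_val P x z \<le> dual_val P x (zini P) \<Longrightarrow> s \<in> Omega P x \<Longrightarrow>
        \<rho> / 2 * (infdist z (Omega P x))\<^sup>2 \<le> dual_val P x z - dual_val P x s"
    and j: "2 * sqrt (2 * LD P / \<rho>) \<le> real j"
  defines "z \<equiv> restarted_apg P x (restarts P \<rho> \<mu> x) j"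
  shows "fst z \<in> edom (conjugate (gfun P)) \<and> edist z (Omega P x) \<le> ereal \<mu>"
proof -
  obtain s where s: "s \<in> Omega P x" using \<Omega> by blast
  define m where "m = dual_val P x s"
  define i where "i = restarts P \<rho> \<mu> x"
  have same: "dual_val P x s' = m" if "s' \<in> Omega P x" for s'
    using that s by (auto simp: m_def Omega_iff intro: antisym)
  have opt: "m \<le> dual_val P x u" if "u \<in> dual_dom P" for u using that s by (simp add: m_def Omega_iff)
  have z_eq: "z = ((\<lambda>z. fst ((momentum_step (dual_prox_step P x) ^^ j) (z, z, 1))) ^^ i) (zini P)"
    by (simp add: z_def i_def restarted_apg_def apg_cycle_def[abs_def] apg_step_eq)
  have gr: "\<rho> / 2 * (infdist z (Omega P x))\<^sup>2 \<le> dual_val P x z - m"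
    if "z \<in> dual_dom P" "dual_val P x z \<le> dual_val P x (zini P)" for z
    using growth[OF that s] by (simp add: m_def)
  note halving = restarted_momentum_halving[where T = "dual_prox_step P x" and D = "dual_val P x" and S = "dual_dom P"
      and \<Omega> = "Omega P x" and m = m, OF LD_pos dual_prox_step_dual_dom dual_prox_step_descent zini_dual_dom \<Omega> _ same opt \<rho> gr j]
  have zd: "z \<in> dual_dom P" unfolding z_eq by (rule halving(1)) (auto simp: Omega_iff)
  have zm: "dual_val P x z - m \<le> (1 / 2) ^ i * gap P x"
    unfolding z_eq gap_eq(1)[OF s] m_def[symmetric] by (rule halving(2)) (auto simp: Omega_iff)
  have g0: "gap P x \<ge> 0" by (rule gap_eq(2)[OF s])
  have "(1 / 2) ^ i * gap P x \<le> 1 * gap P x"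
    using g0 by (intro mult_right_mono) (auto simp: power_le_one)
  from order_trans[OF zm this] have "dual_val P x z \<le> dual_val P x (zini P)"
    unfolding gap_eq(1)[OF s] m_def by simp
  from gr[OF zd this] have "2 / \<rho> * (\<rho> / 2 * (infdist z (Omega P x))\<^sup>2) \<le> 2 / \<rho> * ((1 / 2) ^ i * gap P x)"
    using \<rho> zm by (intro mult_left_mono) auto
  also have "\<dots> \<le> \<mu>\<^sup>2" unfolding i_def restarts_def by (rule half_power_restarts[OF \<rho> \<mu> g0])
  finally have "2 / \<rho> * (\<rho> / 2 * (infdist z (Omega P x))\<^sup>2) \<le> \<mu>\<^sup>2" .
  then have "(infdist z (Omega P x))\<^sup>2 \<le> \<mu>\<^sup>2" using \<rho> by simp
  then have "infdist z (Omega P x) \<le> \<mu>" by (rule power2_le_imp_le) (rule less_imp_le[OF \<mu>])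
  then show ?thesis using zd \<Omega> by (simp add: edist_eq_infdist dual_dom_def)
qed

lemma growth_of_full_rank:
  assumes rank: "rank (matB P) = CARD('m + 'n)" and s: "s \<in> Omega P x" and z: "z \<in> dual_dom P"
  shows "kappaD P / 2 * (infdist z (Omega P x))\<^sup>2 \<le> dual_val P x z - dual_val P x s"
proof -
  let ?l = "lam_min_pos (matB P ** transpose (matB P))"
  have l: "?l * (norm (z - s))\<^sup>2 \<le> (norm (stack_adj P (z - s)))\<^sup>2" "0 < ?l"
    using gram_quadratic_ge_lam_min_pos(1,2)[of "matB P", OF full_row_rank_transpose_inj[OF rank]]
    by (metis stack_adj_stackv norm_stackv)+
  have "infdist z (Omega P x) \<le> norm (z - s)" using infdist_le[OF s, of z] by (simp add: dist_norm)
  then have "(infdist z (Omega P x))\<^sup>2 \<le> (norm (z - s))\<^sup>2" by (intro power_mono infdist_nonneg) auto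
  then have "?l * (infdist z (Omega P x))\<^sup>2 \<le> (norm (stack_adj P (z - s)))\<^sup>2"
    using l by (meson mult_left_mono order_trans less_imp_le)
  then have "kappaD P / 2 * (infdist z (Omega P x))\<^sup>2 \<le> 1 / (2 * tau P) * (norm (stack_adj P (z - s)))\<^sup>2"
    using tau_pos by (simp add: kappaD_def field_simps)
  then show ?thesis using Omega_growth_residual[OF s z] by simp
qed

lemma Omega_nonempty_of_full_rank:
  assumes rank: "rank (matB P) = CARD('m + 'n)"
  shows "Omega P x \<noteq> {}"
proof -
  let ?l = "lam_min_pos (matB P ** transpose (matB P))"
  have l: "?l * (norm z)\<^sup>2 \<le> (norm (stack_adj P z))\<^sup>2" "0 < ?l" for z
    using gram_quadratic_ge_lam_min_pos(1,2)[of "matB P", OF full_row_rank_transpose_inj[OF rank]]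
    by (metis stack_adj_stackv norm_stackv)+
  have "\<exists>z. is_arg_min (\<lambda>z. conjugate (gfun P) (fst z) + ereal (dual_quad P x z)) (\<lambda>_. True) z"
  proof (rule conjugate_plus_coercive_attains_min[OF gfun(1), where zi = "zini P"
        and a = "?l / (2 * tau P)" and b = "norm (dual_grad P x 0)" and e = "- dual_quad P x 0"])
    show "continuous_on UNIV (dual_quad P x)"
      unfolding dual_quad_def dres_def
      by (intro continuous_intros matrix_vector_mult_linear_continuous_on
          continuous_on_compose2[OF matrix_vector_mult_linear_continuous_on]) auto
    fix z
    have "dual_quad P x z = dual_quad P x 0 + dual_grad P x 0 \<bullet> z + 1 / (2 * tau P) * (norm (stack_adj P z))\<^sup>2"
      using dual_quad_add[of P x 0 z] by simp
    moreover have "1 / (2 * tau P) * (?l * (norm z)\<^sup>2) \<le> 1 / (2 * tau P) * (norm (stack_adj P z))\<^sup>2"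
      using l tau_pos by (intro mult_left_mono) auto
    moreover have "\<bar>dual_grad P x 0 \<bullet> z\<bar> \<le> norm (dual_grad P x 0) * norm z" by (rule Cauchy_Schwarz_ineq2)
    ultimately show "?l / (2 * tau P) * (norm z)\<^sup>2 - norm (dual_grad P x 0) * norm z - (- dual_quad P x 0) \<le> dual_quad P x z"
      by simp
  qed (use l tau_pos zini_dual_dom in \<open>auto simp: dual_dom_def norm_fst_le intro!: continuous_intros\<close>)
  then show ?thesis by (auto simp: Omega_def Dk_eq[abs_def])
qed

end

section \<open>Quadratic growth from the Hoffman inequality\<close>

text \<open>
  The conjugate of the support function of a polyhedron is the indicator of the polyhedron: outside,
  multiples of a violated row make the conjugate infinite; inside, the value at \<open>y = 0\<close> is optimal.
\<close>

lemma support_function_conjugate: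
  fixes h :: "real^'m::finite \<Rightarrow> ereal" and C :: "real^'m^'p::finite"
  assumes h: "proper_fun h" and sup: "support_function_of h C dv"
    and u: "u \<in> edom (conjugate h)"
  shows "(C *v u) $ i \<le> dv $ i" and "conj_real h u = 0"
proof -
  let ?K = "{u. \<forall>i. (C *v u) $ i \<le> dv $ i}"
  have h_eq: "h y = (SUP u\<in>?K. ereal (u \<bullet> y))" for y
    using sup by (simp add: support_function_of_def)
  have ne: "?K \<noteq> {}"
  proof
    assume "?K = {}"
    then have "h 0 = - \<infinity>" unfolding h_eq by (simp only: image_empty Sup_empty bot_ereal_def)
    then show False using h by (simp add: proper_fun_def)
  qed
  then have h0: "h 0 = 0" by (simp add: h_eq zero_ereal_def)
  have rows: "(C *v u) $ i \<le> dv $ i" for i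
  proof (rule ccontr)
    assume "\<not> ?thesis"
    then have pos: "(C *v u) $ i - dv $ i > 0" by simp
    have inner_row: "v \<bullet> row i C = (C *v v) $ i" for v
      by (simp add: matrix_vector_mul_component row_def inner_commute vec_lambda_eta)
    have bound: "t * ((C *v u) $ i - dv $ i) \<le> conj_real h u" if "t \<ge> 0" for t
    proof -
      have "h (t *\<^sub>R row i C) \<le> ereal (t * dv $ i)"
        unfolding h_eq using that by (intro SUP_least) (auto simp: inner_row intro: mult_left_mono)
      moreover have "t *\<^sub>R row i C \<in> edom h" using calculation by (auto simp: edom_def)
      ultimately have "real_of_ereal (h (t *\<^sub>R row i C)) \<le> t * dv $ i" "t *\<^sub>R row i C \<in> edom h"
        using proper_fun_real[OF h] by (metis ereal_less_eq(3))+
      then show ?thesis using fenchel_young[OF h u, of "t *\<^sub>R row i C"]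
        by (simp add: inner_row right_diff_distrib)
    qed
    define t where "t = (\<bar>conj_real h u\<bar> + 1) / ((C *v u) $ i - dv $ i)"
    have "t \<ge> 0" unfolding t_def using pos by (intro divide_nonneg_pos; linarith)
    moreover have "t * ((C *v u) $ i - dv $ i) = \<bar>conj_real h u\<bar> + 1" using pos by (simp add: t_def)
    ultimately show False using bound[of t] by linarith
  qed
  then show "(C *v u) $ i \<le> dv $ i" .
  show "conj_real h u = 0"
  proof (rule antisym)
    show "conj_real h u \<le> 0"
      unfolding conj_real_le_iff[OF h u]
    proof
      fix y assume y: "y \<in> edom h"
      have "ereal (u \<bullet> y) \<le> h y" unfolding h_eq by (rule SUP_upper) (use rows in auto)
      then show "u \<bullet> y - real_of_ereal (h y) \<le> 0"
        using proper_fun_real[OF h y] by (metis diff_le_0_iff_le ereal_less_eq(3))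
    qed
    have "0 \<in> edom h" by (simp add: edom_def h0)
    then show "0 \<le> conj_real h u" using fenchel_young[OF h u, of 0] h0 by simp
  qed
qed

context pg_problem begin

lemma Omega_nonempty_of_hoffman:
  assumes "hoffman P C dv theta x"
  shows "Omega P x \<noteq> {}"
proof
  assume "Omega P x = {}"
  then have "edist (0 :: ('n, 'm) dual) (Omega P x) = \<infinity>" by (simp add: edist_def top_ereal_def)
  then show False using assms unfolding hoffman_def Let_def
    by (metis PInfty_neq_ereal(1) ereal_infty_less_eq(1))
qed

lemma rho_pos:
  assumes "Omega P x \<noteq> {}" "theta > 0" "w \<ge> 0"
  shows "rho P theta w x > 0"
proof -
  have "gap P x \<ge> 0" using gap_eq(2) assms(1) by blast
  then have "tau P + gap P x + w * (norm (nu P x))\<^sup>2 > 0"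
    using tau_pos assms(3) by (intro add_pos_nonneg) auto
  then show ?thesis using assms(2) tau_pos by (simp add: rho_def)
qed

text \<open>
  Suppose that the shifts are nonzero. With \<open>G\<close> the gap at \<open>z\<close> and \<open>r\<^sub>1\<close>, \<open>r\<^sub>2\<close> the first two blocks of the Hoffman residual, one has
  \<open>|r\<^sub>1|\<^sup>2 \<le> 2 \<tau> G\<close> and \<open>r\<^sub>2 = q - \<nu> \<bullet> r\<^sub>1 / \<tau>\<close>, where \<open>0 \<le> q \<le> G\<close> is the first-order part of the gap. On the
  initial level set \<open>q\<^sup>2\<close> is at most the initial gap times \<open>G\<close>, so
  \<open>|r\<^sub>1|\<^sup>2 + r\<^sub>2\<^sup>2\<close> is at most \<open>2 G\<close> times \<open>\<tau> + gap + (2 / \<tau>) |\<nu>|\<^sup>2\<close>; this is where \<open>w \<ge> 2 / \<tau>\<close> enters.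
  The third block vanishes on the domain. Without shifts the bound on \<open>r\<^sub>1\<close> is already enough.
\<close>

lemma growth_of_hoffman:
  fixes C :: "real^'m^'p::finite"
  assumes sup: "support_function_of (gfun P) C dv" and hof: "hoffman P C dv theta x"
    and theta: "theta > 0"
    and w: "w \<ge> 2 / tau P \<or> (vecbbar P = 0 \<and> vecb P = 0)"
    and s: "s \<in> Omega P x" and z: "z \<in> dual_dom P" and level: "dual_val P x z \<le> dual_val P x (zini P)"
  shows "rho P theta w x / 2 * (infdist z (Omega P x))\<^sup>2 \<le> dual_val P x z - dual_val P x s"
proof -
  define G where "G = dual_val P x z - dual_val P x s"
  define r1 where "r1 = dres P x z - nu P x"
  define r2 where "r2 = - (fst z \<bullet> vecbbar P) - snd z \<bullet> vecb P - real_of_ereal (Dmin P x)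
               + 1 / (2 * tau P) * (norm (nu P x))\<^sup>2"
  have sd: "s \<in> dual_dom P" using s by (simp add: Omega_iff)
  have r1: "r1 = stack_adj P (z - s)" using nu_eq[OF s] dres_add[of P x s "z - s"] by (simp add: r1_def)
  have "(\<chi> i. max 0 ((C *v fst z - dv) $ i)) = 0"
    using support_function_conjugate(1)[OF gfun(1) sup, of "fst z"] z
    by (auto simp: vec_eq_iff dual_dom_def max_def intro: antisym)
  then have "edist z (Omega P x) \<le> ereal (theta * (if vecbbar P \<noteq> 0 \<or> vecb P \<noteq> 0
      then norm (r1, r2, 0 :: real^'p) else norm (r1, 0 :: real^'p)))"
    using hof unfolding hoffman_def Let_def r1_def r2_def by metis
  moreover have "edist z (Omega P x) = ereal (infdist z (Omega P x))"
    using s by (intro edist_eq_infdist) auto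
  ultimately have dist: "infdist z (Omega P x) \<le> theta * (if vecbbar P \<noteq> 0 \<or> vecb P \<noteq> 0
      then sqrt ((norm r1)\<^sup>2 + r2\<^sup>2) else norm r1)"
    by (cases "vecbbar P = 0 \<and> vecb P = 0") (auto simp: norm_Pair)
  have a: "(norm r1)\<^sup>2 \<le> 2 * tau P * G"
    using Omega_growth_residual[OF s z] tau_pos by (simp add: r1 G_def field_simps)
  have G0: "G \<ge> 0" using s z by (simp add: G_def Omega_iff)
  show ?thesis
  proof (cases "vecbbar P \<noteq> 0 \<or> vecb P \<noteq> 0")
    case False
    have "infdist z (Omega P x) \<le> theta * norm r1" using dist False by simp
    then have "(infdist z (Omega P x))\<^sup>2 \<le> (theta * norm r1)\<^sup>2" by (intro power_mono infdist_nonneg)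
    also have "\<dots> \<le> theta\<^sup>2 * (2 * tau P * G)"
      using a by (simp add: power_mult_distrib mult_left_mono)
    finally show ?thesis using False theta tau_pos
      by (simp add: rho_def field_simps flip: G_def)
  next
    case True
    define N where "N = norm (nu P x)"
    have cz: "conj_real (gfun P) (fst z) = 0" "conj_real (gfun P) (fst s) = 0"
      using support_function_conjugate(2)[OF gfun(1) sup] z sd by (auto simp: dual_dom_def)
    have "r2 = - ((z - s) \<bullet> (vecbbar P, vecb P))"
      using nu_eq[OF s] cz
      by (simp add: r2_def Dmin_eq[OF s] dual_val_def dual_quad_def inner_prod_def inner_diff_left)
    then have r2: "r2 = dual_grad P x s \<bullet> (z - s) - (1 / tau P) * (nu P x \<bullet> r1)"
      by (simp add: inner_dual_grad r1 nu_eq[OF s])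
    have G_eq: "G = dual_grad P x s \<bullet> (z - s) + 1 / (2 * tau P) * (norm r1)\<^sup>2"
      using dual_quad_add[of P x s "z - s"] cz by (simp add: G_def dual_val_def r1)
    define q where "q = dual_grad P x s \<bullet> (z - s)"
    have q: "0 \<le> q" "q \<le> G"
      using Omega_variational[OF s z] cz G_eq tau_pos by (auto simp: q_def)
    have gap: "G \<le> gap P x" using level by (simp add: G_def gap_eq(1)[OF s])
    have "(a - b)\<^sup>2 \<le> 2 * a\<^sup>2 + 2 * b\<^sup>2" for a b :: real
      using zero_le_power2[of "a + b"] by (simp add: power2_eq_square algebra_simps)
    then have "r2\<^sup>2 \<le> 2 * q\<^sup>2 + 2 * ((1 / tau P) * (nu P x \<bullet> r1))\<^sup>2"
      unfolding r2 q_def .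
    moreover have "q\<^sup>2 \<le> gap P x * G" using q gap by (simp add: power2_eq_square mult_mono)
    moreover have "((1 / tau P) * (nu P x \<bullet> r1))\<^sup>2 \<le> 2 / tau P * N\<^sup>2 * G"
    proof -
      have "\<bar>nu P x \<bullet> r1\<bar> \<le> N * norm r1" unfolding N_def by (rule Cauchy_Schwarz_ineq2)
      then have "(nu P x \<bullet> r1)\<^sup>2 \<le> (N * norm r1)\<^sup>2" by (metis abs_ge_zero power2_abs power_mono)
      also have "\<dots> \<le> N\<^sup>2 * (2 * tau P * G)" using a by (simp add: power_mult_distrib mult_left_mono)
      finally have "(1 / tau P)\<^sup>2 * (nu P x \<bullet> r1)\<^sup>2 \<le> (1 / tau P)\<^sup>2 * (N\<^sup>2 * (2 * tau P * G))"
        by (intro mult_left_mono) auto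
      also have "\<dots> = 2 / tau P * N\<^sup>2 * G" using tau_pos by (simp add: power2_eq_square)
      finally show ?thesis by (simp only: power_mult_distrib)
    qed
    ultimately have "r2\<^sup>2 \<le> 2 * (gap P x * G) + 2 * (2 / tau P * N\<^sup>2 * G)" by linarith
    then have "(norm r1)\<^sup>2 + r2\<^sup>2 \<le> 2 * G * (tau P + gap P x + 2 / tau P * N\<^sup>2)"
      using a by (simp add: algebra_simps)
    also have "\<dots> \<le> 2 * G * (tau P + gap P x + w * N\<^sup>2)"
      using True w G0 by (intro mult_left_mono add_left_mono mult_right_mono) auto
    finally have sq: "(norm r1)\<^sup>2 + r2\<^sup>2 \<le> 2 * G * (tau P + gap P x + w * N\<^sup>2)" .
    have w0: "w \<ge> 0" using True w tau_pos by (auto intro: order_trans[rotated])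
    have "gap P x \<ge> 0" using gap_eq(2)[OF s] .
    then have E: "tau P + gap P x + w * N\<^sup>2 > 0"
      using tau_pos w0 by (intro add_pos_nonneg) auto
    have "infdist z (Omega P x) \<le> theta * sqrt ((norm r1)\<^sup>2 + r2\<^sup>2)" using dist True by simp
    then have "(infdist z (Omega P x))\<^sup>2 \<le> (theta * sqrt ((norm r1)\<^sup>2 + r2\<^sup>2))\<^sup>2"
      by (intro power_mono infdist_nonneg)
    also have "\<dots> = theta\<^sup>2 * ((norm r1)\<^sup>2 + r2\<^sup>2)" by (simp add: power_mult_distrib)
    also have "\<dots> \<le> theta\<^sup>2 * (2 * G * (tau P + gap P x + w * N\<^sup>2))"
      using sq by (intro mult_left_mono) auto
    finally have "(infdist z (Omega P x))\<^sup>2 \<le> 2 * G / rho P theta w x"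
      using True by (simp add: rho_def N_def field_simps)
    moreover have "rho P theta w x > 0" using s by (intro rho_pos[OF _ theta w0]) auto
    ultimately show ?thesis by (simp add: field_simps G_def)
  qed
qed

end

section \<open>Descent and stationarity of the exact points\<close>

lemma lipschitz_gradient_upper_bound:
  fixes f :: "'a::real_inner \<Rightarrow> real"
  assumes f: "\<And>x. GDERIV f x :> g x" and g: "L-lipschitz_on UNIV g"
  shows "f y \<le> f x + g x \<bullet> (y - x) + L / 2 * (norm (y - x))\<^sup>2"
proof -
  define d where "d = y - x"
  define \<phi> where "\<phi> t = f (x + t *\<^sub>R d) - t * (g x \<bullet> d) - L / 2 * t\<^sup>2 * (norm d)\<^sup>2" for t :: real
  have "\<phi> 1 \<le> \<phi> 0"
  proof (rule DERIV_nonpos_imp_nonincreasing[of 0 1 \<phi>])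
    fix t :: real assume t: "0 \<le> t" "t \<le> 1"
    have "(f has_derivative (\<lambda>h. h \<bullet> g (x + t *\<^sub>R d))) (at (x + t *\<^sub>R d))"
      using f by (simp add: gderiv_def)
    moreover have "((\<lambda>t. x + t *\<^sub>R d) has_derivative (\<lambda>s. s *\<^sub>R d)) (at t)"
      by (auto intro!: derivative_eq_intros)
    ultimately have "((\<lambda>t. f (x + t *\<^sub>R d)) has_derivative (\<lambda>s. s *\<^sub>R d \<bullet> g (x + t *\<^sub>R d))) (at t)"
      using has_derivative_compose by fastforce
    then have "DERIV (\<lambda>t. f (x + t *\<^sub>R d)) t :> g (x + t *\<^sub>R d) \<bullet> d"
      by (rule has_derivative_imp_has_field_derivative) (simp add: inner_commute)
    then have "DERIV \<phi> t :> g (x + t *\<^sub>R d) \<bullet> d - g x \<bullet> d - L * t * (norm d)\<^sup>2"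
      unfolding \<phi>_def by (auto intro!: derivative_eq_intros)
    moreover have "g (x + t *\<^sub>R d) \<bullet> d - g x \<bullet> d - L * t * (norm d)\<^sup>2 \<le> 0"
    proof -
      have "(g (x + t *\<^sub>R d) - g x) \<bullet> d \<le> norm (g (x + t *\<^sub>R d) - g x) * norm d" by (rule norm_cauchy_schwarz)
      also have "\<dots> \<le> (L * norm (t *\<^sub>R d)) * norm d"
        using lipschitz_onD[OF g, of "x + t *\<^sub>R d" x] by (intro mult_right_mono) (auto simp: dist_norm)
      also have "\<dots> = L * t * (norm d)\<^sup>2" using t by (simp add: power2_eq_square)
      finally show ?thesis by (simp add: inner_diff_left)
    qed
    ultimately show "\<exists>y. DERIV \<phi> t :> y \<and> y \<le> 0" by blast
  qed simp
  then show ?thesis by (simp add: \<phi>_def d_def)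
qed

lemma lipschitz_gradient_lower_bound:
  fixes f :: "'a::real_inner \<Rightarrow> real"
  assumes f: "\<And>x. GDERIV f x :> g x" and g: "L-lipschitz_on UNIV g"
  shows "f x + g x \<bullet> (y - x) \<le> f y + L / 2 * (norm (y - x))\<^sup>2"
proof -
  have "L-lipschitz_on UNIV (\<lambda>x. - g x)"
    using g by (auto simp: lipschitz_on_def dist_norm norm_minus_commute)
  moreover have "\<And>x. GDERIV (\<lambda>x. - f x) x :> - g x" using f by (rule GDERIV_minus)
  ultimately show ?thesis
    using lipschitz_gradient_upper_bound[of "\<lambda>x. - f x" "\<lambda>x. - g x" L y x] by simp
qed

lemma sum_inverse_squares_le: "(\<Sum>j<k. 1 / (real j + 1)\<^sup>2) \<le> 3"
proof -
  \<comment> \<open>The subtracted term makes the induction close, by \<open>1 / n\<^sup>2 \<le> 2 / (n (n + 1))\<close>.\<close>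
  have "(\<Sum>j<k. 1 / (real j + 1)\<^sup>2) \<le> 3 - 2 / (real k + 1)"
  proof (induction k)
    case (Suc k)
    have "(real k + 1) * (real k + 2) \<le> 2 * (real k + 1)\<^sup>2"
      by (simp add: power2_eq_square algebra_simps)
    then have "2 / (2 * (real k + 1)\<^sup>2) \<le> 2 / ((real k + 1) * (real k + 2))"
      by (intro divide_left_mono) auto
    then have "1 / (real k + 1)\<^sup>2 \<le> 2 / ((real k + 1) * (real k + 2))" by simp
    also have "\<dots> = 2 / (real k + 1) - 2 / (real k + 2)" by (simp add: field_simps)
    finally show ?case using Suc by (simp add: add.commute)
  qed simp
  then show ?thesis by (smt (verit) divide_nonneg_nonneg of_nat_0_le_iff)
qed

text \<open>
  The inner solver matters below through its accuracy only; unfolding an iterate would expose its code.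
\<close>

declare iterate.simps(2) [simp del]

context pg_problem begin

definition feasible :: "real^'d \<Rightarrow> bool" where
  "feasible v \<longleftrightarrow> matA P *v v + vecb P = 0 \<and> matAbar P *v v + vecbbar P \<in> edom (gfun P)"

definition F0_real :: "real^'d \<Rightarrow> real" where
  "F0_real v = f0 P v + real_of_ereal (gfun P (matAbar P *v v + vecbbar P))"

lemma F0_eq: "feasible v \<Longrightarrow> F0 P v = ereal (F0_real v)"
  using proper_fun_real[OF gfun(1)] unfolding feasible_def F0_def F0_real_def
  by (metis plus_ereal.simps(1))

lemma feasible_xini: "feasible (xini P)"
  using inp by (auto simp: feasible_def algorithm_inputs_def)

lemma F0_real_ge: "feasible v \<Longrightarrow> F0_real v \<ge> F0_real (xini P) - DeltaF0 P"
  and DeltaF0_nonneg: "DeltaF0 P \<ge> 0"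
proof -
  let ?m = "INF x. F0 P x"
  have le: "?m \<le> ereal (F0_real v)" if "feasible v" for v
    using F0_eq[OF that] by (metis INF_lower UNIV_I)
  have "?m > -\<infinity>" using std by (simp add: standing_assumptions_def)
  then obtain m where m: "?m = ereal m" using le[OF feasible_xini] by (cases ?m) auto
  have "DeltaF0 P = F0_real (xini P) - m"
    by (simp add: DeltaF0_def m F0_eq[OF feasible_xini])
  then show "feasible v \<Longrightarrow> F0_real v \<ge> F0_real (xini P) - DeltaF0 P" "DeltaF0 P \<ge> 0"
    using le[of v] le[OF feasible_xini] m by auto
qed

lemma gradf: "GDERIV (f0 P) x :> gradf P x" "(Lf P)-lipschitz_on UNIV (gradf P)"
  using std by (auto simp: standing_assumptions_def)

text \<open>
  Add the subgradient inequality for \<open>g\<close> at the exact step (the multiplier of the equality constraint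
  drops out between feasible points), the three-point identity, and the upper and lower quadratic bounds for \<open>f\<^sub>0\<close>.
  With \<open>\<tau> = 2 L\<^sub>f\<close> the coefficient of \<open>|u - x|\<^sup>2\<close> is \<open>(\<tau> - L\<^sub>f) / 2\<close> and that of \<open>|v - x|\<^sup>2\<close> is
  \<open>(\<tau> + L\<^sub>f) / 2\<close>.
\<close>

lemma prox_linear_descent:
  assumes \<Omega>: "Omega P x \<noteq> {}" and v: "feasible v"
  shows "feasible (exact_step P x)"
    and "F0_real (exact_step P x) + Lf P / 2 * (norm (exact_step P x - x))\<^sup>2 \<le> F0_real v + 3 * Lf P / 2 * (norm (v - x))\<^sup>2"
proof -
  let ?u = "exact_step P x"
  let ?y = "\<lambda>v. matAbar P *v v + vecbbar P"
  obtain z where z: "z \<in> Omega P x" using \<Omega> by blast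
  have sub: "?y ?u \<in> edom (gfun P)" "gfun P (?y ?u) + ereal (fst z \<bullet> (?y v - ?y ?u)) \<le> gfun P (?y v)"
    using exact_step_kkt(2)[OF z] unfolding subdiff_def by blast+
  show fu: "feasible ?u" using exact_step_kkt(1)[OF z] sub(1) by (simp add: feasible_def)
  have vd: "?y v \<in> edom (gfun P)" using v by (simp add: feasible_def)
  have g: "real_of_ereal (gfun P (?y ?u)) + fst z \<bullet> (?y v - ?y ?u) \<le> real_of_ereal (gfun P (?y v))"
    using sub(2) proper_fun_real[OF gfun(1) sub(1)] proper_fun_real[OF gfun(1) vd]
    by (metis ereal_less_eq(3) plus_ereal.simps(1))
  have "matA P *v (v - ?u) = 0"
    using v fu by (simp add: feasible_def matrix_vector_mult_diff_distrib add_eq_0_iff)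
  then have "fst z \<bullet> (?y v - ?y ?u) = stack_adj P z \<bullet> (v - ?u)"
    by (simp add: inner_stack_adj matrix_vector_mult_diff_distrib)
  moreover have "stack_adj P z = - (gradf P x) - tau P *\<^sub>R (?u - x)"
    using tau_pos by (simp add: exact_step_eq[OF z] algebra_simps)
  moreover have "gradf P x \<bullet> (v - ?u) = gradf P x \<bullet> (v - x) - gradf P x \<bullet> (?u - x)"
    by (simp add: inner_diff_right)
  ultimately have lin: "fst z \<bullet> (?y v - ?y ?u)
      = - (gradf P x \<bullet> (v - x)) + gradf P x \<bullet> (?u - x) - tau P * ((?u - x) \<bullet> (v - ?u))"
    by (simp add: inner_diff_left)
  have "(?u - x) \<bullet> (v - ?u) = ((norm (v - x))\<^sup>2 - (norm (?u - x))\<^sup>2 - (norm (v - ?u))\<^sup>2) / 2"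
    unfolding power2_norm_eq_inner by (simp add: inner_diff inner_commute)
  then have "tau P * ((?u - x) \<bullet> (v - ?u))
      = Lf P * (norm (v - x))\<^sup>2 - Lf P * (norm (?u - x))\<^sup>2 - Lf P * (norm (v - ?u))\<^sup>2"
    by (simp only: tau) (simp add: field_simps)
  moreover have "Lf P * (norm (v - ?u))\<^sup>2 \<ge> 0" using Lf_pos by simp
  ultimately show "F0_real ?u + Lf P / 2 * (norm (?u - x))\<^sup>2 \<le> F0_real v + 3 * Lf P / 2 * (norm (v - x))\<^sup>2"
    using g lin lipschitz_gradient_upper_bound[OF gradf, of ?u x] lipschitz_gradient_lower_bound[OF gradf, of x v]
    by (simp add: F0_real_def)
qed


text \<open>
  The residual is \<open>\<nabla>f\<^sub>0 u - \<nabla>f\<^sub>0 x - \<tau> (u - x)\<close>, of norm at most \<open>(L\<^sub>f + \<tau>) |u - x|\<close>.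
\<close>

lemma eps_kkt_exact_step:
  assumes \<Omega>: "Omega P x \<noteq> {}" and small: "3 * Lf P * norm (exact_step P x - x) \<le> eps" and eps: "0 \<le> eps"
  shows "eps_kkt P eps (exact_step P x)"
proof -
  let ?u = "exact_step P x"
  obtain z where z: "z \<in> Omega P x" using \<Omega> by blast
  let ?r = "gradf P ?u + transpose (matA P) *v snd z + transpose (matAbar P) *v fst z"
  have "stack_adj P z = - (gradf P x) - tau P *\<^sub>R (?u - x)"
    using tau_pos by (simp add: exact_step_eq[OF z] algebra_simps)
  then have r: "?r = (gradf P ?u - gradf P x) - tau P *\<^sub>R (?u - x)" by (simp add: stack_adj_def algebra_simps)
  have "norm ?r \<le> norm (gradf P ?u - gradf P x) + norm (tau P *\<^sub>R (?u - x))"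
    unfolding r by (rule norm_triangle_ineq4)
  also have "\<dots> \<le> Lf P * norm (?u - x) + tau P * norm (?u - x)"
    using lipschitz_onD[OF gradf(2), of ?u x] tau_pos by (simp add: dist_norm)
  also have "\<dots> = 3 * Lf P * norm (?u - x)" by (simp add: tau)
  finally have r_le: "norm ?r \<le> eps" using small by simp
  let ?S = "(\<lambda>s. gradf P ?u + transpose (matA P) *v snd z + transpose (matAbar P) *v s) `
      subdiff (gfun P) (matAbar P *v ?u + vecbbar P)"
  have "?r \<in> ?S" using exact_step_kkt(2)[OF z] by blast
  then have "edist 0 ?S \<le> ereal (dist 0 ?r)" unfolding edist_def by (rule INF_lower)
  also have "\<dots> \<le> ereal eps" using r_le by simp
  finally have "edist 0 ?S \<le> ereal eps" .
  then show ?thesis using exact_step_kkt(1)[OF z] eps unfolding eps_kkt_def by (intro exI[of _ "snd z"]) auto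
qed

lemma inexact_step_error:
  assumes ok: "step1_ok P s mu k"
  shows "Omega P (xk P s k) \<noteq> {}"
    and "norm (xk P s (Suc k) - exact_step P (xk P s k)) \<le> specnorm (matB P) / tau P * mu k (xk P s k)"
proof -
  let ?x = "xk P s k"
  define z where "z = solve_dual P s k ?x"
  have z: "edist z (Omega P ?x) \<le> ereal (mu k ?x)" using ok by (simp add: step1_ok_def Let_def z_def)
  show ne: "Omega P ?x \<noteq> {}"
  proof
    assume "Omega P ?x = {}"
    then show False using z by (simp add: edist_def top_ereal_def)
  qed
  have xk_Suc: "xk P s (Suc k) = ?x - (1 / tau P) *\<^sub>R (stack_adj P z + gradf P ?x)"
    by (simp add: iterate.simps(2) Let_def z_def stack_adj_def)
  let ?e = "norm (xk P s (Suc k) - exact_step P ?x)"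
  have lower: "?e * tau P / specnorm (matB P) \<le> dist z u" if u: "u \<in> Omega P ?x" for u
  proof -
    have "xk P s (Suc k) - exact_step P ?x = - (1 / tau P) *\<^sub>R stack_adj P (z - u)"
      unfolding xk_Suc exact_step_eq[OF u] by (simp add: linear_diff[OF linear_stack_adj] algebra_simps)
    then have "?e * tau P = norm (stack_adj P (z - u))" using tau_pos by simp
    also have "\<dots> \<le> specnorm (matB P) * dist z u" unfolding dist_norm by (rule norm_stack_adj_le)
    finally show ?thesis using specnorm_B_pos by (simp add: divide_le_eq mult.commute)
  qed
  have "?e * tau P / specnorm (matB P) \<le> infdist z (Omega P ?x)"
    unfolding infdist_notempty[OF ne] by (rule cINF_greatest[OF ne]) (rule lower)
  also have "\<dots> \<le> mu k ?x" using z edist_eq_infdist[OF ne] by simp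
  finally have bound: "?e * tau P / specnorm (matB P) \<le> mu k ?x" .
  have "e * t / B \<le> m \<Longrightarrow> t > 0 \<Longrightarrow> B > 0 \<Longrightarrow> e \<le> B / t * m" for e t B m :: real
    by (simp add: field_simps)
  from this[OF bound tau_pos specnorm_B_pos] show "?e \<le> specnorm (matB P) / tau P * mu k ?x" .
qed

lemma mubar_le:
  "mubar P eps delta x \<le> tau P * delta / specnorm (matB P)"
  "mubar P eps delta x \<le> eps / (6 * specnorm (matB P))"
  unfolding mubar_def by (rule Min_le; (intro finite.intros | blast))+

text \<open>
  The exact points run one index ahead of the iterate from which they are computed; index 0 is the feasible
  initial point.
\<close>

definition exact_point :: "'d schedule \<Rightarrow> nat \<Rightarrow> real^'d" where
  "exact_point s k = (case k of 0 \<Rightarrow> xini P | Suc j \<Rightarrow> exact_step P (xk P s j))"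

lemma exact_point_simps [simp]:
  "exact_point s 0 = xini P" "exact_point s (Suc k) = exact_step P (xk P s k)"
  by (simp_all add: exact_point_def)

lemma exact_point_error:
  assumes adm: "admissible P eps delta" and ok: "step1_ok P s mu k"
    and mu: "mu k (xk P s k) \<le> c * mubar P eps delta (xk P s k)" and c: "0 \<le> c" "c \<le> 1"
  shows "norm (xk P s (Suc k) - exact_point s (Suc k)) \<le> delta"
    and "norm (exact_point s (Suc k) - xk P s (Suc k)) \<le> c * (eps / (12 * Lf P))"
proof -
  let ?m = "mubar P eps delta (xk P s k)" and ?B = "specnorm (matB P)"
  let ?e = "norm (xk P s (Suc k) - exact_step P (xk P s k))"
  have e: "?e \<le> ?B / tau P * (c * ?m)"
  proof -
    have "?B / tau P * mu k (xk P s k) \<le> ?B / tau P * (c * ?m)"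
      using mu tau_pos specnorm_B_pos by (intro mult_left_mono) auto
    then show ?thesis using inexact_step_error(2)[OF ok] by (rule order_trans[rotated])
  qed
  have "?B / tau P * (c * ?m) \<le> ?B / tau P * (c * (eps / (6 * ?B)))"
    using mubar_le(2) tau_pos specnorm_B_pos c by (intro mult_left_mono) auto
  also have "\<dots> = c * (eps / (12 * Lf P))" using specnorm_B_pos by (simp add: tau)
  finally show "norm (exact_point s (Suc k) - xk P s (Suc k)) \<le> c * (eps / (12 * Lf P))"
    using e by (simp add: norm_minus_commute)
  have "?B / tau P * (c * ?m) \<le> ?B / tau P * (c * (tau P * delta / ?B))"
    using mubar_le(1) tau_pos specnorm_B_pos c by (intro mult_left_mono) auto
  also have "\<dots> = c * delta" using tau_pos specnorm_B_pos by simp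
  also have "\<dots> \<le> delta" using c adm by (simp add: admissible_def mult_left_le_one_le)
  finally show "norm (xk P s (Suc k) - exact_point s (Suc k)) \<le> delta"
    using e by simp
qed

lemma telescoped_descent:
  assumes "\<And>k. k < K \<Longrightarrow> Omega P (xk P s k) \<noteq> {}"
  shows "feasible (exact_point s K)"
    and "F0_real (exact_point s K) + Lf P / 2 * (\<Sum>k<K. (norm (exact_point s (Suc k) - xk P s k))\<^sup>2)
      \<le> F0_real (xini P) + 3 * Lf P / 2 * (\<Sum>k<K. (norm (exact_point s k - xk P s k))\<^sup>2)"
proof -
  have "feasible (exact_point s K) \<and>
    F0_real (exact_point s K) + Lf P / 2 * (\<Sum>k<K. (norm (exact_point s (Suc k) - xk P s k))\<^sup>2)
      \<le> F0_real (xini P) + 3 * Lf P / 2 * (\<Sum>k<K. (norm (exact_point s k - xk P s k))\<^sup>2)"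
    using assms
  proof (induction K)
    case 0 then show ?case by (simp add: feasible_xini)
  next
    case (Suc K)
    have f: "feasible (exact_point s K)" using Suc by simp
    have "F0_real (exact_point s (Suc K)) + Lf P / 2 * (norm (exact_point s (Suc K) - xk P s K))\<^sup>2
        \<le> F0_real (exact_point s K) + 3 * Lf P / 2 * (norm (exact_point s K - xk P s K))\<^sup>2"
      using prox_linear_descent(2)[OF Suc.prems[of K] f] by simp
    moreover have "feasible (exact_point s (Suc K))"
      using prox_linear_descent(1)[OF Suc.prems[of K] f] by simp
    moreover have "F0_real (exact_point s K) + Lf P / 2 * (\<Sum>k<K. (norm (exact_point s (Suc k) - xk P s k))\<^sup>2)
      \<le> F0_real (xini P) + 3 * Lf P / 2 * (\<Sum>k<K. (norm (exact_point s k - xk P s k))\<^sup>2)"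
      using Suc by simp
    ultimately show ?case
      unfolding sum.lessThan_Suc distrib_left by - (rule conjI, assumption, linarith)
  qed
  then show "feasible (exact_point s K)"
    "F0_real (exact_point s K) + Lf P / 2 * (\<Sum>k<K. (norm (exact_point s (Suc k) - xk P s k))\<^sup>2)
      \<le> F0_real (xini P) + 3 * Lf P / 2 * (\<Sum>k<K. (norm (exact_point s k - xk P s k))\<^sup>2)" by auto
qed

text \<open>
  The errors enter with \<open>3 L\<^sub>f / 2 * (\<epsilon> / (12 L\<^sub>f))\<^sup>2 = \<epsilon>\<^sup>2 / (96 L\<^sub>f)\<close> per iteration.
\<close>

lemma exact_step_sum:
  assumes adm: "admissible P eps delta" and ok: "\<And>k. k < K \<Longrightarrow> step1_ok P s mu k"
    and mu: "\<And>k x. mu k x \<le> mubar P eps delta x"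
  shows "Lf P / 2 * (\<Sum>k<K. (norm (exact_point s (Suc k) - xk P s k))\<^sup>2)
      \<le> DeltaF0 P + real K * eps\<^sup>2 / (96 * Lf P)"
proof -
  have eps: "0 < eps" using adm by (simp add: admissible_def)
  have "(norm (exact_point s k - xk P s k))\<^sup>2 \<le> (eps / (12 * Lf P))\<^sup>2" if k: "k < K" for k
  proof (cases k)
    case (Suc j)
    have "norm (exact_point s k - xk P s k) \<le> 1 * (eps / (12 * Lf P))"
      unfolding Suc using k Suc by (intro exact_point_error(2)[OF adm ok]) (auto simp: mu)
    then show ?thesis by (intro power_mono) auto
  qed simp
  then have "(\<Sum>k<K. (norm (exact_point s k - xk P s k))\<^sup>2) \<le> (\<Sum>k<K. (eps / (12 * Lf P))\<^sup>2)"
    by (intro sum_mono) auto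
  then have "3 * Lf P / 2 * (\<Sum>k<K. (norm (exact_point s k - xk P s k))\<^sup>2)
      \<le> 3 * Lf P / 2 * (real K * (eps / (12 * Lf P))\<^sup>2)"
    using Lf_pos by (intro mult_left_mono) auto
  also have "\<dots> = real K * eps\<^sup>2 / (96 * Lf P)" using Lf_pos by (simp add: power2_eq_square)
  finally show ?thesis
    using telescoped_descent[of K s] inexact_step_error(1)[OF ok] F0_real_ge[of "exact_point s K"] by fastforce
qed

lemma Kbar_bounds:
  assumes "eps > 0"
  shows "120 * Lf P * DeltaF0 P \<le> real (Kbar P eps) * eps\<^sup>2"
    and "real (Kbar P eps) * eps\<^sup>2 \<le> 120 * Lf P * DeltaF0 P + eps\<^sup>2"
proof -
  let ?q = "120 * Lf P * DeltaF0 P / eps\<^sup>2"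
  have q: "0 \<le> ?q" using Lf_pos DeltaF0_nonneg by simp
  have "?q \<le> real (Kbar P eps)" "real (Kbar P eps) \<le> ?q + 1"
    using q unfolding Kbar_def by linarith+
  then show "120 * Lf P * DeltaF0 P \<le> real (Kbar P eps) * eps\<^sup>2"
    "real (Kbar P eps) * eps\<^sup>2 \<le> 120 * Lf P * DeltaF0 P + eps\<^sup>2"
    using assms by (simp_all add: field_simps)
qed

text \<open>
  If all steps were longer than \<open>\<epsilon> / (3 L\<^sub>f)\<close>, the left side of the summed descent would be at least
  \<open>K \<epsilon>\<^sup>2 / (18 L\<^sub>f)\<close>, while its right side is at most \<open>(1/120 + 1/96) K \<epsilon>\<^sup>2 / L\<^sub>f\<close>. If \<open>K = 0\<close>, the initial point
  already minimises the objective, so descent cannot move it and it is itself a KKT point.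
\<close>

theorem finds_kkt_of_accurate_steps:
  assumes adm: "admissible P eps delta" and ok: "\<And>k. k < Kbar P eps \<Longrightarrow> step1_ok P s mu k"
    and mu: "\<And>k x. mu k x \<le> mubar P eps delta x"
    and \<Omega>0: "Omega P (xini P) \<noteq> {}"
  shows "finds_kkt P s eps delta"
proof -
  let ?K = "Kbar P eps" and ?step = "\<lambda>k. norm (exact_point s (Suc k) - xk P s k)"
  have eps: "0 < eps" and delta: "0 < delta" using adm by (auto simp: admissible_def)
  show ?thesis
  proof (cases "\<exists>k<?K. 3 * Lf P * ?step k \<le> eps")
    case True
    then obtain k where k: "k < ?K" "3 * Lf P * ?step k \<le> eps" by blast
    have "eps_kkt P eps (exact_point s (Suc k))"
      using eps_kkt_exact_step[OF inexact_step_error(1)[OF ok[OF k(1)]]] k(2) eps by simp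
    moreover have "norm (xk P s (Suc k) - exact_point s (Suc k)) \<le> delta"
      using exact_point_error(1)[OF adm ok[OF k(1)], of 1] mu by simp
    ultimately show ?thesis using k(1) unfolding finds_kkt_def delta_eps_kkt_def by (intro exI[of _ "Suc k"]) auto
  next
    case False
    have "?K = 0"
    proof (rule ccontr)
      assume "?K \<noteq> 0"
      have "(eps / (3 * Lf P))\<^sup>2 \<le> (?step k)\<^sup>2" if "k < ?K" for k
        using False that Lf_pos eps by (intro power_mono) (auto simp: divide_le_eq mult.commute not_le less_imp_le)
      then have "(\<Sum>k<?K. (eps / (3 * Lf P))\<^sup>2) \<le> (\<Sum>k<?K. (?step k)\<^sup>2)" by (intro sum_mono) auto
      then have "Lf P / 2 * (real ?K * (eps / (3 * Lf P))\<^sup>2) \<le> Lf P / 2 * (\<Sum>k<?K. (?step k)\<^sup>2)"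
        using Lf_pos by (intro mult_left_mono) auto
      also have "\<dots> \<le> DeltaF0 P + real ?K * eps\<^sup>2 / (96 * Lf P)" by (rule exact_step_sum[OF adm ok mu])
      also have "\<dots> \<le> real ?K * eps\<^sup>2 / (120 * Lf P) + real ?K * eps\<^sup>2 / (96 * Lf P)"
        using Kbar_bounds(1)[OF eps] Lf_pos by (simp add: field_simps)
      finally have "real ?K * eps\<^sup>2 / Lf P * (1 / 18) \<le> real ?K * eps\<^sup>2 / Lf P * (1 / 120 + 1 / 96)"
        using Lf_pos by (simp add: power2_eq_square field_simps)
      moreover have "real ?K * eps\<^sup>2 / Lf P > 0" using \<open>?K \<noteq> 0\<close> eps Lf_pos by simp
      ultimately show False by simp
    qed
    then have "DeltaF0 P \<le> 0" using Kbar_bounds(1)[OF eps] Lf_pos by (simp add: mult_le_0_iff)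
    then have "Lf P / 2 * (norm (exact_step P (xini P) - xini P))\<^sup>2 \<le> 0"
      using prox_linear_descent[OF \<Omega>0 feasible_xini] F0_real_ge[of "exact_step P (xini P)"] by simp
    then have "exact_step P (xini P) = xini P" using Lf_pos by (simp add: mult_le_0_iff)
    then have "eps_kkt P eps (xini P)" using eps_kkt_exact_step[OF \<Omega>0, of eps] eps by simp
    then show ?thesis unfolding finds_kkt_def delta_eps_kkt_def
      using delta by (intro exI[of _ 0]) (auto intro!: exI[of _ "xini P"])
  qed
qed

text \<open>
  Each step is bounded by a constant of the problem, because \<open>K \<epsilon>\<^sup>2\<close> is; there are \<open>O(1 / \<epsilon>\<^sup>2)\<close> steps.
\<close>

lemma iterates_grow_polynomially:
  obtains R where "R > 0"
    "\<And>eps delta s mu k. admissible P eps delta \<Longrightarrow> (\<And>k. k < Kbar P eps \<Longrightarrow> step1_ok P s mu k) \<Longrightarrow>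
       (\<And>k x. mu k x \<le> mubar P eps delta x) \<Longrightarrow> k \<le> Kbar P eps \<Longrightarrow> norm (xk P s k) \<le> R / eps\<^sup>2"
proof -
  define W where "W = 120 * Lf P * DeltaF0 P + 1"
  define Q where "Q = 2 / Lf P * (DeltaF0 P + W / (96 * Lf P))"
  define M where "M = 1 + Q + 1 / (12 * Lf P)"
  define R where "R = norm (xini P) + W * M + 1"
  have W: "W > 0" and Q: "Q \<ge> 0" using Lf_pos DeltaF0_nonneg by (auto simp: W_def Q_def intro!: add_nonneg_pos)
  then have M: "M \<ge> 0" using Lf_pos by (simp add: M_def)
  have "R > 0" using W M by (simp add: R_def add_nonneg_pos)
  moreover have "norm (xk P s k) \<le> R / eps\<^sup>2"
    if adm: "admissible P eps delta" and ok: "\<And>k. k < Kbar P eps \<Longrightarrow> step1_ok P s mu k"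
      and mu: "\<And>k x. mu k x \<le> mubar P eps delta x" and k: "k \<le> Kbar P eps" for eps delta s mu k
  proof -
    let ?K = "Kbar P eps" and ?step = "\<lambda>k. norm (exact_point s (Suc k) - xk P s k)"
    have eps: "0 < eps" "eps < 1" using adm by (auto simp: admissible_def)
    then have eps2: "0 < eps\<^sup>2" "eps\<^sup>2 \<le> 1" by (auto simp: power_le_one)
    have KW: "real ?K * eps\<^sup>2 \<le> W" using Kbar_bounds(2)[OF eps(1)] eps2 by (simp add: W_def)
    have step: "?step j \<le> 1 + Q" if j: "j < ?K" for j
    proof -
      have "(?step j)\<^sup>2 \<le> (\<Sum>k<?K. (?step k)\<^sup>2)" using j by (intro member_le_sum) auto
      then have "Lf P / 2 * (?step j)\<^sup>2 \<le> Lf P / 2 * (\<Sum>k<?K. (?step k)\<^sup>2)"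
        using Lf_pos by (intro mult_left_mono) auto
      also have "\<dots> \<le> DeltaF0 P + real ?K * eps\<^sup>2 / (96 * Lf P)" by (rule exact_step_sum[OF adm ok mu])
      also have "\<dots> \<le> DeltaF0 P + W / (96 * Lf P)" using KW Lf_pos by (intro add_left_mono divide_right_mono) auto
      finally have "(?step j)\<^sup>2 \<le> Q" using Lf_pos by (simp add: Q_def field_simps)
      moreover have "2 * ?step j \<le> 1 + (?step j)\<^sup>2"
        using zero_le_power2[of "?step j - 1"] by (simp add: power2_eq_square algebra_simps)
      ultimately show ?thesis using Q by linarith
    qed
    have "norm (xk P s k) \<le> norm (xini P) + real k * M" using k
    proof (induction k)
      case (Suc k)
      have "norm (exact_point s (Suc k) - xk P s (Suc k)) \<le> 1 * (eps / (12 * Lf P))"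
        using Suc.prems by (intro exact_point_error(2)[OF adm ok]) (auto simp: mu)
      also have "\<dots> \<le> 1 / (12 * Lf P)" using eps Lf_pos by (simp add: divide_right_mono)
      finally have "norm (exact_point s (Suc k) - xk P s (Suc k)) \<le> 1 / (12 * Lf P)" .
      moreover have "norm (xk P s (Suc k)) \<le> norm (xk P s k) + ?step k
          + norm (exact_point s (Suc k) - xk P s (Suc k))"
      proof -
        have "norm (a + b - c) \<le> norm a + norm b + norm c" for a b c :: "real^'d"
          using norm_triangle_ineq4[of "a + b" c] norm_triangle_ineq[of a b] by linarith
        from this[of "xk P s k" "exact_point s (Suc k) - xk P s k" "exact_point s (Suc k) - xk P s (Suc k)"]
        show ?thesis by simp
      qed
      moreover have "norm (xk P s k) \<le> norm (xini P) + real k * M" using Suc by simp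
      moreover have "?step k \<le> 1 + Q" using step Suc.prems by simp
      ultimately have "norm (xk P s (Suc k)) \<le> norm (xini P) + real k * M + M"
        using M_def by linarith
      then show ?case by (simp add: distrib_right)
    qed simp
    also have "\<dots> \<le> norm (xini P) + real ?K * M" using k M by (intro add_left_mono mult_right_mono) auto
    finally have "norm (xk P s k) * eps\<^sup>2 \<le> (norm (xini P) + real ?K * M) * eps\<^sup>2"
      using eps2 by (intro mult_right_mono) auto
    also have "\<dots> = norm (xini P) * eps\<^sup>2 + (real ?K * eps\<^sup>2) * M" by (simp add: algebra_simps)
    also have "\<dots> \<le> norm (xini P) * 1 + W * M" using KW eps2 M by (intro add_mono mult_left_mono mult_right_mono) auto
    also have "\<dots> \<le> R" by (simp add: R_def)
    finally show ?thesis using eps2 by (simp add: pos_le_divide_eq)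
  qed
  ultimately show ?thesis using that by blast
qed

text \<open>
  With tolerances decaying like \<open>1 / (k + 1)\<^sup>2\<close> the accumulated errors in the descent inequality stay below
  one, for every number of iterations; here \<open>\<epsilon>\<^sup>2 < 3 L\<^sub>f\<close> is used.
\<close>

lemma iterates_bounded_of_compact_level:
  assumes compact: "compact {(x, y). Fsplit P x y \<le> Fsplit P (xini P) (yini P) + 1}"
  obtains R where "R > 0"
    "\<And>eps delta s mu k. admissible P eps delta \<Longrightarrow> (\<And>k. k < Kbar P eps \<Longrightarrow> step1_ok P s mu k) \<Longrightarrow>
       (\<And>k x. mu k x \<le> 1 / (real k + 1)\<^sup>2 * mubar P eps delta x) \<Longrightarrow> k \<le> Kbar P eps \<Longrightarrow>
       norm (exact_point s k) \<le> R \<and> norm (xk P s k) \<le> R"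
proof -
  obtain R0 where R0: "\<And>x y. Fsplit P x y \<le> Fsplit P (xini P) (yini P) + 1 \<Longrightarrow> norm (x, y) \<le> R0"
    using compact_imp_bounded[OF compact] unfolding bounded_iff by blast
  define R where "R = \<bar>R0\<bar> + 1 / (12 * Lf P) + 1"
  have "R > 0" using Lf_pos by (simp add: R_def add_nonneg_pos)
  moreover have "norm (exact_point s k) \<le> R \<and> norm (xk P s k) \<le> R"
    if adm: "admissible P eps delta" and ok: "\<And>k. k < Kbar P eps \<Longrightarrow> step1_ok P s mu k"
      and mu: "\<And>k x. mu k x \<le> 1 / (real k + 1)\<^sup>2 * mubar P eps delta x" and k: "k \<le> Kbar P eps"
    for eps delta s mu k
  proof -
    have eps: "0 < eps" "eps < 1" "eps < sqrt (3 * Lf P)" using adm by (auto simp: admissible_def)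
    have "eps\<^sup>2 \<le> (sqrt (3 * Lf P))\<^sup>2" using eps by (intro power_mono) auto
    then have eps2: "eps\<^sup>2 \<le> 3 * Lf P" using Lf_pos by simp
    have err: "norm (exact_point s (Suc j) - xk P s (Suc j)) \<le> 1 / (real j + 1)\<^sup>2 * (eps / (12 * Lf P))"
      if "j < Kbar P eps" for j
      using exact_point_error(2)[OF adm ok[OF that] mu] by simp
    have weight: "0 \<le> 1 / (real j + 1)\<^sup>2" "1 / (real j + 1)\<^sup>2 \<le> 1" for j
      by auto
    have "(\<Sum>j<n. (norm (exact_point s j - xk P s j))\<^sup>2) \<le> (1 / (48 * Lf P)) * 3" if n: "n \<le> Kbar P eps" for n
    proof (cases n)
      case (Suc n')
      have "(norm (exact_point s (Suc j) - xk P s (Suc j)))\<^sup>2 \<le> 1 / (48 * Lf P) * (1 / (real j + 1)\<^sup>2)"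
        if j: "j < n'" for j
      proof -
        have "(norm (exact_point s (Suc j) - xk P s (Suc j)))\<^sup>2 \<le> (1 / (real j + 1)\<^sup>2 * (eps / (12 * Lf P)))\<^sup>2"
          using err[of j] j n Suc by (intro power_mono) auto
        also have "\<dots> = (1 / (real j + 1)\<^sup>2)\<^sup>2 * (eps\<^sup>2 / (12 * Lf P)\<^sup>2)" by (simp only: power_mult_distrib power_divide)
        also have "\<dots> \<le> (1 / (real j + 1)\<^sup>2) * (3 * Lf P / (12 * Lf P)\<^sup>2)"
        proof (intro mult_mono divide_right_mono eps2)
          have "(1 / (real j + 1)\<^sup>2) * (1 / (real j + 1)\<^sup>2) \<le> (1 / (real j + 1)\<^sup>2) * 1"
            by (intro mult_left_mono weight)
          then show "(1 / (real j + 1)\<^sup>2)\<^sup>2 \<le> 1 / (real j + 1)\<^sup>2"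
            by (simp only: power2_eq_square[of "1 / (real j + 1)\<^sup>2"] mult_1_right)
        qed (use weight in auto)
        also have "\<dots> = 1 / (48 * Lf P) * (1 / (real j + 1)\<^sup>2)" using Lf_pos by (simp add: power2_eq_square)
        finally show ?thesis .
      qed
      then have "(\<Sum>j<n'. (norm (exact_point s (Suc j) - xk P s (Suc j)))\<^sup>2)
          \<le> (\<Sum>j<n'. 1 / (48 * Lf P) * (1 / (real j + 1)\<^sup>2))" by (intro sum_mono) auto
      also have "\<dots> = 1 / (48 * Lf P) * (\<Sum>j<n'. 1 / (real j + 1)\<^sup>2)" by (simp only: sum_distrib_left)
      also have "\<dots> \<le> 1 / (48 * Lf P) * 3" using Lf_pos by (intro mult_left_mono sum_inverse_squares_le) auto
      finally show ?thesis unfolding Suc sum.lessThan_Suc_shift by simp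
    qed (use Lf_pos in simp)
    then have "3 * Lf P / 2 * (\<Sum>j<k. (norm (exact_point s j - xk P s j))\<^sup>2) \<le> 3 * Lf P / 2 * ((1 / (48 * Lf P)) * 3)"
      using k Lf_pos by (intro mult_left_mono) auto
    also have "\<dots> \<le> 1" using Lf_pos by simp
    finally have small: "3 * Lf P / 2 * (\<Sum>j<k. (norm (exact_point s j - xk P s j))\<^sup>2) \<le> 1" .
    have desc: "feasible (exact_point s k)"
      "F0_real (exact_point s k) + Lf P / 2 * (\<Sum>j<k. (norm (exact_point s (Suc j) - xk P s j))\<^sup>2)
        \<le> F0_real (xini P) + 3 * Lf P / 2 * (\<Sum>j<k. (norm (exact_point s j - xk P s j))\<^sup>2)"
      using telescoped_descent[of k s] inexact_step_error(1)[OF ok] k by auto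
    moreover have "0 \<le> Lf P / 2 * (\<Sum>j<k. (norm (exact_point s (Suc j) - xk P s j))\<^sup>2)"
      using Lf_pos by (intro mult_nonneg_nonneg sum_nonneg) auto
    ultimately have "F0_real (exact_point s k) \<le> F0_real (xini P) + 1" using small by linarith
    then have "F0 P (exact_point s k) \<le> F0 P (xini P) + 1"
      by (simp add: F0_eq[OF desc(1)] F0_eq[OF feasible_xini] one_ereal_def)
    moreover have "yini P = matAbar P *v xini P + vecbbar P" using inp by (simp add: algorithm_inputs_def)
    ultimately have "norm (exact_point s k, matAbar P *v exact_point s k + vecbbar P) \<le> R0"
      by (intro R0) (simp add: Fsplit_def F0_def)
    then have u: "norm (exact_point s k) \<le> \<bar>R0\<bar>"
      using norm_fst_le[of "exact_point s k" "matAbar P *v exact_point s k + vecbbar P"] by linarith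
    have e: "norm (exact_point s k - xk P s k) \<le> 1 / (12 * Lf P)"
    proof (cases k)
      case (Suc j)
      have "norm (exact_point s (Suc j) - xk P s (Suc j)) \<le> 1 * (eps / (12 * Lf P))"
        using err[of j] weight[of j] k Suc eps Lf_pos
        by (intro order_trans[OF err] mult_right_mono) auto
      also have "\<dots> \<le> 1 / (12 * Lf P)" using eps Lf_pos by (simp add: divide_right_mono)
      finally show ?thesis using Suc by simp
    qed (use Lf_pos in simp)
    have "norm (xk P s k) \<le> norm (exact_point s k) + norm (exact_point s k - xk P s k)"
      by (metis norm_triangle_sub add.commute norm_minus_commute)
    then have "norm (xk P s k) \<le> R" using u e by (simp add: R_def)
    moreover have "1 / (12 * Lf P) \<ge> 0" using Lf_pos by simp
    then have "norm (exact_point s k) \<le> R" using u unfolding R_def by linarith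
    ultimately show ?thesis by blast
  qed
  ultimately show ?thesis using that by blast
qed

end

section \<open>Number of inner iterations\<close>

lemma ceiling_nat_le:
  assumes "1 \<le> S" "x \<le> 2 * sqrt 2 * S"
  shows "real (nat \<lceil>x\<rceil>) \<le> 4 * S"
proof -
  have "sqrt 2 \<le> 3 / 2" by (rule real_le_lsqrt) (auto simp: power2_eq_square)
  then have "2 * sqrt 2 * S \<le> 3 * S" using assms(1) by simp
  moreover have "real (nat \<lceil>x\<rceil>) \<le> max 0 (x + 1)" by linarith
  ultimately show ?thesis using assms by linarith
qed

lemma restarts_le_log:
  assumes "0 \<le> 2 * gap P x / (r * \<mu>\<^sup>2)" "2 * gap P x / (r * \<mu>\<^sup>2) \<le> Y" "1 \<le> Y"
  shows "real (restarts P r \<mu> x) \<le> log 2 Y + 1"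
proof -
  let ?X = "2 * gap P x / (r * \<mu>\<^sup>2)"
  have "log 2 ?X \<le> log 2 Y"
  proof (cases "?X = 0")
    case True
    show ?thesis unfolding True using assms(3) by (simp add: log_def)
  next
    case False
    then have "0 < ?X" using assms(1) by (metis order_less_le)
    then show ?thesis by (rule log_mono[OF _ _ assms(2), rotated]) simp
  qed
  moreover have "0 \<le> log 2 Y" using assms(3) by simp
  ultimately show ?thesis unfolding restarts_def by linarith
qed

context pg_problem begin

lemma norm_gradf_le: "norm (gradf P x) \<le> (norm (gradf P 0) + Lf P) * (1 + norm x)"
proof -
  have "norm (gradf P x) \<le> norm (gradf P 0) + norm (gradf P x - gradf P 0)" by (rule norm_triangle_sub)
  also have "\<dots> \<le> norm (gradf P 0) + Lf P * norm x"
    using lipschitz_onD[OF gradf(2), of x 0] by (simp add: dist_norm)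
  also have "\<dots> \<le> (norm (gradf P 0) + Lf P) * (1 + norm x)"
    using Lf_pos by (simp add: algebra_simps)
  finally show ?thesis .
qed

text \<open>
  The initial dual value is quadratic in \<open>x\<close>. The dual minimum is bounded below by weak duality against
  the feasible initial point: the Fenchel-Young inequality at its image reduces the dual function to a
  quadratic in the residual.
\<close>

lemma gap_le_quadratic:
  obtains G where "G > 0" "\<And>x. Omega P x \<noteq> {} \<Longrightarrow> gap P x \<le> G * (1 + norm x)\<^sup>2"
proof -
  define c0 where "c0 = norm (gradf P 0) + Lf P + tau P"
  define n where "n = norm (xini P)"
  define g0 where "g0 = real_of_ereal (gfun P (matAbar P *v xini P + vecbbar P))"
  define e0 where "e0 = \<bar>conj_real (gfun P) (fst (zini P))\<bar> + \<bar>zini P \<bullet> (vecbbar P, vecb P)\<bar>"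
  define h0 where "h0 = 1 / (2 * tau P) * (norm (stack_adj P (zini P)) + c0)\<^sup>2"
  define k0 where "k0 = tau P * n\<^sup>2 / 2 + \<bar>g0\<bar>"
  define G where "G = e0 + h0 + k0 + c0 * n + 1"
  have pos: "c0 \<ge> 0" "n \<ge> 0" "e0 \<ge> 0" "h0 \<ge> 0" "k0 \<ge> 0"
    using Lf_pos tau_pos unfolding c0_def n_def e0_def h0_def k0_def
    by (auto intro!: add_nonneg_nonneg simp del: abs_real_of_ereal)
  have "G > 0" using pos by (simp add: G_def add_nonneg_pos)
  moreover have "gap P x \<le> G * (1 + norm x)\<^sup>2" if ne: "Omega P x \<noteq> {}" for x
  proof -
    obtain z where z: "z \<in> Omega P x" using ne by blast
    define t where "t = 1 + norm x"
    define c where "c = gradf P x - tau P *\<^sub>R x"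
    have "t \<ge> 1" by (simp add: t_def)
    then have t: "t \<ge> 1" "t \<le> t\<^sup>2" by (auto simp: self_le_power)
    have c: "norm c \<le> c0 * t"
    proof -
      have "norm c \<le> norm (gradf P x) + tau P * norm x"
        unfolding c_def using norm_triangle_ineq4[of "gradf P x" "tau P *\<^sub>R x"] tau_pos by simp
      also have "\<dots> \<le> (norm (gradf P 0) + Lf P) * t + tau P * t"
        unfolding t_def using tau_pos by (intro add_mono norm_gradf_le mult_left_mono) auto
      finally show ?thesis by (simp add: c0_def algebra_simps)
    qed
    have "norm (dres P x (zini P)) \<le> (norm (stack_adj P (zini P)) + c0) * t"
    proof -
      have "norm (dres P x (zini P)) \<le> norm (stack_adj P (zini P)) + norm c"
        unfolding dres_stack_adj c_def using norm_triangle_ineq by (metis add_diff_eq)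
      also have "\<dots> \<le> norm (stack_adj P (zini P)) * t + c0 * t"
        using c t by (intro add_mono) (auto simp: mult_le_cancel_left1)
      finally show ?thesis by (simp add: algebra_simps)
    qed
    then have "(norm (dres P x (zini P)))\<^sup>2 \<le> ((norm (stack_adj P (zini P)) + c0) * t)\<^sup>2" by (intro power_mono) auto
    then have "1 / (2 * tau P) * (norm (dres P x (zini P)))\<^sup>2 \<le> 1 / (2 * tau P) * ((norm (stack_adj P (zini P)) + c0) * t)\<^sup>2"
      using tau_pos by (intro mult_left_mono) auto
    then have up1: "1 / (2 * tau P) * (norm (dres P x (zini P)))\<^sup>2 \<le> h0 * t\<^sup>2"
      by (simp add: h0_def power_mult_distrib)
    have up: "dual_val P x (zini P) \<le> e0 + h0 * t\<^sup>2"
      using up1 unfolding dual_val_def dual_quad_def e0_def by linarith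
    let ?r = "dres P x z"
    have zd: "fst z \<in> edom (conjugate (gfun P))" using z by (simp add: Omega_iff dual_dom_def)
    have y0: "matAbar P *v xini P + vecbbar P \<in> edom (gfun P)" and Ax: "vecb P = - (matA P *v xini P)"
      using feasible_xini by (auto simp: feasible_def eq_neg_iff_add_eq_0 add.commute)
    have "stack_adj P z \<bullet> xini P - g0 \<le> conj_real (gfun P) (fst z) - z \<bullet> (vecbbar P, vecb P)"
      using fenchel_young[OF gfun(1) zd y0] by (simp add: g0_def inner_stack_adj inner_prod_def Ax inner_add_right)
    moreover have "stack_adj P z \<bullet> xini P = ?r \<bullet> xini P - c \<bullet> xini P"
      by (simp add: dres_stack_adj c_def inner_add_left inner_diff_left)
    moreover have "\<bar>?r \<bullet> xini P\<bar> \<le> norm ?r * n" unfolding n_def by (rule Cauchy_Schwarz_ineq2)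
    moreover have "\<bar>c \<bullet> xini P\<bar> \<le> c0 * t * n"
      using Cauchy_Schwarz_ineq2[of c "xini P"] c pos(2) unfolding n_def
      by (meson mult_right_mono norm_ge_zero order_trans)
    moreover have "norm ?r * n \<le> 1 / (2 * tau P) * (norm ?r)\<^sup>2 + tau P * n\<^sup>2 / 2"
    proof -
      have "0 \<le> 1 / (2 * tau P) * (norm ?r - tau P * n)\<^sup>2" using tau_pos by simp
      also have "\<dots> = 1 / (2 * tau P) * (norm ?r)\<^sup>2 + tau P * n\<^sup>2 / 2 - norm ?r * n"
        using tau_pos by (simp add: power2_eq_square field_simps)
      finally show ?thesis by simp
    qed
    ultimately have lo: "- dual_val P x z \<le> k0 + c0 * n * t"
      by (simp add: dual_val_def dual_quad_def k0_def algebra_simps)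
    have "gap P x \<le> (e0 + h0 * t\<^sup>2) + (k0 + c0 * n * t)"
      using up lo by (simp add: gap_eq(1)[OF z])
    also have "\<dots> \<le> (e0 * t\<^sup>2 + h0 * t\<^sup>2) + (k0 * t\<^sup>2 + c0 * n * t\<^sup>2)"
      using t pos by (intro add_mono mult_left_mono) (auto simp: mult_le_cancel_left1 intro: order_trans[of 1 t])
    also have "\<dots> \<le> G * t\<^sup>2" by (simp add: G_def algebra_simps)
    finally show ?thesis by (simp add: t_def)
  qed
  ultimately show ?thesis using that by blast
qed

text \<open>
  For bounded \<open>\<delta>\<close> each of the seven terms is at least a positive constant times \<open>\<delta> \<epsilon>\<^sup>2 / (1 + |x|)\<close>: only the term
  with \<open>B\<^sub>3\<close> and \<open>B\<^sub>4\<close> depends on the iterate, and these grow linearly with it.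
\<close>

lemma mubar_ge:
  assumes dmax: "dmax > 0"
  obtains m where "m > 0" "\<And>eps delta x. admissible P eps delta \<Longrightarrow> delta \<le> dmax \<Longrightarrow>
     m * (delta * eps\<^sup>2 / (1 + norm x)) \<le> mubar P eps delta x"
proof -
  let ?B = "specnorm (matB P)" and ?Ab = "specnorm (matAbar P)"
  define q3 where "q3 = pinv_norm P * ((norm (gradf P 0) + Lf P) + ?Ab * lg P)"
  define q4 where "q4 = 1 / tau P * ((norm (gradf P 0) + Lf P) + ?B * (lg P + q3))"
  define q where "q = q3 + sigma P * ?Ab * q4 + lg P"
  define c7 where "c7 = 1 / (12 * Lf P * B1 P * B2 P * (1 + 1 / tau P * sigma P * ?Ab * ?B))"
  note pos = Lf_pos lg_pos sigma_pos tau_pos specnorm_B_pos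
  have Ab: "?Ab \<ge> 0" "specnorm (matA P) \<ge> 0" and pin: "pinv_norm P \<ge> 0"
    by (simp_all add: specnorm_nonneg pinv_norm_def)
  have B1: "B1 P > 0" unfolding B1_def using pos Ab
    by (intro add_pos_nonneg add_nonneg_pos mult_nonneg_nonneg) auto
  have B2: "B2 P > 0" unfolding B2_def using pos pin by (simp add: add_pos_nonneg)
  have q3: "q3 \<ge> 0" using pos Ab pin by (simp add: q3_def)
  have q4: "q4 \<ge> 0" using pos q3 by (simp add: q4_def)
  have q: "q > 0" using pos q3 q4 Ab by (simp add: q_def add_nonneg_pos)
  have "1 + 1 / tau P * sigma P * ?Ab * ?B > 0" using pos Ab by (simp add: add_pos_nonneg)
  then have c7: "c7 > 0" using pos B1 B2 by (simp add: c7_def)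
  let ?M = "{1 / (480 * B1 P * lg P * Lf P) / dmax, tau P / ?B, 1 / (6 * ?B) / dmax,
    1 / (B1 P * sigma P) / dmax, 1 / B1 P / dmax, 1 / (12 * Lf P * B1 P * q) / dmax, sqrt c7 / dmax}"
  define m where "m = Min ?M"
  have "m > 0" unfolding m_def using pos B1 q c7 dmax by simp
  have m: "m \<le> a" if "a \<in> ?M" for a unfolding m_def using that by (intro Min_le) auto
  have "m * (delta * eps\<^sup>2 / (1 + norm x)) \<le> mubar P eps delta x"
    if adm: "admissible P eps delta" and d: "delta \<le> dmax" for eps delta x
  proof -
    let ?E = "delta * eps\<^sup>2 / (1 + norm x)"
    have eps: "0 < eps" "eps < 1" and delta: "0 < delta" using adm by (auto simp: admissible_def)
    have t: "1 + norm x \<ge> 1" by simp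
    have e1: "eps\<^sup>2 \<le> eps" "eps\<^sup>2 \<le> 1" using eps by (auto simp: power2_eq_square mult_le_one)
    have E0: "?E \<ge> 0" using delta by simp
    have tpos: "0 < 1 + norm x" by (rule add_pos_nonneg) auto
    have "?E \<le> delta * eps\<^sup>2 / 1" using delta by (intro divide_left_mono) (auto simp: tpos)
    moreover have "delta * eps\<^sup>2 \<le> delta * 1" using delta e1 by (intro mult_left_mono) auto
    moreover have "delta * eps\<^sup>2 \<le> dmax * eps\<^sup>2" using d by (intro mult_right_mono) auto
    moreover have "dmax * eps\<^sup>2 \<le> dmax * eps" using dmax e1 by (intro mult_left_mono) auto
    ultimately have E: "?E \<le> delta" "?E \<le> dmax * eps\<^sup>2" "?E \<le> dmax * eps" by simp_all
    have small: "m * ?E \<le> c * e" if c: "c / dmax \<in> ?M" "c \<ge> 0" and e: "?E \<le> dmax * e" for c e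
    proof -
      have "m * ?E \<le> (c / dmax) * (dmax * e)"
        using m[OF c(1)] e E0 c(2) dmax by (intro mult_mono) auto
      then show ?thesis using dmax by simp
    qed
    have le_t: "a \<ge> 0 \<Longrightarrow> a \<le> a * (1 + norm x)" for a by (simp add: distrib_left)
    have B3: "B3 P x \<le> q3 * (1 + norm x)" "B3 P x \<ge> 0"
    proof -
      have "norm (gradf P x) + ?Ab * lg P \<le> (norm (gradf P 0) + Lf P) * (1 + norm x) + ?Ab * lg P * (1 + norm x)"
        using Ab pos by (intro add_mono norm_gradf_le le_t) auto
      then show "B3 P x \<le> q3 * (1 + norm x)"
        unfolding B3_def q3_def mult.assoc using pin by (intro mult_left_mono) (auto simp: algebra_simps)
      show "B3 P x \<ge> 0" unfolding B3_def using pin Ab pos by simp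
    qed
    have B4: "B4 P x \<le> q4 * (1 + norm x)" "B4 P x \<ge> 0"
    proof -
      have "lg P + B3 P x \<le> lg P * (1 + norm x) + q3 * (1 + norm x)"
        using B3 pos by (intro add_mono le_t) auto
      then have "?B * (lg P + B3 P x) \<le> ?B * ((lg P + q3) * (1 + norm x))"
        using pos by (intro mult_left_mono) (auto simp: algebra_simps)
      then have "norm (gradf P x) + ?B * (lg P + B3 P x)
          \<le> (norm (gradf P 0) + Lf P) * (1 + norm x) + ?B * ((lg P + q3) * (1 + norm x))"
        using norm_gradf_le by (intro add_mono) auto
      then show "B4 P x \<le> q4 * (1 + norm x)"
        unfolding B4_def q4_def mult.assoc using pos by (intro mult_left_mono) (auto simp: algebra_simps)
      show "B4 P x \<ge> 0" unfolding B4_def using B3(2) pos by simp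
    qed
    define Q where "Q = B3 P x + sigma P * ?Ab * B4 P x + lg P"
    have Q: "Q > 0" "Q \<le> q * (1 + norm x)"
    proof -
      show "Q > 0" using B3 B4 pos Ab by (simp add: Q_def add_nonneg_pos)
      have "sigma P * ?Ab * B4 P x \<le> sigma P * ?Ab * (q4 * (1 + norm x))"
        using B4 pos Ab by (intro mult_left_mono) auto
      moreover have "lg P \<le> lg P * (1 + norm x)" using pos by (intro le_t) auto
      ultimately have "Q \<le> q3 * (1 + norm x) + sigma P * ?Ab * (q4 * (1 + norm x)) + lg P * (1 + norm x)"
        unfolding Q_def using B3 by linarith
      then show "Q \<le> q * (1 + norm x)" by (simp add: q_def algebra_simps)
    qed
    have a1: "m * ?E \<le> eps\<^sup>2 / (480 * B1 P * lg P * Lf P)"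
      using small[of "1 / (480 * B1 P * lg P * Lf P)" "eps\<^sup>2"] E pos B1 by simp
    have a2: "m * ?E \<le> tau P * delta / ?B"
    proof -
      have "m * ?E \<le> tau P / ?B * delta" using m[of "tau P / ?B"] E E0 pos by (intro mult_mono) auto
      then show ?thesis by simp
    qed
    have a3: "m * ?E \<le> eps / (6 * ?B)" using small[of "1 / (6 * ?B)" eps] E pos by simp
    have a4: "m * ?E \<le> eps / (B1 P * sigma P)" using small[of "1 / (B1 P * sigma P)" eps] E pos B1 by simp
    have a5: "m * ?E \<le> eps / B1 P" using small[of "1 / B1 P" eps] E B1 by simp
    have a6: "m * ?E \<le> eps\<^sup>2 / (12 * Lf P * B1 P * Q)"
    proof -
      have "m * ?E \<le> (1 / (12 * Lf P * B1 P * q) / dmax) * (dmax * (eps\<^sup>2 / (1 + norm x)))"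
      proof (rule mult_mono)
        show "?E \<le> dmax * (eps\<^sup>2 / (1 + norm x))"
          using d by (simp add: divide_right_mono mult_right_mono)
      qed (use m E0 pos B1 q dmax in auto)
      also have "\<dots> = eps\<^sup>2 / (12 * Lf P * B1 P * (q * (1 + norm x)))" using dmax by simp
      also have "\<dots> \<le> eps\<^sup>2 / (12 * Lf P * B1 P * Q)"
        using Q pos B1 q tpos by (intro divide_left_mono mult_left_mono mult_pos_pos) (auto simp: tpos)
      finally show ?thesis .
    qed
    have a7: "m * ?E \<le> sqrt (eps\<^sup>2 / (12 * Lf P * B1 P * B2 P * (1 + 1 / tau P * sigma P * ?Ab * ?B)))"
    proof -
      have "m * ?E \<le> sqrt c7 * eps" using small[of "sqrt c7" eps] E c7 by simp
      also have "\<dots> = sqrt (eps\<^sup>2 * c7)" using eps by (simp add: real_sqrt_mult)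
      also have "eps\<^sup>2 * c7 = eps\<^sup>2 / (12 * Lf P * B1 P * B2 P * (1 + 1 / tau P * sigma P * ?Ab * ?B))"
        by (simp only: c7_def times_divide_eq_right mult_1_right)
      finally show ?thesis .
    qed
    show ?thesis unfolding mubar_def Q_def[symmetric] using a1 a2 a3 a4 a5 a6 a7
      by (subst Min_ge_iff) (simp_all only: finite_insert finite.emptyI insert_not_empty ball_simps simp_thms)
  qed
  with \<open>m > 0\<close> show ?thesis using that by blast
qed

lemma mubar_pos: "admissible P eps delta \<Longrightarrow> mubar P eps delta x > 0"
proof -
  assume adm: "admissible P eps delta"
  then have pos: "delta > 0" "eps > 0" by (auto simp: admissible_def)
  obtain m where m: "m > 0" "\<And>eps delta' x. admissible P eps delta' \<Longrightarrow> delta' \<le> delta \<Longrightarrow>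
     m * (delta' * eps\<^sup>2 / (1 + norm x)) \<le> mubar P eps delta' x"
    using mubar_ge[OF pos(1)] by blast
  have "0 < m * (delta * eps\<^sup>2 / (1 + norm x))"
    using m(1) pos by (intro mult_pos_pos divide_pos_pos) (auto simp: add_pos_nonneg)
  then show ?thesis using m(2)[OF adm order_refl, of x] by linarith
qed

text \<open>
  The exponent counts powers of \<open>1 / \<epsilon>\<close>: the iterate contributes 2, hence the gap 4; the tolerance is at least
  of order \<open>\<delta> \<epsilon>\<^sup>8\<close> (2 from the tolerance itself, 2 from the iterate, 4 from \<open>(k + 1)\<^sup>2\<close>) and is squared. In
  total \<open>\<delta>\<^sup>-\<^sup>2 \<epsilon>\<^sup>-\<^sup>2\<^sup>0\<close>, and bounded \<open>\<delta>\<close> may be raised to the same power.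
\<close>

lemma uniform_restarts_bound:
  assumes dmax: "dmax > 0" and r0: "r0 > 0"
  obtains c where "c \<ge> 1"
    "\<And>eps delta s mu k r. admissible P eps delta \<Longrightarrow> delta \<le> dmax \<Longrightarrow>
       (\<And>k. k < Kbar P eps \<Longrightarrow> step1_ok P s mu k) \<Longrightarrow>
       (\<And>k x. mu k x \<le> mubar P eps delta x) \<Longrightarrow>
       (\<And>k x. 1 / (real k + 1)\<^sup>2 * mubar P eps delta x \<le> mu k x) \<Longrightarrow>
       k < Kbar P eps \<Longrightarrow> r0 \<le> r \<Longrightarrow>
       real (restarts P r (mu k (xk P s k)) (xk P s k)) \<le> log 2 (c * (1 / (delta * eps)) ^ 20) + 1"
proof -
  obtain R where R: "R > 0"
    "\<And>eps delta s mu k. admissible P eps delta \<Longrightarrow> (\<And>k. k < Kbar P eps \<Longrightarrow> step1_ok P s mu k) \<Longrightarrow>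
       (\<And>k x. mu k x \<le> mubar P eps delta x) \<Longrightarrow> k \<le> Kbar P eps \<Longrightarrow> norm (xk P s k) \<le> R / eps\<^sup>2"
    using iterates_grow_polynomially by blast
  obtain G where G: "G > 0" "\<And>x. Omega P x \<noteq> {} \<Longrightarrow> gap P x \<le> G * (1 + norm x)\<^sup>2"
    using gap_le_quadratic by blast
  obtain m where m: "m > 0" "\<And>eps delta x. admissible P eps delta \<Longrightarrow> delta \<le> dmax \<Longrightarrow>
     m * (delta * eps\<^sup>2 / (1 + norm x)) \<le> mubar P eps delta x"
    using mubar_ge[OF dmax] by blast
  define W where "W = 120 * Lf P * DeltaF0 P + 1"
  have W: "W > 0" using Lf_pos DeltaF0_nonneg by (auto simp: W_def intro!: add_nonneg_pos)
  define m' where "m' = m / ((1 + R) * W\<^sup>2)"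
  have m': "m' > 0" using m(1) R(1) W by (simp add: m'_def)
  define c0 where "c0 = 2 * G * (1 + R)\<^sup>2 / (r0 * m'\<^sup>2)"
  have c0: "c0 > 0" using G(1) R(1) r0 m' by (simp add: c0_def)
  define c where "c = max 1 (max (c0 * dmax ^ 18) (dmax ^ 20))"
  have c: "c \<ge> 1" "c0 * dmax ^ 18 \<le> c" "dmax ^ 20 \<le> c" by (auto simp: c_def)
  have "real (restarts P r (mu k (xk P s k)) (xk P s k)) \<le> log 2 (c * (1 / (delta * eps)) ^ 20) + 1"
    if adm: "admissible P eps delta" and d: "delta \<le> dmax"
      and ok: "\<And>k. k < Kbar P eps \<Longrightarrow> step1_ok P s mu k"
      and mu: "\<And>k x. mu k x \<le> mubar P eps delta x"
      and mu_ge: "\<And>k x. 1 / (real k + 1)\<^sup>2 * mubar P eps delta x \<le> mu k x"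
      and k: "k < Kbar P eps" and r: "r0 \<le> r" for eps delta s mu k r
  proof (rule restarts_le_log)
    let ?x = "xk P s k"
    have eps: "0 < eps" "eps < 1" and delta: "0 < delta" using adm by (auto simp: admissible_def)
    then have eps2: "0 < eps\<^sup>2" "eps\<^sup>2 \<le> 1" by (auto simp: power_le_one)
    have ne: "Omega P ?x \<noteq> {}" using inexact_step_error(1)[OF ok[OF k]] .
    have g0: "gap P ?x \<ge> 0" using ne gap_eq(2) by blast
    have x: "1 + norm ?x \<le> (1 + R) / eps\<^sup>2"
    proof -
      have "norm ?x \<le> R / eps\<^sup>2" using R(2)[OF adm ok mu] k by simp
      moreover have "1 \<le> 1 / eps\<^sup>2" using eps2 by simp
      ultimately show ?thesis by (simp add: add_divide_distrib)
    qed
    have gap: "gap P ?x \<le> G * (1 + R)\<^sup>2 / eps ^ 4"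
    proof -
      have "(1 + norm ?x)\<^sup>2 \<le> ((1 + R) / eps\<^sup>2)\<^sup>2" using x by (intro power_mono) auto
      then have "G * (1 + norm ?x)\<^sup>2 \<le> G * ((1 + R) / eps\<^sup>2)\<^sup>2" using G(1) by (intro mult_left_mono) auto
      then show ?thesis using G(2)[OF ne] by (simp add: power_divide flip: power_mult)
    qed
    have mu_low: "m' * delta * eps ^ 8 \<le> mu k ?x"
    proof -
      have "(real k + 1) * eps\<^sup>2 \<le> real (Kbar P eps) * eps\<^sup>2" using k eps2 by (intro mult_right_mono) auto
      also have "\<dots> \<le> W" using Kbar_bounds(2)[OF eps(1)] eps2 by (simp add: W_def)
      finally have "real k + 1 \<le> W / eps\<^sup>2" using eps2 by (simp add: pos_le_divide_eq)
      then have "(real k + 1)\<^sup>2 \<le> (W / eps\<^sup>2)\<^sup>2" by (intro power_mono) auto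
      then have "1 / (W / eps\<^sup>2)\<^sup>2 \<le> 1 / (real k + 1)\<^sup>2"
        using W eps by (intro divide_left_mono mult_pos_pos zero_less_power divide_pos_pos) auto
      moreover have "m * (delta * eps\<^sup>2 / ((1 + R) / eps\<^sup>2)) \<le> mubar P eps delta ?x"
      proof -
        have "delta * eps\<^sup>2 / ((1 + R) / eps\<^sup>2) \<le> delta * eps\<^sup>2 / (1 + norm ?x)"
          using x delta eps2 R(1) by (intro divide_left_mono mult_pos_pos divide_pos_pos) (auto simp: add_pos_nonneg)
        then have "m * (delta * eps\<^sup>2 / ((1 + R) / eps\<^sup>2)) \<le> m * (delta * eps\<^sup>2 / (1 + norm ?x))"
          using m(1) by (intro mult_left_mono) auto
        then show ?thesis using m(2)[OF adm d, of ?x] by linarith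
      qed
      ultimately have "1 / (W / eps\<^sup>2)\<^sup>2 * (m * (delta * eps\<^sup>2 / ((1 + R) / eps\<^sup>2)))
          \<le> 1 / (real k + 1)\<^sup>2 * mubar P eps delta ?x"
        using m(1) delta R(1) by (intro mult_mono) auto
      also have "\<dots> \<le> mu k ?x" by (rule mu_ge)
      also have "1 / (W / eps\<^sup>2)\<^sup>2 * (m * (delta * eps\<^sup>2 / ((1 + R) / eps\<^sup>2))) = m' * delta * eps ^ 8"
        using W R(1) eps by (simp add: m'_def field_simps power2_eq_square power_numeral_reduce)
      finally show ?thesis .
    qed
    have low0: "0 < m' * delta * eps ^ 8" using m' delta eps by simp
    have rpos: "r > 0" using r r0 by simp
    have mupos: "mu k ?x > 0" using low0 mu_low by linarith
    show "0 \<le> 2 * gap P ?x / (r * (mu k ?x)\<^sup>2)" using g0 rpos by simp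
    have "2 * gap P ?x / (r * (mu k ?x)\<^sup>2) \<le> 2 * (G * (1 + R)\<^sup>2 / eps ^ 4) / (r0 * (m' * delta * eps ^ 8)\<^sup>2)"
    proof (rule frac_le)
      have "(m' * delta * eps ^ 8)\<^sup>2 \<le> (mu k ?x)\<^sup>2" using mu_low low0 by (intro power_mono) auto
      then show "r0 * (m' * delta * eps ^ 8)\<^sup>2 \<le> r * (mu k ?x)\<^sup>2" using r r0 by (intro mult_mono) auto
      show "0 < r0 * (m' * delta * eps ^ 8)\<^sup>2" by (rule mult_pos_pos[OF r0 zero_less_power[OF low0]])
    qed (use gap g0 G(1) in auto)
    also have "\<dots> = c0 * (1 / delta)\<^sup>2 * (1 / eps) ^ 20"
      using eps delta m' r0 by (simp add: c0_def field_simps power2_eq_square power_numeral_reduce)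
    also have "\<dots> \<le> c0 * (dmax ^ 18 * (1 / delta) ^ 20) * (1 / eps) ^ 20"
    proof -
      have "(1 / delta)\<^sup>2 = delta ^ 18 * (1 / delta) ^ 20"
        using delta by (simp add: field_simps power_numeral_reduce)
      also have "\<dots> \<le> dmax ^ 18 * (1 / delta) ^ 20"
        using delta d by (intro mult_right_mono power_mono) auto
      finally show ?thesis using c0 eps by (intro mult_right_mono mult_left_mono) auto
    qed
    also have "\<dots> = (c0 * dmax ^ 18) * (1 / (delta * eps)) ^ 20"
      by (simp add: power_divide power_mult_distrib)
    also have "\<dots> \<le> c * (1 / (delta * eps)) ^ 20"
      using c(2) delta eps by (intro mult_right_mono) auto
    finally show "2 * gap P ?x / (r * (mu k ?x)\<^sup>2) \<le> c * (1 / (delta * eps)) ^ 20" .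
    have "delta * eps \<le> dmax * 1" using d eps delta dmax by (intro mult_mono) auto
    then have "(delta * eps) ^ 20 \<le> c"
      using c(3) delta eps by (intro order_trans[OF power_mono[of "delta * eps" dmax 20]]) auto
    then show "1 \<le> c * (1 / (delta * eps)) ^ 20"
      using delta eps by (simp add: power_divide)
  qed
  with c(1) show ?thesis using that by blast
qed

text \<open>
  The constant is \<open>121 * 31 * 4\<close>: outer iterations (120 plus rounding), restarts (\<open>20 / ln 2 \<le> 30\<close>, plus one for the
  additive constants that small \<open>\<epsilon>\<close> absorbs) and cycle length. The predicate \<open>good\<close> selects the runs that are
  counted.
\<close>

lemma inner_total_bigO:
  fixes s :: "real \<Rightarrow> real \<Rightarrow> 'd schedule" and mu :: "real \<Rightarrow> real \<Rightarrow> 'd tolerance"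
  assumes S: "S \<ge> 1" and B: "B \<ge> 1" and r0: "r0 > 0"
    and ok: "\<And>eps delta k. admissible P eps delta \<Longrightarrow> good eps delta \<Longrightarrow> k < Kbar P eps \<Longrightarrow>
        step1_ok P (s eps delta) (mu eps delta) k"
    and mu: "\<And>eps delta k x. admissible P eps delta \<Longrightarrow> mu eps delta k x \<le> mubar P eps delta x"
      "\<And>eps delta k x. admissible P eps delta \<Longrightarrow> 1 / (real k + 1)\<^sup>2 * mubar P eps delta x \<le> mu eps delta k x"
    and r: "\<And>eps delta k. admissible P eps delta \<Longrightarrow> good eps delta \<Longrightarrow> k < Kbar P eps \<Longrightarrow>
        r0 \<le> r (xk P (s eps delta) k)"
    and restarts: "\<And>eps delta k x. fst (s eps delta k x) = restarts P (r x) (mu eps delta k x) x"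
    and cycle: "\<And>eps delta k. admissible P eps delta \<Longrightarrow> good eps delta \<Longrightarrow> k < Kbar P eps \<Longrightarrow>
        real (snd (s eps delta k (xk P (s eps delta) k))) \<le> 4 * S"
  shows "bigO_eps 15004 (\<lambda>eps delta. real (if good eps delta then inner_total P (s eps delta) (Kbar P eps) else 0))
     (\<lambda>eps delta. S * ln (B / (delta * eps)) * (Lf P * DeltaF0 P / eps\<^sup>2))"
  unfolding bigO_eps_def
proof (intro allI impI)
  fix dmax :: real assume dmax: "dmax > 0"
  obtain c where c: "c \<ge> 1"
    "\<And>eps delta s mu k r. admissible P eps delta \<Longrightarrow> delta \<le> dmax \<Longrightarrow>
       (\<And>k. k < Kbar P eps \<Longrightarrow> step1_ok P s mu k) \<Longrightarrow>
       (\<And>k x. mu k x \<le> mubar P eps delta x) \<Longrightarrow>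
       (\<And>k x. 1 / (real k + 1)\<^sup>2 * mubar P eps delta x \<le> mu k x) \<Longrightarrow>
       k < Kbar P eps \<Longrightarrow> r0 \<le> r \<Longrightarrow>
       real (restarts P r (mu k (xk P s k)) (xk P s k)) \<le> log 2 (c * (1 / (delta * eps)) ^ 20) + 1"
    using uniform_restarts_bound[OF dmax r0] by blast
  \<comment> \<open>Below \<open>e1\<close> the logarithm exceeds the additive constant \<open>log 2 c + 1\<close>; below \<open>e2\<close> rounding up
    the number of outer iterations costs at most one more unit of \<open>L\<^sub>f \<Delta> / \<epsilon>\<^sup>2\<close>. For \<open>\<Delta> = 0\<close> that number
    is \<open>0\<close> and any positive value of \<open>e2\<close> will do.\<close>
  define e1 where "e1 = exp (- (log 2 c + 1)) / dmax"
  define e2 where "e2 = (if DeltaF0 P = 0 then 1 else sqrt (Lf P * DeltaF0 P))"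
  define b where "b = min (min (sqrt (3 * Lf P)) 1) (min e1 e2)"
  have "b > 0" using Lf_pos DeltaF0_nonneg dmax by (simp add: b_def e1_def e2_def)
  have "real (if good eps delta then inner_total P (s eps delta) (Kbar P eps) else 0)
        \<le> 15004 * (S * ln (B / (delta * eps)) * (Lf P * DeltaF0 P / eps\<^sup>2))"
    if eps: "0 < eps" "eps < b" and delta: "0 < delta" "delta \<le> dmax" for eps delta
  proof -
    have adm: "admissible P eps delta" using eps delta by (simp add: admissible_def b_def)
    define l where "l = ln (1 / (delta * eps))"
    have "delta * eps \<le> dmax * e1" using eps delta dmax by (intro mult_mono) (auto simp: b_def)
    also have "\<dots> = exp (- (log 2 c + 1))" using dmax by (simp add: e1_def)
    finally have "ln (delta * eps) \<le> - (log 2 c + 1)" using eps delta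
      by (metis exp_gt_zero ln_exp ln_le_cancel_iff mult_pos_pos)
    then have l: "log 2 c + 1 \<le> l" using eps delta by (simp add: l_def ln_div)
    have lc: "log 2 c \<ge> 0" using c(1) by simp
    have log_bound: "log 2 (c * (1 / (delta * eps)) ^ 20) + 1 \<le> 31 * l"
    proof -
      have log_eq: "log 2 (c * (1 / (delta * eps)) ^ 20) = log 2 c + 20 * (l / ln 2)"
      proof -
        have "ln (a * y ^ 20) = ln a + 20 * ln y" if "a > 0" "y > 0" for a y :: real
          using that by (simp add: ln_mult ln_realpow)
        then have "ln (c * (1 / (delta * eps)) ^ 20) = ln c + 20 * l"
          unfolding l_def using c(1) eps delta by simp
        then show ?thesis by (simp only: log_def add_divide_distrib times_divide_eq_right)
      qed
      have "l / ln 2 \<le> l / (2 / 3)"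
        using l lc ln2_ge_two_thirds by (intro divide_left_mono) auto
      then show ?thesis unfolding log_eq using l by simp
    qed
    have lB: "l \<le> ln (B / (delta * eps))"
      unfolding l_def using B eps delta by (subst ln_le_cancel_iff) (auto simp: divide_right_mono)
    have K: "real (Kbar P eps) \<le> 121 * (Lf P * DeltaF0 P / eps\<^sup>2)"
    proof (cases "DeltaF0 P = 0")
      case True then show ?thesis by (simp add: Kbar_def)
    next
      case False
      have "eps\<^sup>2 \<le> (sqrt (Lf P * DeltaF0 P))\<^sup>2"
        using eps False by (intro power_mono) (auto simp: b_def e2_def)
      then have "eps\<^sup>2 \<le> Lf P * DeltaF0 P" using Lf_pos DeltaF0_nonneg by simp
      then have "real (Kbar P eps) * eps\<^sup>2 \<le> 121 * (Lf P * DeltaF0 P)"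
        using Kbar_bounds(2)[OF eps(1)] by simp
      then show ?thesis using eps by (simp add: pos_le_divide_eq)
    qed
    have rhs: "0 \<le> S * ln (B / (delta * eps)) * (Lf P * DeltaF0 P / eps\<^sup>2)"
      using S l lc lB Lf_pos DeltaF0_nonneg by simp
    show ?thesis
    proof (cases "good eps delta")
      case True
      let ?s = "s eps delta"
      have summand: "real (fst (?s k (xk P ?s k)) * snd (?s k (xk P ?s k))) \<le> 31 * l * (4 * S)"
        if k: "k < Kbar P eps" for k
      proof -
        have "real (fst (?s k (xk P ?s k))) \<le> 31 * l"
          unfolding restarts
          by (rule order_trans[OF c(2)[OF adm delta(2) ok[OF adm True] mu(1)[OF adm] mu(2)[OF adm] k r[OF adm True k]] log_bound])
        then show ?thesis using cycle[OF adm True k] l lc by (simp only: of_nat_mult) (intro mult_mono, auto)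
      qed
      have "real (inner_total P ?s (Kbar P eps)) = (\<Sum>k<Kbar P eps. real (fst (?s k (xk P ?s k)) * snd (?s k (xk P ?s k))))"
        by (simp only: inner_total_def of_nat_sum)
      also have "\<dots> \<le> (\<Sum>k<Kbar P eps. 31 * l * (4 * S))" using summand by (intro sum_mono) auto
      also have "\<dots> = real (Kbar P eps) * (124 * (S * l))" by simp
      also have "\<dots> \<le> (121 * (Lf P * DeltaF0 P / eps\<^sup>2)) * (124 * (S * ln (B / (delta * eps))))"
        using K lB S l lc Lf_pos DeltaF0_nonneg by (intro mult_mono) auto
      also have "\<dots> = 15004 * (S * ln (B / (delta * eps)) * (Lf P * DeltaF0 P / eps\<^sup>2))" by simp
      finally show ?thesis using True by simp
    qed (use rhs in simp)
  qed
  then show "\<forall>\<^sub>F eps in at_right 0. \<forall>delta\<in>{0<..dmax}.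
      real (if good eps delta then inner_total P (s eps delta) (Kbar P eps) else 0)
        \<le> 15004 * (S * ln (B / (delta * eps)) * (Lf P * DeltaF0 P / eps\<^sup>2))"
    unfolding eventually_at_right_field using \<open>b > 0\<close> by (intro exI[of _ b]) auto
qed

end

section \<open>Complexity in the three cases\<close>

context pg_problem begin

lemma admissible_exists: "\<exists>eps. admissible P eps 1"
proof -
  have "admissible P (min (sqrt (3 * Lf P)) 1 / 2) 1"
    using Lf_pos by (auto simp: admissible_def min_def)
  then show ?thesis by blast
qed

lemma mu_const_bounds:
  assumes "admissible P eps delta"
  shows "mu_const P eps delta k x > 0" "mu_const P eps delta k x \<le> mubar P eps delta x"
    "1 / (real k + 1)\<^sup>2 * mubar P eps delta x \<le> mu_const P eps delta k x"
  using mubar_pos[OF assms, of x] by (auto simp: mu_const_def divide_le_eq mult_le_cancel_left1)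

lemma mu_decay_bounds:
  assumes "admissible P eps delta"
  shows "mu_decay P eps delta k x > 0" "mu_decay P eps delta k x \<le> mubar P eps delta x"
  using mubar_pos[OF assms, of x] mu_const_bounds(3)[OF assms, of k x]
  by (auto simp: mu_decay_def mu_const_def)

lemma rank_cycle_length:
  assumes rank: "rank (matB P) = CARD('m + 'n)"
  shows "kappaD P > 0" "2 * sqrt (2 * LD P / kappaD P) = 2 * sqrt 2 * kappa (matB P)" "kappa (matB P) \<ge> 1"
proof -
  note l = gram_quadratic_ge_lam_min_pos[of "matB P", OF full_row_rank_transpose_inj[OF rank]]
  show "kappaD P > 0" using l(2) tau_pos by (simp add: kappaD_def)
  have "LD P / kappaD P = lam_max (matB P ** transpose (matB P)) / lam_min_pos (matB P ** transpose (matB P))"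
    using tau_pos by (simp add: LD_def kappaD_def)
  then show "2 * sqrt (2 * LD P / kappaD P) = 2 * sqrt 2 * kappa (matB P)"
    by (simp add: kappa_def real_sqrt_mult real_sqrt_divide flip: times_divide_eq_right)
  show "kappa (matB P) \<ge> 1" unfolding kappa_def using l(2,3) by simp
qed

lemma step1_ok_sched_rank:
  assumes rank: "rank (matB P) = CARD('m + 'n)" and mu: "\<And>x. mu k x > 0"
  shows "step1_ok P (sched_rank P mu) mu k"
proof -
  let ?x = "xk P (sched_rank P mu) k" and ?j = "nat \<lceil>2 * sqrt 2 * kappa (matB P)\<rceil>"
  have "fst (restarted_apg P ?x (restarts P (kappaD P) (mu k ?x) ?x) ?j) \<in> edom (conjugate (gfun P)) \<and>
      edist (restarted_apg P ?x (restarts P (kappaD P) (mu k ?x) ?x) ?j) (Omega P ?x) \<le> ereal (mu k ?x)"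
  proof (rule solve_dual_accuracy[OF Omega_nonempty_of_full_rank[OF rank] rank_cycle_length(1)[OF rank] mu])
    show "kappaD P / 2 * (infdist z (Omega P ?x))\<^sup>2 \<le> dual_val P ?x z - dual_val P ?x s"
      if "z \<in> dual_dom P" "s \<in> Omega P ?x" for z s
      using growth_of_full_rank[OF rank that(2,1)] .
    show "2 * sqrt (2 * LD P / kappaD P) \<le> real ?j"
      unfolding rank_cycle_length(2)[OF rank] by linarith
  qed
  then show ?thesis by (simp add: step1_ok_def solve_dual_def sched_rank_def Let_def)
qed

theorem full_rank_complexity:
  assumes rank: "rank (matB P) = CARD('m + 'n)"
  defines "s \<equiv> \<lambda>eps delta. sched_rank P (mu_const P eps delta)"
  shows "admissible P eps delta \<Longrightarrow> step1_ok P (s eps delta) (mu_const P eps delta) k"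
    and "admissible P eps delta \<Longrightarrow> finds_kkt P (s eps delta) eps delta"
    and "bigO_eps 15004 (\<lambda>eps delta. inner_total P (s eps delta) (Kbar P eps))
           (\<lambda>eps delta. kappa (matB P) * ln (1 / (delta * eps)) * (Lf P * DeltaF0 P / eps\<^sup>2))"
proof -
  show ok: "step1_ok P (s eps delta) (mu_const P eps delta) k"
    if "admissible P eps delta" for eps delta k
    unfolding s_def by (rule step1_ok_sched_rank[OF rank mu_const_bounds(1)[OF that]])
  show "finds_kkt P (s eps delta) eps delta" if "admissible P eps delta"
    by (rule finds_kkt_of_accurate_steps[OF that ok[OF that] mu_const_bounds(2)[OF that]
          Omega_nonempty_of_full_rank[OF rank]])
  have "bigO_eps 15004
      (\<lambda>eps delta. real (if True then inner_total P (s eps delta) (Kbar P eps) else 0))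
      (\<lambda>eps delta. kappa (matB P) * ln (1 / (delta * eps)) * (Lf P * DeltaF0 P / eps\<^sup>2))"
  proof (rule inner_total_bigO[where good = "\<lambda>_ _. True" and r = "\<lambda>_. kappaD P" and mu = "mu_const P",
        OF rank_cycle_length(3)[OF rank] order_refl rank_cycle_length(1)[OF rank] ok
          mu_const_bounds(2) mu_const_bounds(3) order_refl])
    show "real (snd (s eps delta k (xk P (s eps delta) k))) \<le> 4 * kappa (matB P)" for eps delta k
      unfolding s_def sched_rank_def snd_conv
      by (rule ceiling_nat_le[OF rank_cycle_length(3)[OF rank] order_refl])
  qed (auto simp: s_def sched_rank_def)
  then show "bigO_eps 15004 (\<lambda>eps delta. inner_total P (s eps delta) (Kbar P eps))
           (\<lambda>eps delta. kappa (matB P) * ln (1 / (delta * eps)) * (Lf P * DeltaF0 P / eps\<^sup>2))" by simp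
qed

lemma step1_ok_sched_hoffman:
  fixes C :: "real^'m^'p::finite"
  assumes sup: "support_function_of (gfun P) C dv"
    and hof: "hoffman P C dv theta (xk P (sched_hoffman P theta w mu) k)"
    and theta: "theta > 0" and w: "w \<ge> 0" "w \<ge> 2 / tau P \<or> (vecbbar P = 0 \<and> vecb P = 0)"
    and mu: "\<And>x. mu k x > 0"
  shows "step1_ok P (sched_hoffman P theta w mu) mu k"
proof -
  let ?x = "xk P (sched_hoffman P theta w mu) k"
  let ?r = "rho P theta w ?x"
  let ?j = "nat \<lceil>2 * sqrt (2 * LD P / ?r)\<rceil>"
  note ne = Omega_nonempty_of_hoffman[OF hof]
  have "fst (restarted_apg P ?x (restarts P ?r (mu k ?x) ?x) ?j) \<in> edom (conjugate (gfun P)) \<and>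
      edist (restarted_apg P ?x (restarts P ?r (mu k ?x) ?x) ?j) (Omega P ?x) \<le> ereal (mu k ?x)"
  proof (rule solve_dual_accuracy[OF ne rho_pos[OF ne theta w(1)] mu])
    show "?r / 2 * (infdist z (Omega P ?x))\<^sup>2 \<le> dual_val P ?x z - dual_val P ?x s"
      if "z \<in> dual_dom P" "dual_val P ?x z \<le> dual_val P ?x (zini P)" "s \<in> Omega P ?x" for z s
      using growth_of_hoffman[OF sup hof theta w(2) that(3,1,2)] .
    show "2 * sqrt (2 * LD P / ?r) \<le> real ?j" by linarith
  qed
  then show ?thesis by (simp add: step1_ok_def solve_dual_def sched_hoffman_def Let_def)
qed

text \<open>
  Test the inequality at a minimiser shifted along the second block. Without shifts only the residual
  \<open>B\<^sup>T (0, v)\<close> is left on the right side, and every minimiser is at least as far away as this residual divided by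
  \<open>\<surd>\<lambda>\<^sub>m\<^sub>a\<^sub>x\<close>.
\<close>

lemma hoffman_constant_lower_bound:
  fixes C :: "real^'m^'p::finite"
  assumes sup: "support_function_of (gfun P) C dv" and hof: "hoffman P C dv theta x"
    and theta: "theta > 0" and b: "vecbbar P = 0" "vecb P = 0"
  shows "1 \<le> lam_max (matB P ** transpose (matB P)) * theta\<^sup>2"
proof -
  let ?l = "lam_max (matB P ** transpose (matB P))"
  have ne: "Omega P x \<noteq> {}" by (rule Omega_nonempty_of_hoffman[OF hof])
  then obtain s where s: "s \<in> Omega P x" by blast
  obtain v where v: "stack_adj P (0, v) \<noteq> 0" using stack_adj_nonzero by blast
  define z where "z = s + (0, v)"
  let ?r = "norm (stack_adj P (0, v))"
  have zd: "z \<in> dual_dom P" using s by (simp add: z_def Omega_iff dual_dom_def)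
  have res: "dres P x z - nu P x = stack_adj P (0, v)" by (simp add: z_def dres_add nu_eq[OF s])
  have in_polyhedron: "(\<chi> i. max 0 ((C *v fst z - dv) $ i)) = 0"
    using support_function_conjugate(1)[OF gfun(1) sup, of "fst z"] zd
    by (auto simp: vec_eq_iff dual_dom_def max_def intro: antisym)
  have "edist z (Omega P x) \<le> ereal (theta * norm (stack_adj P (0, v), 0 :: real^'p))"
    using hof[unfolded hoffman_def Let_def, rule_format, of z] unfolding in_polyhedron res using b by simp
  then have dist: "infdist z (Omega P x) \<le> theta * ?r"
    using edist_eq_infdist[OF ne, of z] by (simp add: norm_Pair)
  have "?r\<^sup>2 \<le> ?l * (dist z u)\<^sup>2" if u: "u \<in> Omega P x" for u
  proof -
    have "stack_adj P (z - u) = stack_adj P (0, v)"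
      using res dres_add[of P x u "z - u"] by (simp add: nu_eq[OF u])
    then show ?thesis using norm_stack_adj_sq_le[of P "z - u"] by (simp add: dist_norm)
  qed
  from le_infdist_sq[OF ne lam_max_B_pos this]
  have "?r\<^sup>2 \<le> ?l * (infdist z (Omega P x))\<^sup>2" by simp
  also have "\<dots> \<le> ?l * (theta * ?r)\<^sup>2"
    using dist lam_max_B_pos by (intro mult_left_mono power_mono infdist_nonneg) auto
  finally have "1 * ?r\<^sup>2 \<le> (?l * theta\<^sup>2) * ?r\<^sup>2" by (simp add: power_mult_distrib)
  then show ?thesis using v by (simp only: mult_le_cancel_right) auto
qed

theorem polyhedral_complexity_homogeneous:
  fixes C :: "real^'m^'p::finite"
  assumes sup: "support_function_of (gfun P) C dv" and b: "vecbbar P = 0" "vecb P = 0"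
    and theta: "theta > 0"
  defines "s \<equiv> \<lambda>eps delta. sched_hoffman P theta (2 * tau P) (mu_const P eps delta)"
  assumes hof: "\<And>eps delta k. admissible P eps delta \<Longrightarrow> hoffman P C dv theta (xk P (s eps delta) k)"
  shows "admissible P eps delta \<Longrightarrow> step1_ok P (s eps delta) (mu_const P eps delta) k"
    and "admissible P eps delta \<Longrightarrow> finds_kkt P (s eps delta) eps delta"
    and "bigO_eps 15004 (\<lambda>eps delta. inner_total P (s eps delta) (Kbar P eps))
           (\<lambda>eps delta. sqrt (lam_max (matB P ** transpose (matB P)) * theta\<^sup>2)
              * ln (1 / (delta * eps)) * (Lf P * DeltaF0 P / eps\<^sup>2))"
proof -
  let ?S = "sqrt (lam_max (matB P ** transpose (matB P)) * theta\<^sup>2)"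
  have w: "0 \<le> 2 * tau P" using tau_pos by simp
  obtain eps0 where adm0: "admissible P eps0 1" using admissible_exists by blast
  have S: "?S \<ge> 1"
    using hoffman_constant_lower_bound[OF sup hof[OF adm0] theta b] by simp
  have rho: "rho P theta (2 * tau P) x = inverse (theta\<^sup>2 * tau P)" for x
    using b by (simp add: rho_def)
  have r0: "inverse (theta\<^sup>2 * tau P) > 0" using theta tau_pos by simp
  have cyc: "2 * sqrt (2 * LD P / inverse (theta\<^sup>2 * tau P)) \<le> 2 * sqrt 2 * ?S"
  proof -
    have "2 * LD P / inverse (theta\<^sup>2 * tau P) = 2 * (lam_max (matB P ** transpose (matB P)) * theta\<^sup>2)"
      using tau_pos by (simp add: LD_def divide_inverse)
    then show ?thesis by (simp only: real_sqrt_mult mult.assoc order_refl)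
  qed
  show ok: "step1_ok P (s eps delta) (mu_const P eps delta) k"
    if "admissible P eps delta" for eps delta k
    using step1_ok_sched_hoffman[OF sup hof[OF that, unfolded s_def] theta w _ mu_const_bounds(1)[OF that]] b
    unfolding s_def by blast
  show "finds_kkt P (s eps delta) eps delta" if adm: "admissible P eps delta"
  proof (rule finds_kkt_of_accurate_steps[OF adm ok[OF adm] mu_const_bounds(2)[OF adm]])
    show "Omega P (xini P) \<noteq> {}" using Omega_nonempty_of_hoffman[OF hof[OF adm, of 0]] by simp
  qed
  have "bigO_eps 15004
      (\<lambda>eps delta. real (if True then inner_total P (s eps delta) (Kbar P eps) else 0))
      (\<lambda>eps delta. ?S * ln (1 / (delta * eps)) * (Lf P * DeltaF0 P / eps\<^sup>2))"
  proof (rule inner_total_bigO[where good = "\<lambda>_ _. True" and r = "rho P theta (2 * tau P)" and mu = "mu_const P",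
        OF S order_refl r0 ok mu_const_bounds(2) mu_const_bounds(3)])
    show "real (snd (s eps delta k (xk P (s eps delta) k))) \<le> 4 * ?S" for eps delta k
      unfolding s_def sched_hoffman_def snd_conv rho by (rule ceiling_nat_le[OF S cyc])
  qed (auto simp: s_def sched_hoffman_def rho)
  then show "bigO_eps 15004 (\<lambda>eps delta. inner_total P (s eps delta) (Kbar P eps))
      (\<lambda>eps delta. ?S * ln (1 / (delta * eps)) * (Lf P * DeltaF0 P / eps\<^sup>2))" by simp
qed

text \<open>
  \<open>B\<^sub>5\<close> comes from \<open>\<nu> = - \<tau> u\<close> with bounded exact points \<open>u\<close>, and \<open>B\<^sub>6\<close> from the quadratic bound of the gap. Enlarging
  \<open>B\<^sub>6\<close> to at least \<open>1\<close> and \<open>\<tau> / (\<lambda>\<^sub>m\<^sub>a\<^sub>x \<theta>\<^sup>2)\<close> makes the logarithm at least \<open>ln (1 / (\<delta> \<epsilon>))\<close> and the square root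
  at least \<open>1\<close>, so that the latter absorbs the rounding of the cycle length.
  \<open>B\<^sub>5\<close> and \<open>B\<^sub>6\<close> depend on neither \<open>\<epsilon>\<close> nor \<open>\<delta>\<close>, since the radius \<open>R\<close> does not.
\<close>

theorem polyhedral_complexity_compact_level:
  fixes C :: "real^'m^'p::finite"
  assumes sup: "support_function_of (gfun P) C dv"
    and compact: "compact {(x, y). Fsplit P x y \<le> Fsplit P (xini P) (yini P) + 1}"
    and theta: "theta > 0" and w: "w \<ge> 0"
  defines "s \<equiv> \<lambda>eps delta. sched_hoffman P theta w (mu_decay P eps delta)"
  defines "acc \<equiv> \<lambda>eps delta. \<forall>k<Kbar P eps. step1_ok P (s eps delta) (mu_decay P eps delta) k"
  assumes hof: "\<And>eps delta k. admissible P eps delta \<Longrightarrow> hoffman P C dv theta (xk P (s eps delta) k)"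
  shows "w \<ge> 2 / tau P \<or> (vecbbar P = 0 \<and> vecb P = 0) \<Longrightarrow> admissible P eps delta \<Longrightarrow> acc eps delta"
    and "\<exists>B5\<ge>0. \<exists>B6>0.
      (\<forall>eps delta. admissible P eps delta \<and> acc eps delta \<longrightarrow>
         (\<forall>k<Kbar P eps. (norm (nu P (xk P (s eps delta) k)))\<^sup>2 \<le> B5 \<and> gap P (xk P (s eps delta) k) \<le> B6) \<and>
         finds_kkt P (s eps delta) eps delta) \<and>
      bigO_eps 15004 (\<lambda>eps delta. if acc eps delta then inner_total P (s eps delta) (Kbar P eps) else 0)
        (\<lambda>eps delta. sqrt (lam_max (matB P ** transpose (matB P)) * theta\<^sup>2 * (1 + B6 / tau P + w / tau P * B5))
           * ln (B6 / (delta * eps)) * (Lf P * DeltaF0 P / eps\<^sup>2))"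
proof -
  let ?l = "lam_max (matB P ** transpose (matB P))"
  show "acc eps delta"
    if "w \<ge> 2 / tau P \<or> (vecbbar P = 0 \<and> vecb P = 0)" and adm: "admissible P eps delta"
    unfolding acc_def s_def
    using step1_ok_sched_hoffman[OF sup hof[OF adm, unfolded s_def] theta w that(1) mu_decay_bounds(1)[OF adm]] by blast
  obtain R where R: "R > 0"
    "\<And>eps delta s mu k. admissible P eps delta \<Longrightarrow> (\<And>k. k < Kbar P eps \<Longrightarrow> step1_ok P s mu k) \<Longrightarrow>
       (\<And>k x. mu k x \<le> 1 / (real k + 1)\<^sup>2 * mubar P eps delta x) \<Longrightarrow> k \<le> Kbar P eps \<Longrightarrow>
       norm (exact_point s k) \<le> R \<and> norm (xk P s k) \<le> R"
    using iterates_bounded_of_compact_level[OF compact] by blast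
  obtain G where G: "G > 0" "\<And>x. Omega P x \<noteq> {} \<Longrightarrow> gap P x \<le> G * (1 + norm x)\<^sup>2"
    using gap_le_quadratic by blast
  define B5 where "B5 = (tau P * R)\<^sup>2"
  define B6 where "B6 = max 1 (max (G * (1 + R)\<^sup>2) (tau P / (?l * theta\<^sup>2)))"
  have B: "B5 \<ge> 0" "B6 \<ge> 1" "G * (1 + R)\<^sup>2 \<le> B6" "tau P / (?l * theta\<^sup>2) \<le> B6"
    by (auto simp: B5_def B6_def)
  have bounds: "(norm (nu P (xk P (s eps delta) k)))\<^sup>2 \<le> B5 \<and> gap P (xk P (s eps delta) k) \<le> B6"
    if adm: "admissible P eps delta" and acc: "acc eps delta" and k: "k < Kbar P eps" for eps delta k
  proof
    let ?s = "s eps delta"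
    have ok: "\<And>k. k < Kbar P eps \<Longrightarrow> step1_ok P ?s (mu_decay P eps delta) k" using acc by (simp add: acc_def)
    have mu: "\<And>k x. mu_decay P eps delta k x \<le> 1 / (real k + 1)\<^sup>2 * mubar P eps delta x"
      by (simp add: mu_decay_def)
    have x: "norm (xk P ?s k) \<le> R" "norm (exact_point ?s (Suc k)) \<le> R"
      using R(2)[OF adm ok mu, of k] R(2)[OF adm ok mu, of "Suc k"] k by auto
    have "nu P (xk P ?s k) = - tau P *\<^sub>R exact_point ?s (Suc k)" using tau_pos by (simp add: exact_step_def)
    then have "norm (nu P (xk P ?s k)) = tau P * norm (exact_point ?s (Suc k))" using tau_pos by simp
    also have "\<dots> \<le> tau P * R" using x(2) tau_pos by (intro mult_left_mono) auto
    finally show "(norm (nu P (xk P ?s k)))\<^sup>2 \<le> B5" unfolding B5_def by (intro power_mono) auto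
    have "gap P (xk P ?s k) \<le> G * (1 + norm (xk P ?s k))\<^sup>2" by (rule G(2)[OF inexact_step_error(1)[OF ok[OF k]]])
    also have "\<dots> \<le> G * (1 + R)\<^sup>2" using x(1) G(1) by (intro mult_left_mono power_mono) auto
    finally show "gap P (xk P ?s k) \<le> B6" using B(3) by linarith
  qed
  have finds: "finds_kkt P (s eps delta) eps delta"
    if adm: "admissible P eps delta" and acc: "acc eps delta" for eps delta
  proof (rule finds_kkt_of_accurate_steps[where mu = "mu_decay P eps delta", OF adm _ mu_decay_bounds(2)[OF adm]])
    show "Omega P (xini P) \<noteq> {}" using Omega_nonempty_of_hoffman[OF hof[OF adm, of 0]] by simp
  qed (use acc in \<open>simp add: acc_def\<close>)
  define E where "E = tau P + B6 + w * B5"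
  have E: "E > 0" using tau_pos B w by (simp add: E_def add_pos_nonneg)
  define S where "S = sqrt (?l * theta\<^sup>2 * (1 + B6 / tau P + w / tau P * B5))"
  have lt: "?l * theta\<^sup>2 > 0" using lam_max_B_pos theta by simp
  have S: "S \<ge> 1"
  proof -
    have "1 \<le> ?l * theta\<^sup>2 * (B6 / tau P)"
      using B(4) lt tau_pos by (simp add: field_simps)
    also have "\<dots> \<le> ?l * theta\<^sup>2 * (1 + B6 / tau P + w / tau P * B5)"
      using lt w tau_pos B(1) by (intro mult_left_mono) auto
    finally show ?thesis by (simp add: S_def)
  qed
  have r0: "inverse (theta\<^sup>2 * E) > 0" using theta E by simp
  have rho_ge: "inverse (theta\<^sup>2 * E) \<le> rho P theta w (xk P (s eps delta) k)"
    if adm: "admissible P eps delta" and acc: "acc eps delta" and k: "k < Kbar P eps" for eps delta k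
  proof -
    let ?x = "xk P (s eps delta) k"
    have g: "gap P ?x \<ge> 0" using gap_eq(2) Omega_nonempty_of_hoffman[OF hof[OF adm]] by blast
    have "w * (norm (nu P ?x))\<^sup>2 \<le> w * B5" using bounds[OF that] w by (intro mult_left_mono) auto
    then have "tau P + gap P ?x + w * (norm (nu P ?x))\<^sup>2 \<le> E" "tau P \<le> E"
      using bounds[OF that] w B by (auto simp: E_def)
    moreover have "0 < tau P + gap P ?x + w * (norm (nu P ?x))\<^sup>2" using tau_pos g w by (simp add: add_pos_nonneg)
    ultimately show ?thesis using theta tau_pos unfolding rho_def
      by (auto intro!: le_imp_inverse_le mult_left_mono)
  qed
  have cyc: "2 * sqrt (2 * LD P / r) \<le> 2 * sqrt 2 * S" if r: "inverse (theta\<^sup>2 * E) \<le> r" for r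
  proof -
    have "2 * LD P / r \<le> 2 * LD P / inverse (theta\<^sup>2 * E)"
      using r r0 LD_pos by (intro divide_left_mono) auto
    also have "\<dots> = 2 * (?l * theta\<^sup>2 * (1 + B6 / tau P + w / tau P * B5))"
      using tau_pos theta E by (simp add: LD_def E_def field_simps)
    finally have "sqrt (2 * LD P / r) \<le> sqrt 2 * S" unfolding S_def by (simp flip: real_sqrt_mult)
    then show ?thesis by simp
  qed
  have cycle_eq: "snd (s eps delta k x) = nat \<lceil>2 * sqrt (2 * LD P / rho P theta w x)\<rceil>" for eps delta k x
    by (simp add: s_def sched_hoffman_def)
  have "bigO_eps 15004
      (\<lambda>eps delta. real (if acc eps delta then inner_total P (s eps delta) (Kbar P eps) else 0))
      (\<lambda>eps delta. S * ln (B6 / (delta * eps)) * (Lf P * DeltaF0 P / eps\<^sup>2))"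
  proof (rule inner_total_bigO[where r = "rho P theta w" and mu = "mu_decay P", OF S B(2) r0 _ mu_decay_bounds(2) _ rho_ge])
    show "real (snd (s eps delta k (xk P (s eps delta) k))) \<le> 4 * S"
      if "admissible P eps delta" "acc eps delta" "k < Kbar P eps" for eps delta k
      unfolding cycle_eq by (rule ceiling_nat_le[OF S cyc[OF rho_ge[OF that]]])
  qed (auto simp: acc_def s_def sched_hoffman_def mu_decay_def)
  then have "bigO_eps 15004 (\<lambda>eps delta. if acc eps delta then inner_total P (s eps delta) (Kbar P eps) else 0)
      (\<lambda>eps delta. S * ln (B6 / (delta * eps)) * (Lf P * DeltaF0 P / eps\<^sup>2))" by simp
  then show "\<exists>B5\<ge>0. \<exists>B6>0.
      (\<forall>eps delta. admissible P eps delta \<and> acc eps delta \<longrightarrow>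
         (\<forall>k<Kbar P eps. (norm (nu P (xk P (s eps delta) k)))\<^sup>2 \<le> B5 \<and> gap P (xk P (s eps delta) k) \<le> B6) \<and>
         finds_kkt P (s eps delta) eps delta) \<and>
      bigO_eps 15004 (\<lambda>eps delta. if acc eps delta then inner_total P (s eps delta) (Kbar P eps) else 0)
        (\<lambda>eps delta. sqrt (?l * theta\<^sup>2 * (1 + B6 / tau P + w / tau P * B5))
           * ln (B6 / (delta * eps)) * (Lf P * DeltaF0 P / eps\<^sup>2))"
    unfolding S_def using B bounds finds
    by (intro exI[of _ B5] conjI exI[of _ B6]) auto
qed

end

theorem corollary3p8:
  "\<exists>c>0. \<forall>P :: ('d::finite, 'n::finite, 'm::finite) pgdata.
     standing_assumptions P \<and> algorithm_inputs P \<and> tau P = 2 * Lf P \<longrightarrow>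
     \<comment> \<open>(a)\<close>
     (let s = (\<lambda>eps delta. sched_rank P (mu_const P eps delta))
      in rank (matB P) = CARD('m + 'n) \<longrightarrow>
         (\<forall>eps delta. admissible P eps delta \<longrightarrow>
            (\<forall>k. step1_ok P (s eps delta) (mu_const P eps delta) k) \<and>
            finds_kkt P (s eps delta) eps delta) \<and>
         bigO_eps c (\<lambda>eps delta. inner_total P (s eps delta) (Kbar P eps))
           (\<lambda>eps delta. kappa (matB P) * ln (1 / (delta * eps)) * (Lf P * DeltaF0 P / eps\<^sup>2)))
     \<and> \<comment> \<open>(b)\<close>
     (\<forall>(C :: real^'m^'p::finite) dv theta.
        let s = (\<lambda>eps delta. sched_hoffman P theta (2 * tau P) (mu_const P eps delta))
        in support_function_of (gfun P) C dv \<and> vecbbar P = 0 \<and> vecb P = 0 \<and>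
           theta > 0 \<and>
           (\<forall>eps delta k. admissible P eps delta \<longrightarrow>
              hoffman P C dv theta (xk P (s eps delta) k)) \<longrightarrow>
           (\<forall>eps delta. admissible P eps delta \<longrightarrow>
              (\<forall>k. step1_ok P (s eps delta) (mu_const P eps delta) k) \<and>
              finds_kkt P (s eps delta) eps delta) \<and>
           bigO_eps c (\<lambda>eps delta. inner_total P (s eps delta) (Kbar P eps))
             (\<lambda>eps delta. sqrt (lam_max (matB P ** transpose (matB P)) * theta\<^sup>2)
                * ln (1 / (delta * eps)) * (Lf P * DeltaF0 P / eps\<^sup>2)))
     \<and> \<comment> \<open>(c); the source has \<open>w = 2 * tau P\<close>, for which \<open>w / tau P * B5 = 2 * B5\<close>\<close>
     (\<forall>(C :: real^'m^'p::finite) dv theta. \<forall>w\<in>{2 * tau P, 2 / tau P}.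
        let s = (\<lambda>eps delta. sched_hoffman P theta w (mu_decay P eps delta));
            acc = (\<lambda>eps delta. \<forall>k<Kbar P eps. step1_ok P (s eps delta) (mu_decay P eps delta) k)
        in support_function_of (gfun P) C dv \<and>
           compact {(x, y). Fsplit P x y \<le> Fsplit P (xini P) (yini P) + 1} \<and>
           theta > 0 \<and>
           (\<forall>eps delta k. admissible P eps delta \<longrightarrow>
              hoffman P C dv theta (xk P (s eps delta) k)) \<longrightarrow>
           (w \<ge> 2 / tau P \<or> (vecbbar P = 0 \<and> vecb P = 0) \<longrightarrow>
              (\<forall>eps delta. admissible P eps delta \<longrightarrow> acc eps delta)) \<and>
           (\<exists>B5\<ge>0. \<exists>B6>0.
              (\<forall>eps delta. admissible P eps delta \<and> acc eps delta \<longrightarrow>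
                 (\<forall>k<Kbar P eps. (norm (nu P (xk P (s eps delta) k)))\<^sup>2 \<le> B5 \<and>
                                 gap P (xk P (s eps delta) k) \<le> B6) \<and>
                 finds_kkt P (s eps delta) eps delta) \<and>
              bigO_eps c
                (\<lambda>eps delta. if acc eps delta
                   then inner_total P (s eps delta) (Kbar P eps) else 0)
                (\<lambda>eps delta. sqrt (lam_max (matB P ** transpose (matB P)) * theta\<^sup>2
                     * (1 + B6 / tau P + w / tau P * B5))
                   * ln (B6 / (delta * eps)) * (Lf P * DeltaF0 P / eps\<^sup>2))))"
proof (rule exI[of _ 15004], intro conjI allI impI, goal_cases)
  case 1 show ?case by simp
next
  case (2 P)
  then interpret pg_problem P by unfold_locales auto
  show ?case using full_rank_complexity unfolding Let_def by blast
next
  case (3 P C dv theta)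
  then interpret pg_problem P by unfold_locales auto
  show ?case unfolding Let_def using polyhedral_complexity_homogeneous[of C dv theta] by blast
next
  case (4 P C dv theta)
  then interpret pg_problem P by unfold_locales auto
  show ?case
  proof (rule ballI, goal_cases)
    case (1 w)
    then have w: "w \<ge> 0" using tau_pos by auto
    show ?case
      unfolding Let_def
    proof (intro impI, elim conjE, intro conjI impI allI, goal_cases)
      case (1 eps delta k)
      show ?case
        by (rule polyhedral_complexity_compact_level(1)[where C = C and dv = dv and theta = theta and w = w, rule_format])
          (use 1 w in \<open>assumption | blast\<close>)+
    next
      case 2
      show ?case
        by (rule polyhedral_complexity_compact_level(2)[where C = C and dv = dv and theta = theta and w = w])
          (use 2 w in \<open>assumption | blast\<close>)+
    qed
  qed
qed

end
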